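(* There is a $\tfrac32$-approximation algorithm for the non-preemptive variant running in time $\mathcal{O}(n\log(n+\Delta))$, where $\Delta=\max\{s_{\max},t_{\max}\}$ is the largest number of the input; i.e. for every instance it computes a feasible non-preemptive schedule with makespan at most $\tfrac32\,\mathrm{OPT}_{\mathrm{nonp}}$ in that time.
   Context: An instance consists of $m\in\mathbb{N}$ identical parallel machines, a set $J$ of $n$ jobs, a partition $J=C_1\,\dot\cup\,\dots\,\dot\cup\, C_c$ into $c$ nonempty classes, processing times $t_j\in\mathbb{N}$ and setup times $s_i\in\mathbb{N}$ ($i\in[c]$); $s_{\max}=\max_i s_i$, $t_{\max}=\max_j t_j$. On each machine at most one item is processed at a time; a setup of class $i$ of length $s_i$ must be processed whenever the machine starts processing jobs of class $i$ and whenever it switches from another class to class $i$; setups are not preempted. In the non-preemptive variant each job is processed without interruption on a single machine. $\mathrm{OPT}_{\mathrm{nonp}}$ is the minimum makespan. *)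

theory Defs
  imports Complex_Main
begin

(* Jobs are the numbers below num_jobs, classes the numbers below num_classes. *)

record batch_instance =
  num_machines :: nat
  num_jobs :: nat
  num_classes :: nat
  proc_time :: "nat \<Rightarrow> nat"
  class_of :: "nat \<Rightarrow> nat"
  setup_time :: "nat \<Rightarrow> nat"

definition class_jobs :: "batch_instance \<Rightarrow> nat \<Rightarrow> nat set" where
  "class_jobs I i = {j. j < num_jobs I \<and> class_of I j = i}"

(* The natural numbers of the problem start at 1, for the number of machines as well as for the
   times; in particular log (n + Delta) is at least log 2. *)

definition valid_instance :: "batch_instance \<Rightarrow> bool" where
  "valid_instance I \<longleftrightarrow>
     num_machines I \<ge> 1 \<and> num_jobs I \<ge> 1 \<and>
     (\<forall>j<num_jobs I. class_of I j < num_classes I) \<and>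
     (\<forall>i<num_classes I. class_jobs I i \<noteq> {}) \<and>
     (\<forall>j<num_jobs I. proc_time I j \<ge> 1) \<and>
     (\<forall>i<num_classes I. setup_time I i \<ge> 1)"

definition max_setup :: "batch_instance \<Rightarrow> nat" where
  "max_setup I = Max (setup_time I ` {..<num_classes I})"

definition max_proc :: "batch_instance \<Rightarrow> nat" where
  "max_proc I = Max (proc_time I ` {..<num_jobs I})"

definition Delta :: "batch_instance \<Rightarrow> nat" where
  "Delta I = max (max_setup I) (max_proc I)"


datatype item = Setup nat | Job nat

(* For each machine, the items it processes in order of processing, with their start times.
   An item occurs in one piece, so neither jobs nor setups are interrupted. *)

type_synonym schedule = "nat \<Rightarrow> (real \<times> item) list"

fun item_length :: "batch_instance \<Rightarrow> item \<Rightarrow> real" where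
  "item_length I (Setup i) = real (setup_time I i)"
| "item_length I (Job j) = real (proc_time I j)"

fun item_class :: "batch_instance \<Rightarrow> item \<Rightarrow> nat" where
  "item_class I (Setup i) = i"
| "item_class I (Job j) = class_of I j"

fun valid_item :: "batch_instance \<Rightarrow> item \<Rightarrow> bool" where
  "valid_item I (Setup i) \<longleftrightarrow> i < num_classes I"
| "valid_item I (Job j) \<longleftrightarrow> j < num_jobs I"

(* The last clause: directly before a job of class i comes a setup of class i or another job
   of class i. *)

definition machine_feasible :: "batch_instance \<Rightarrow> (real \<times> item) list \<Rightarrow> bool" where
  "machine_feasible I xs \<longleftrightarrow>
     (\<forall>(a, x) \<in> set xs. 0 \<le> a \<and> valid_item I x) \<and>
     sorted_wrt (\<lambda>(a, x) (b, y). a + item_length I x \<le> b) xs \<and>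
     (\<forall>k<length xs. \<forall>j. snd (xs ! k) = Job j \<longrightarrow>
        k > 0 \<and> item_class I (snd (xs ! (k - 1))) = class_of I j)"

definition feasible :: "batch_instance \<Rightarrow> schedule \<Rightarrow> bool" where
  "feasible I \<sigma> \<longleftrightarrow>
     (\<forall>u<num_machines I. machine_feasible I (\<sigma> u)) \<and>
     (\<forall>u\<ge>num_machines I. \<sigma> u = []) \<and>
     (\<forall>j<num_jobs I. (\<Sum>u<num_machines I. count_list (map snd (\<sigma> u)) (Job j)) = 1)"

definition makespan :: "batch_instance \<Rightarrow> schedule \<Rightarrow> real" where
  "makespan I \<sigma> =
     Max (insert 0 (\<Union>u<num_machines I. (\<lambda>(a, x). a + item_length I x) ` set (\<sigma> u)))"

(* For valid instances the infimum is a minimum: putting all jobs on one machine is feasible, and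
   starting all items as early as possible leaves only integral times to consider. *)

definition OPT_nonp :: "batch_instance \<Rightarrow> real" where
  "OPT_nonp I = Inf {makespan I \<sigma> | \<sigma>. feasible I \<sigma>}"


(* Algorithms are programs of a word RAM: a while language over finitely many arrays of words, in
   which a scalar is cell 0 of its array. Every constant, operation, memory access and test costs
   one time unit. All values, including addresses and intermediate results, have to stay
   below the word bound W; otherwise evaluation is undefined and the program has no run. *)

type_synonym state = "string \<Rightarrow> nat \<Rightarrow> nat"

datatype binop = Plus | Minus | Times | Divide | Less | Equal

datatype expr = Const nat | Read string expr | Bin binop expr expr

datatype com =
    Skip
  | Write string expr expr   (* array, index, value *)
  | Seq com com
  | Cond expr com com        (* nonzero means true *)
  | While expr com

(* Subtraction is truncated at 0, division is integer division. *)

fun binop_val :: "binop \<Rightarrow> nat \<Rightarrow> nat \<Rightarrow> nat" where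
  "binop_val Plus x y = x + y"
| "binop_val Minus x y = x - y"
| "binop_val Times x y = x * y"
| "binop_val Divide x y = x div y"
| "binop_val Less x y = (if x < y then 1 else 0)"
| "binop_val Equal x y = (if x = y then 1 else 0)"

definition word :: "nat \<Rightarrow> nat \<Rightarrow> nat option" where
  "word W x = (if x < W then Some x else None)"

fun expr_val :: "nat \<Rightarrow> state \<Rightarrow> expr \<Rightarrow> nat option" where
  "expr_val W s (Const x) = word W x"
| "expr_val W s (Read a e) =
     (case expr_val W s e of None \<Rightarrow> None | Some i \<Rightarrow> word W (s a i))"
| "expr_val W s (Bin f e1 e2) =
     (case expr_val W s e1 of None \<Rightarrow> None | Some x \<Rightarrow>
       (case expr_val W s e2 of None \<Rightarrow> None | Some y \<Rightarrow> word W (binop_val f x y)))"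

fun expr_cost :: "expr \<Rightarrow> nat" where
  "expr_cost (Const x) = 1"
| "expr_cost (Read a e) = 1 + expr_cost e"
| "expr_cost (Bin f e1 e2) = 1 + expr_cost e1 + expr_cost e2"

definition update :: "state \<Rightarrow> string \<Rightarrow> nat \<Rightarrow> nat \<Rightarrow> state" where
  "update s a i x = s(a := (s a)(i := x))"

(* exec W p s k s': program p started in s terminates in s' after exactly k time units. *)

inductive exec :: "nat \<Rightarrow> com \<Rightarrow> state \<Rightarrow> nat \<Rightarrow> state \<Rightarrow> bool" for W where
  Skip: "exec W Skip s 1 s"
| Write: "expr_val W s e1 = Some i \<Longrightarrow> expr_val W s e2 = Some x \<Longrightarrow>
    exec W (Write a e1 e2) s (1 + expr_cost e1 + expr_cost e2) (update s a i x)"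
| Seq: "exec W p s k s' \<Longrightarrow> exec W q s' l s'' \<Longrightarrow> exec W (Seq p q) s (k + l) s''"
| CondTrue: "expr_val W s b = Some x \<Longrightarrow> x \<noteq> 0 \<Longrightarrow> exec W p s k s' \<Longrightarrow>
    exec W (Cond b p q) s (1 + expr_cost b + k) s'"
| CondFalse: "expr_val W s b = Some 0 \<Longrightarrow> exec W q s k s' \<Longrightarrow>
    exec W (Cond b p q) s (1 + expr_cost b + k) s'"
| WhileFalse: "expr_val W s b = Some 0 \<Longrightarrow>
    exec W (While b p) s (1 + expr_cost b) s"
| WhileTrue: "expr_val W s b = Some x \<Longrightarrow> x \<noteq> 0 \<Longrightarrow> exec W p s k s' \<Longrightarrow>
    exec W (While b p) s' l s'' \<Longrightarrow>
    exec W (While b p) s (1 + expr_cost b + k + l) s''"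

inductive_cases exec_SkipE: "exec W Skip s k s'"
inductive_cases exec_WriteE: "exec W (Write a e1 e2) s k s'"
inductive_cases exec_SeqE: "exec W (Seq p q) s k s'"
inductive_cases exec_CondE: "exec W (Cond b p q) s k s'"
inductive_cases exec_WhileE: "exec W (While b p) s k s'"

lemma exec_deterministic:
  "exec W p s k s' \<Longrightarrow> exec W p s l s'' \<Longrightarrow> l = k \<and> s'' = s'"
proof (induction arbitrary: l s'' rule: exec.induct)
  case (Skip s)
  then show ?case by (rule exec_SkipE) simp
next
  case (Write s e1 i e2 x a)
  from Write.prems show ?case by (rule exec_WriteE) (simp add: Write.hyps)
next
  case (Seq p s k s1 q k' s2)
  from Seq.prems show ?case
  proof (rule exec_SeqE)
    fix i t j
    assume *: "l = i + j" "exec W p s i t" "exec W q t j s''"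
    from Seq.IH(1)[OF *(2)] have "i = k" "t = s1" by simp_all
    with Seq.IH(2)[of j s''] * show ?thesis by simp
  qed
next
  case (CondTrue s b x p k s1 q)
  from CondTrue.prems show ?case
  proof (rule exec_CondE)
    fix y i
    assume "l = Suc (expr_cost b + i)" "exec W p s i s''"
    with CondTrue.IH[of i s''] show ?thesis by simp
  qed (simp add: CondTrue.hyps)
next
  case (CondFalse s b q k s1 p)
  from CondFalse.prems show ?case
  proof (rule exec_CondE)
    fix i
    assume "l = Suc (expr_cost b + i)" "exec W q s i s''"
    with CondFalse.IH[of i s''] show ?thesis by simp
  qed (simp add: CondFalse.hyps)
next
  case (WhileFalse s b p)
  from WhileFalse.prems show ?case by (rule exec_WhileE) (simp_all add: WhileFalse.hyps)
next
  case (WhileTrue s b x p k s1 k' s2)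
  from WhileTrue.prems show ?case
  proof (rule exec_WhileE)
    fix y i t j
    assume *: "l = Suc (expr_cost b + i + j)" "exec W p s i t" "exec W (While b p) t j s''"
    from WhileTrue.IH(1)[OF *(2)] have "i = k" "t = s1" by simp_all
    with WhileTrue.IH(2)[of j s''] * show ?thesis by simp
  qed (simp add: WhileTrue.hyps)
qed


(* Cells outside the index ranges of the input are 0. *)

definition input_state :: "batch_instance \<Rightarrow> state" where
  "input_state I = (\<lambda>_ _. 0)
     (''m'' := (\<lambda>_. 0)(0 := num_machines I),
      ''n'' := (\<lambda>_. 0)(0 := num_jobs I),
      ''c'' := (\<lambda>_. 0)(0 := num_classes I),
      ''t'' := (\<lambda>j. if j < num_jobs I then proc_time I j else 0),
      ''class'' := (\<lambda>j. if j < num_jobs I then class_of I j else 0),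
      ''s'' := (\<lambda>i. if i < num_classes I then setup_time I i else 0))"

(* The output is a list of entries (machine, start, kind, id) of length ''len''; kind 0 is a
   job, every other kind a setup. The entries of one machine are listed in order of processing. *)

definition output_schedule :: "state \<Rightarrow> schedule" where
  "output_schedule s u =
     map (\<lambda>k. (real (s ''start'' k),
                if s ''kind'' k = 0 then Job (s ''id'' k) else Setup (s ''id'' k)))
       (filter (\<lambda>k. s ''machine'' k = u) [0..<s ''len'' 0])"

(* Words have O(log (n + m + Delta)) bits, for a constant d that depends only on the program.
   The base is at least 2 for valid instances. *)

definition word_bound :: "nat \<Rightarrow> batch_instance \<Rightarrow> nat" where
  "word_bound d I = (num_jobs I + num_machines I + Delta I) ^ d"

end

(* The optimum is an integer, so a binary search over integers T suffices together with a linear-time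
   test that either finds a schedule with makespan at most 3/2 T or certifies that no assignment of
   the jobs to the machines has all machine loads (setups included) at most T.

   A job j of class i is heavy if s_i + t_j > T/2. Two heavy jobs of different classes never share a
   machine, and neither do two jobs longer than T/2. The test gives every job longer than T/2 its own
   machine, puts the other heavy jobs on machines of their class with load below T and opens a new
   machine only if there is none; then each class has at most as many machines as its heavy jobs
   occupy in any assignment with loads at most T. Light jobs fill up the machines of their class to
   T. Those that do not fit are deferred; if a class has deferred jobs, then its machines carry load
   at least T each, so every assignment needs one more setup of that class. Finally the deferred jobs
   are distributed class by class over all machines with load below T. An item that would overrun T
   is charged to the current machine but placed on the next one together with a repeated setup; both
   take at most T/2, and comparing the charges with the total load m T shows that the machines
   suffice. *)

theory Submission
  imports Defs
begin

section \<open>Programs of the word RAM\<close>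

text \<open>The lower bound never compares schedules. \<open>fits I T f\<close> keeps only the
  assignment of jobs to machines and one setup per machine and class, so its loads are integers, and
  any makespan below T + 1 yields an assignment with loads at most T. The bounds on the number of
  machines are stated for every f with \<open>fits I T f\<close>. They hold for all T and are
  vacuous when T is too small, so running out of machines is itself the certificate of rejection.
  Only \<open>fits\<close> has to be monotone in T, not the test: a rejection raises the lower limit
  by a proved bound, an acceptance lowers the upper limit by a stored schedule.

  The time bound does not involve the number of machines, which may be far larger than the number of
  jobs. Hence no loop runs through all machines and no array indexed by machines is ever cleared.
  Loads left over from a previous value of T are overwritten when a machine is first used, and the
  number of machines opened in the first phase is bounded by the number of jobs.\<close>

fun ev :: "state \<Rightarrow> expr \<Rightarrow> nat" where
  "ev s (Const x) = x"
| "ev s (Read a e) = s a (ev s e)"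
| "ev s (Bin f e1 e2) = binop_val f (ev s e1) (ev s e2)"

text \<open>Without multiplication the value of an expression grows at most linearly: it is bounded
  by the size of the expression times a bound on the cells. The cap on constants matches the
  assumption \<open>5 \<le> B\<close>.\<close>

fun simple :: "expr \<Rightarrow> bool" where
  "simple (Const x) \<longleftrightarrow> x \<le> 5"
| "simple (Read a e) \<longleftrightarrow> simple e"
| "simple (Bin f e1 e2) \<longleftrightarrow> f \<noteq> Times \<and> simple e1 \<and> simple e2"

definition bounded :: "nat \<Rightarrow> state \<Rightarrow> bool" where
  "bounded B s \<longleftrightarrow> (\<forall>a i. s a i \<le> B)"

lemma ev_le:
  assumes "bounded B s" "5 \<le> B" "simple e"
  shows "ev s e \<le> expr_cost e * B"
  using assms(3)
proof (induction e)
  case (Const x)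
  then show ?case using assms(2) by simp
next
  case (Read a e)
  have "s a (ev s e) \<le> B" using assms(1) by (simp add: bounded_def)
  then show ?case by simp
next
  case (Bin f e1 e2)
  then have IH: "ev s e1 \<le> expr_cost e1 * B" "ev s e2 \<le> expr_cost e2 * B" by auto
  then show ?case using Bin.prems assms(2) div_le_dividend[of "ev s e1" "ev s e2"]
    by (cases f) (auto simp: algebra_simps simp del: div_le_dividend)
qed

lemma expr_val_ev:
  assumes "bounded B s" "5 \<le> B" "simple e" "expr_cost e * B < W"
  shows "expr_val W s e = Some (ev s e)"
  using assms(3,4)
proof (induction e)
  case (Const x)
  then show ?case using assms(2) by (auto simp: word_def)
next
  case (Read a e)
  have "s a (ev s e) \<le> B" using assms(1) by (simp add: bounded_def)
  with Read show ?case by (auto simp: word_def)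
next
  case (Bin f e1 e2)
  have "ev s (Bin f e1 e2) < W"
    using ev_le[OF assms(1,2) Bin.prems(1)] Bin.prems(2) by simp
  with Bin show ?case by (auto simp: word_def algebra_simps)
qed

text \<open>The cap 20 on the size of expressions goes with the assumption
  \<open>20 * B < W\<close>: then every intermediate result fits into a word as long as all cells
  are at most B.\<close>

fun plain :: "com \<Rightarrow> bool" where
  "plain Skip \<longleftrightarrow> True"
| "plain (Write a e1 e2) \<longleftrightarrow> simple e1 \<and> simple e2 \<and> expr_cost e1 \<le> 20 \<and> expr_cost e2 \<le> 20"
| "plain (Seq p q) \<longleftrightarrow> plain p \<and> plain q"
| "plain (Cond b p q) \<longleftrightarrow> simple b \<and> expr_cost b \<le> 20 \<and> plain p \<and> plain q"
| "plain (While b p) \<longleftrightarrow> False"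

text \<open>Adding both branches of a conditional overestimates the time, but makes the cost a
  constant of the program text.\<close>

fun cost :: "com \<Rightarrow> nat" where
  "cost Skip = 1"
| "cost (Write a e1 e2) = 1 + expr_cost e1 + expr_cost e2"
| "cost (Seq p q) = cost p + cost q"
| "cost (Cond b p q) = 1 + expr_cost b + cost p + cost q"
| "cost (While b p) = 0"

text \<open>The bound B is demanded of stored values only; values inside expressions are controlled
  by \<open>plain\<close>.\<close>

fun wp :: "nat \<Rightarrow> com \<Rightarrow> (state \<Rightarrow> bool) \<Rightarrow> state \<Rightarrow> bool" where
  "wp B Skip Q s \<longleftrightarrow> Q s"
| "wp B (Write a e1 e2) Q s \<longleftrightarrow> ev s e2 \<le> B \<and> Q (s(a := (s a)(ev s e1 := ev s e2)))"
| "wp B (Seq p q) Q s \<longleftrightarrow> wp B p (wp B q Q) s"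
| "wp B (Cond b p q) Q s \<longleftrightarrow> (if ev s b \<noteq> 0 then wp B p Q s else wp B q Q s)"
| "wp B (While b p) Q s \<longleftrightarrow> False"

definition runs :: "nat \<Rightarrow> nat \<Rightarrow> com \<Rightarrow> nat \<Rightarrow> (state \<Rightarrow> bool) \<Rightarrow> state \<Rightarrow> bool" where
  "runs B W p t Q s \<longleftrightarrow> (\<exists>k s'. exec W p s k s' \<and> k \<le> t \<and> bounded B s' \<and> Q s')"

lemma runs_plain:
  assumes "5 \<le> B" "20 * B < W"
  shows "plain p \<Longrightarrow> bounded B s \<Longrightarrow> wp B p Q s \<Longrightarrow> runs B W p (cost p) Q s"
proof (induction p arbitrary: s Q)
  case Skip
  then show ?case unfolding runs_def using exec.Skip[of W s] by auto
next
  case (Write a e1 e2)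
  have *: "expr_val W s e = Some (ev s e)" if "simple e" "expr_cost e \<le> 20" for e
  proof (rule expr_val_ev[OF Write.prems(2) assms(1) that(1)])
    have "expr_cost e * B \<le> 20 * B" using that(2) by simp
    then show "expr_cost e * B < W" using assms(2) by linarith
  qed
  have "exec W (Write a e1 e2) s (1 + expr_cost e1 + expr_cost e2)
      (update s a (ev s e1) (ev s e2))"
    by (rule exec.Write) (use * Write.prems in auto)
  then show ?case unfolding runs_def using Write.prems
    by (intro exI[of _ "1 + expr_cost e1 + expr_cost e2"]
        exI[of _ "update s a (ev s e1) (ev s e2)"]) (auto simp: update_def bounded_def)
next
  case (Seq p q)
  from Seq.IH(1)[of s "wp B q Q"] Seq.prems obtain k s1 where
    1: "exec W p s k s1" "k \<le> cost p" "bounded B s1" "wp B q Q s1" by (auto simp: runs_def)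
  from Seq.IH(2)[of s1 Q] Seq.prems 1 obtain k' s2 where
    2: "exec W q s1 k' s2" "k' \<le> cost q" "bounded B s2" "Q s2" by (auto simp: runs_def)
  show ?case unfolding runs_def using exec.Seq[OF 1(1) 2(1)] 1 2 
    by (intro exI[of _ "k + k'"] exI[of _ s2]) auto
next
  case (Cond b p q)
  have "expr_cost b * B \<le> 20 * B" using Cond.prems by simp
  with assms(2) have "expr_cost b * B < W" by linarith
  then have *: "expr_val W s b = Some (ev s b)"
    using expr_val_ev[OF Cond.prems(2) assms(1)] Cond.prems(1) by simp
  show ?case
  proof (cases "ev s b = 0")
    case True
    with Cond.IH(2)[of s Q] Cond.prems obtain k s1 where
      1: "exec W q s k s1" "k \<le> cost q" "bounded B s1" "Q s1" by (auto simp: runs_def)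
    then show ?thesis unfolding runs_def using exec.CondFalse[of W s b q k s1 p] * True
      by (intro exI[of _ "1 + expr_cost b + k"] exI[of _ s1]) auto
  next
    case False
    with Cond.IH(1)[of s Q] Cond.prems obtain k s1 where
      1: "exec W p s k s1" "k \<le> cost p" "bounded B s1" "Q s1" by (auto simp: runs_def)
    then show ?thesis unfolding runs_def using exec.CondTrue[of W s b _ p k s1 q] * False
      by (intro exI[of _ "1 + expr_cost b + k"] exI[of _ s1]) auto
  qed
qed simp

lemma runs_Seq:
  assumes "runs B W p t1 R s" "\<And>s'. bounded B s' \<Longrightarrow> R s' \<Longrightarrow> runs B W q t2 Q s'"
  shows "runs B W (Seq p q) (t1 + t2) Q s"
proof -
  from assms(1) obtain k s1 where
    1: "exec W p s k s1" "k \<le> t1" "bounded B s1" "R s1" by (auto simp: runs_def)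
  from assms(2)[OF 1(3,4)] obtain k' s2 where
    2: "exec W q s1 k' s2" "k' \<le> t2" "bounded B s2" "Q s2" by (auto simp: runs_def)
  show ?thesis unfolding runs_def using exec.Seq[OF 1(1) 2(1)] 1 2
    by (intro exI[of _ "k + k'"] exI[of _ s2]) auto
qed

lemma runs_mono:
  assumes "runs B W p t R s" "t \<le> t'" "\<And>s'. bounded B s' \<Longrightarrow> R s' \<Longrightarrow> Q s'"
  shows "runs B W p t' Q s"
  using assms unfolding runs_def by (meson le_trans)

text \<open>The index k of the invariant decreases in every round, so it bounds the number of
  rounds. Each round pays t for the body and at most 21 for the guard, and the last, failing guard
  pays 21 once more.\<close>

lemma runs_While:
  assumes B: "5 \<le> B" "20 * B < W" and b: "simple b" "expr_cost b \<le> 20"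
    and step: "\<And>k s. bounded B s \<Longrightarrow> Inv k s \<Longrightarrow> ev s b \<noteq> 0 \<Longrightarrow>
      runs B W p t (\<lambda>s'. \<exists>k'<k. Inv k' s') s"
  shows "bounded B s \<Longrightarrow> Inv (k :: nat) s \<Longrightarrow>
    runs B W (While b p) (k * (t + 21) + 21) (\<lambda>s'. (\<exists>k'. Inv k' s') \<and> ev s' b = 0) s"
proof (induction k arbitrary: s rule: less_induct)
  case (less k)
  have "expr_cost b * B \<le> 20 * B" using b(2) by simp
  with B(2) have "expr_cost b * B < W" by linarith
  then have *: "expr_val W s b = Some (ev s b)"
    using expr_val_ev[OF less.prems(1) B(1) b(1)] by simp
  show ?case
  proof (cases "ev s b = 0")
    case True
    then show ?thesis unfolding runs_def using exec.WhileFalse[of W s b p] * less.prems b(2)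
      by (intro exI[of _ "1 + expr_cost b"] exI[of _ s]) auto
  next
    case False
    from step[OF less.prems False] obtain l1 s1 k' where
      1: "exec W p s l1 s1" "l1 \<le> t" "bounded B s1" "Inv k' s1" "k' < k"
      by (auto simp: runs_def)
    from less.IH[OF 1(5,3,4)] obtain l s2 where
      2: "exec W (While b p) s1 l s2" "l \<le> k' * (t + 21) + 21" "bounded B s2" "\<exists>k'. Inv k' s2"
        "ev s2 b = 0" by (auto simp: runs_def)
    have "k' * (t + 21) + (t + 21) \<le> k * (t + 21)"
      using mult_le_mono1[of "Suc k'" k "t + 21"] 1(5) by simp
    then have "1 + expr_cost b + l1 + l \<le> k * (t + 21) + 21"
      using 1(2) 2(2) b(2) by linarith
    then show ?thesis unfolding runs_def
      using exec.WhileTrue[of W s b _ p l1 s1 l s2] * False 1 2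
      by (intro exI[of _ "1 + expr_cost b + l1 + l"] exI[of _ s2]) auto
  qed
qed

section \<open>Partial schedules and assignments\<close>

definition last_class :: "batch_instance \<Rightarrow> (real \<times> item) list \<Rightarrow> nat option" where
  "last_class I xs = (if xs = [] then None else Some (item_class I (snd (last xs))))"

definition ends_by :: "batch_instance \<Rightarrow> (real \<times> item) list \<Rightarrow> nat \<Rightarrow> bool" where
  "ends_by I xs L \<longleftrightarrow>
     machine_feasible I xs \<and> (\<forall>(a, x) \<in> set xs. a + item_length I x \<le> real L)"

text \<open>The load is an upper bound on the completion times of a machine and the start time of
  its next item. For an empty machine every value qualifies, so leftover array contents do no
  harm.\<close>

definition partial_schedule ::
  "batch_instance \<Rightarrow> schedule \<Rightarrow> (nat \<Rightarrow> nat) \<Rightarrow> nat set \<Rightarrow> bool" where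
  "partial_schedule I \<sigma> load P \<longleftrightarrow>
     (\<forall>u. ends_by I (\<sigma> u) (load u)) \<and> (\<forall>u\<ge>num_machines I. \<sigma> u = []) \<and>
     (\<forall>j<num_jobs I. (\<Sum>u<num_machines I. count_list (map snd (\<sigma> u)) (Job j)) =
        (if j \<in> P then 1 else 0))"

lemma machine_feasible_snoc:
  assumes "ends_by I xs L" "valid_item I x"
    "\<And>j. x = Job j \<Longrightarrow> last_class I xs = Some (class_of I j)"
  shows "machine_feasible I (xs @ [(real L, x)])"
proof -
  have "k > 0 \<and> item_class I (snd ((xs @ [(real L, x)]) ! (k - 1))) = class_of I j"
    if "k < length (xs @ [(real L, x)])" "snd ((xs @ [(real L, x)]) ! k) = Job j" for k j
  proof (cases "k = length xs")
    case True
    with that have "x = Job j" by simp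
    with assms(3) have "xs \<noteq> []" "item_class I (snd (last xs)) = class_of I j"
      by (auto simp: last_class_def split: if_splits)
    with True show ?thesis by (auto simp: nth_append last_conv_nth)
  next
    case False
    with that have "k < length xs" "snd (xs ! k) = Job j" by (auto simp: nth_append)
    with assms(1) have "k > 0 \<and> item_class I (snd (xs ! (k - 1))) = class_of I j"
      by (auto simp: ends_by_def machine_feasible_def)
    with \<open>k < length xs\<close> show ?thesis by (auto simp: nth_append)
  qed
  with assms(1,2) show ?thesis
    by (auto simp: ends_by_def machine_feasible_def sorted_wrt_append)
qed

lemma ends_by_setup:
  assumes "ends_by I xs L" "i < num_classes I"
  shows "ends_by I (xs @ [(real L, Setup i)]) (L + setup_time I i)"
  using machine_feasible_snoc[OF assms(1), of "Setup i"] assms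
  by (fastforce simp: ends_by_def)

lemma ends_by_job:
  assumes "ends_by I xs L" "j < num_jobs I" "last_class I xs = Some (class_of I j)"
  shows "ends_by I (xs @ [(real L, Job j)]) (L + proc_time I j)"
  using machine_feasible_snoc[OF assms(1), of "Job j"] assms
  by (fastforce simp: ends_by_def)

lemma last_class_snoc [simp]: "last_class I (xs @ [(a, x)]) = Some (item_class I x)"
  by (simp add: last_class_def)

lemma sum_update_add:
  fixes f :: "'a \<Rightarrow> nat"
  assumes "finite A" "u \<in> A"
  shows "sum (f(u := f u + d)) A = sum f A + d"
proof -
  have "sum (f(u := f u + d)) A = (f u + d) + sum (f(u := f u + d)) (A - {u})"
    using assms by (subst sum.remove[of _ u]) auto
  also have "sum (f(u := f u + d)) (A - {u}) = sum f (A - {u})"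
    by (rule sum.cong) auto
  also have "f u + d + \<dots> = sum f A + d" using assms by (subst sum.remove[of A u f]) auto
  finally show ?thesis .
qed

lemma partial_schedule_setup:
  assumes "partial_schedule I \<sigma> load P" "u < num_machines I" "i < num_classes I"
  shows "partial_schedule I (\<sigma>(u := \<sigma> u @ [(real (load u), Setup i)]))
    (load(u := load u + setup_time I i)) P"
proof -
  have "(\<Sum>v<num_machines I. count_list (map snd ((\<sigma>(u := \<sigma> u @ [(real (load u), Setup i)])) v)) (Job j))
    = (\<Sum>v<num_machines I. count_list (map snd (\<sigma> v)) (Job j))" for j
    by (rule sum.cong) auto
  then show ?thesis using assms ends_by_setup[of I "\<sigma> u" "load u" i]
    by (auto simp: partial_schedule_def)
qed

lemma partial_schedule_job:
  assumes "partial_schedule I \<sigma> load P" "u < num_machines I" "j < num_jobs I" "j \<notin> P"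
    "last_class I (\<sigma> u) = Some (class_of I j)"
  shows "partial_schedule I (\<sigma>(u := \<sigma> u @ [(real (load u), Job j)]))
    (load(u := load u + proc_time I j)) (insert j P)"
proof -
  let ?\<sigma> = "\<sigma>(u := \<sigma> u @ [(real (load u), Job j)])"
  have "(\<Sum>v<num_machines I. count_list (map snd (?\<sigma> v)) (Job k)) =
    (\<Sum>v<num_machines I. count_list (map snd (\<sigma> v)) (Job k)) + (if k = j then 1 else 0)" for k
  proof -
    have "(\<Sum>v<num_machines I. count_list (map snd (?\<sigma> v)) (Job k)) =
      sum ((\<lambda>v. count_list (map snd (\<sigma> v)) (Job k))(u := count_list (map snd (\<sigma> u)) (Job k) +
        (if k = j then 1 else 0))) {..<num_machines I}"
      by (rule sum.cong) auto
    also have "\<dots> = (\<Sum>v<num_machines I. count_list (map snd (\<sigma> v)) (Job k)) + (if k = j then 1 else 0)"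
      using assms(2)
      by (intro sum_update_add[where f = "\<lambda>v. count_list (map snd (\<sigma> v)) (Job k)"]) auto
    finally show ?thesis .
  qed
  then show ?thesis using assms ends_by_job[of I "\<sigma> u" "load u" j]
    by (auto simp: partial_schedule_def)
qed

lemma partial_schedule_load_irrelevant:
  assumes "partial_schedule I \<sigma> load P" "\<sigma> u = []"
  shows "partial_schedule I \<sigma> (load(u := x)) P"
  using assms by (auto simp: partial_schedule_def ends_by_def)

lemma partial_schedule_complete:
  assumes "partial_schedule I \<sigma> load {..<num_jobs I}"
    "\<And>u. \<sigma> u \<noteq> [] \<Longrightarrow> 2 * load u \<le> 3 * T"
  shows "feasible I \<sigma>" "makespan I \<sigma> \<le> 3 / 2 * real T"
proof -
  show "feasible I \<sigma>" using assms(1)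
    by (auto simp: partial_schedule_def feasible_def ends_by_def)
  have "a + item_length I x \<le> 3 / 2 * real T" if "(a, x) \<in> set (\<sigma> u)" for u a x
  proof -
    have "a + item_length I x \<le> real (load u)"
      using assms(1) that by (auto simp: partial_schedule_def ends_by_def)
    moreover have "\<sigma> u \<noteq> []" using that by auto
    then have "2 * load u \<le> 3 * T" by (rule assms(2))
    then have "2 * real (load u) \<le> 3 * real T" by linarith
    ultimately show ?thesis by linarith
  qed
  then show "makespan I \<sigma> \<le> 3 / 2 * real T"
    unfolding makespan_def by (subst Max_le_iff) auto
qed

section \<open>Assignments as a lower bound for the optimum\<close>

definition fits :: "batch_instance \<Rightarrow> nat \<Rightarrow> (nat \<Rightarrow> nat) \<Rightarrow> bool" where
  "fits I T f \<longleftrightarrow> (\<forall>j<num_jobs I. f j < num_machines I) \<and>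
     (\<forall>u<num_machines I. (\<Sum>j | j < num_jobs I \<and> f j = u. proc_time I j) +
        (\<Sum>i \<in> class_of I ` {j. j < num_jobs I \<and> f j = u}. setup_time I i) \<le> T)"

lemma machine_feasible_length_sum:
  assumes "machine_feasible I xs" "xs \<noteq> []"
  shows "(\<Sum>x\<leftarrow>map snd xs. item_length I x) \<le> fst (last xs) + item_length I (snd (last xs))"
proof -
  have "sorted_wrt (\<lambda>(a, x) (b, y). a + item_length I x \<le> b) xs" "\<forall>(a, x) \<in> set xs. 0 \<le> a"
    using assms(1) by (auto simp: machine_feasible_def)
  then show ?thesis using assms(2)
  proof (induction xs rule: rev_induct)
    case (snoc y ys)
    show ?case
    proof (cases "ys = []")
      case True
      with snoc.prems show ?thesis by auto
    next
      case False
      have "(\<Sum>x\<leftarrow>map snd ys. item_length I x) \<le> fst (last ys) + item_length I (snd (last ys))"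
        using snoc False by (auto simp: sorted_wrt_append)
      moreover have "fst (last ys) + item_length I (snd (last ys)) \<le> fst y"
        using snoc.prems(1) False last_in_set[OF False]
        by (auto simp: sorted_wrt_append case_prod_beta)
      ultimately show ?thesis by simp
    qed
  qed simp
qed

text \<open>Going back from a job, each predecessor has the same class. The first item cannot be a
  job, so the walk meets a setup of that class.\<close>

lemma machine_feasible_setup_in:
  assumes "machine_feasible I xs" "k < length xs" "snd (xs ! k) = Job j"
  shows "Setup (class_of I j) \<in> snd ` set xs"
  using assms(2,3)
proof (induction k arbitrary: j)
  case 0
  then show ?case using assms(1) unfolding machine_feasible_def by blast
next
  case (Suc k)
  then have *: "item_class I (snd (xs ! k)) = class_of I j"
    using assms(1) unfolding machine_feasible_def by fastforce
  show ?case
  proof (cases "snd (xs ! k)")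
    case (Setup i)
    with * have "Setup (class_of I j) = snd (xs ! k)" by simp
    then show ?thesis using Suc.prems by simp
  next
    case (Job j')
    with * have "class_of I j' = class_of I j" by simp
    with Suc.IH[OF _ Job] Suc.prems show ?thesis by simp
  qed
qed

lemma sum_set_le_sum_list:
  fixes g :: "'a \<Rightarrow> real"
  assumes "\<And>x. 0 \<le> g x"
  shows "sum g (set xs) \<le> sum_list (map g xs)"
proof (induction xs)
  case (Cons x xs)
  then show ?case using assms[of x] by (cases "x \<in> set xs") (auto simp: insert_absorb)
qed simp

lemma item_length_nonneg [simp]: "0 \<le> item_length I x"
  by (cases x) auto

text \<open>Each job is sent to a machine on which it occurs. On a machine, these jobs and one setup
  for each of their classes are distinct items that do not overlap in time, so their total length is
  at most the makespan. Being an integer below T + 1, it is at most T.\<close>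

lemma feasible_imp_fits:
  assumes feas: "feasible I \<sigma>" and T: "makespan I \<sigma> < real (Suc T)"
  shows "\<exists>f. fits I T f"
proof -
  have "\<exists>u. u < num_machines I \<and> Job j \<in> snd ` set (\<sigma> u)" if "j < num_jobs I" for j
  proof -
    have "(\<Sum>u<num_machines I. count_list (map snd (\<sigma> u)) (Job j)) \<noteq> 0"
      using feas that by (simp add: feasible_def)
    then obtain u where "u < num_machines I" "count_list (map snd (\<sigma> u)) (Job j) \<noteq> 0"
      by (auto elim: sum.not_neutral_contains_not_neutral)
    then show ?thesis by (auto simp: count_list_0_iff)
  qed
  then obtain f where f: "\<And>j. j < num_jobs I \<Longrightarrow> f j < num_machines I \<and> Job j \<in> snd ` set (\<sigma> (f j))"
    by metis
  have "(\<Sum>j | j < num_jobs I \<and> f j = u. proc_time I j) +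
        (\<Sum>i \<in> class_of I ` {j. j < num_jobs I \<and> f j = u}. setup_time I i) \<le> T"
    if u: "u < num_machines I" for u
  proof (cases "\<sigma> u = []")
    case True
    have "{j. j < num_jobs I \<and> f j = u} = {}" using f True by force
    then show ?thesis by (simp only: sum.empty image_empty)
  next
    case False
    let ?A = "{j. j < num_jobs I \<and> f j = u}"
    have mf: "machine_feasible I (\<sigma> u)" using feas u by (simp add: feasible_def)
    have "Setup ` (class_of I ` ?A) \<subseteq> snd ` set (\<sigma> u)"
    proof clarsimp
      fix j assume "j < num_jobs I" "u = f j"
      then have "Job j \<in> set (map snd (\<sigma> u))" using f by simp
      then obtain k where "k < length (\<sigma> u)" "snd (\<sigma> u ! k) = Job j"
        by (metis in_set_conv_nth length_map nth_map)
      with machine_feasible_setup_in[OF mf] \<open>u = f j\<close>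
      show "Setup (class_of I j) \<in> snd ` set (\<sigma> (f j))" by blast
    qed
    moreover have "Job ` ?A \<subseteq> snd ` set (\<sigma> u)" using f by auto
    ultimately have sub: "Job ` ?A \<union> Setup ` (class_of I ` ?A) \<subseteq> snd ` set (\<sigma> u)" by blast
    have "real ((\<Sum>j\<in>?A. proc_time I j) + (\<Sum>i \<in> class_of I ` ?A. setup_time I i)) =
      sum (item_length I) (Job ` ?A) + sum (item_length I) (Setup ` (class_of I ` ?A))"
      by (simp add: sum.reindex inj_on_def)
    also have "\<dots> = sum (item_length I) (Job ` ?A \<union> Setup ` (class_of I ` ?A))"
      by (rule sum.union_disjoint[symmetric]) auto
    also have "\<dots> \<le> sum (item_length I) (snd ` set (\<sigma> u))"
      by (rule sum_mono2) (use sub in auto)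
    also have "\<dots> \<le> (\<Sum>x\<leftarrow>map snd (\<sigma> u). item_length I x)"
      using sum_set_le_sum_list[of "item_length I" "map snd (\<sigma> u)"] by simp
    also have "\<dots> \<le> fst (last (\<sigma> u)) + item_length I (snd (last (\<sigma> u)))"
      by (rule machine_feasible_length_sum[OF mf False])
    also have "\<dots> \<le> makespan I \<sigma>"
      unfolding makespan_def
    proof (rule Max_ge)
      show "fst (last (\<sigma> u)) + item_length I (snd (last (\<sigma> u))) \<in>
        insert 0 (\<Union>u<num_machines I. (\<lambda>(a, x). a + item_length I x) ` set (\<sigma> u))"
        using u last_in_set[OF False] by (force simp: case_prod_beta)
    qed auto
    finally show ?thesis using T by linarith
  qed
  with f show ?thesis unfolding fits_def by blast
qed

text \<open>The feasible schedule makes the set of makespans nonempty, as an infimum over the reals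
  requires. A makespan below T would give an assignment for T - 1.\<close>

lemma le_OPT_nonp:
  assumes "feasible I \<sigma>" "\<And>T' f. T' < T \<Longrightarrow> \<not> fits I T' f"
  shows "real T \<le> OPT_nonp I"
  unfolding OPT_nonp_def
proof (rule cInf_greatest)
  show "{makespan I \<sigma> |\<sigma>. feasible I \<sigma>} \<noteq> {}" using assms(1) by blast
next
  fix x assume "x \<in> {makespan I \<sigma> |\<sigma>. feasible I \<sigma>}"
  then obtain \<tau> where \<tau>: "x = makespan I \<tau>" "feasible I \<tau>" by blast
  show "real T \<le> x"
  proof (cases T)
    case 0
    have "0 \<le> makespan I \<tau>" unfolding makespan_def by (rule Max_ge) auto
    with 0 \<tau> show ?thesis by simp
  next
    case (Suc T')
    with assms(2)[of T'] feasible_imp_fits[OF \<tau>(2), of T'] \<tau>(1) show ?thesis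
      by fastforce
  qed
qed

lemma fits_mono:
  assumes "fits I T f" "T \<le> T'"
  shows "fits I T' f"
  using assms unfolding fits_def by fastforce

text \<open>Charging one setup per job covers one setup per class. This crude sum is the starting
  point of the search and needs only one pass over the jobs.\<close>

lemma fits_single_machine:
  assumes "valid_instance I"
  shows "fits I (\<Sum>j<num_jobs I. proc_time I j + setup_time I (class_of I j)) (\<lambda>_. 0)"
proof -
  have "(\<Sum>i \<in> class_of I ` {..<num_jobs I}. setup_time I i) \<le>
    (\<Sum>j<num_jobs I. setup_time I (class_of I j))"
    using sum_image_le[of "{..<num_jobs I}" "setup_time I" "class_of I"] by simp
  moreover have "{j. j < num_jobs I \<and> 0 = u} = (if u = 0 then {..<num_jobs I} else {})" for u :: nat
    by auto
  ultimately show ?thesis using assms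
    by (auto simp: fits_def valid_instance_def sum.distrib)
qed

section \<open>Opening machines for large jobs\<close>

lemma fits_subset:
  assumes "fits I T f" "X \<noteq> {}" "\<And>j. j \<in> X \<Longrightarrow> j < num_jobs I \<and> f j = u"
  shows "sum (proc_time I) X + sum (setup_time I) (class_of I ` X) \<le> T"
proof -
  let ?A = "{j. j < num_jobs I \<and> f j = u}"
  have "u < num_machines I" using assms by (auto simp: fits_def)
  have "X \<subseteq> ?A" using assms(3) by blast
  then have "sum (proc_time I) X \<le> sum (proc_time I) ?A"
    "sum (setup_time I) (class_of I ` X) \<le> sum (setup_time I) (class_of I ` ?A)"
    by (auto intro!: sum_mono2)
  moreover have "sum (proc_time I) ?A + sum (setup_time I) (class_of I ` ?A) \<le> T"
    using assms(1) \<open>u < num_machines I\<close> by (auto simp: fits_def)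
  ultimately show ?thesis by linarith
qed

lemma fits_job:
  assumes "fits I T f" "j < num_jobs I"
  shows "setup_time I (class_of I j) + proc_time I j \<le> T"
  using fits_subset[OF assms(1), of "{j}" "f j"] assms(2) by simp

lemma fits_pair:
  assumes "fits I T f" "j < num_jobs I" "j' < num_jobs I" "j \<noteq> j'" "f j = f j'"
  shows "setup_time I (class_of I j) + proc_time I j + proc_time I j' +
    (if class_of I j = class_of I j' then 0 else setup_time I (class_of I j')) \<le> T"
proof -
  have "sum (proc_time I) {j, j'} + sum (setup_time I) (class_of I ` {j, j'}) \<le> T"
    by (rule fits_subset[OF assms(1), of _ "f j"]) (use assms in auto)
  with assms(4) show ?thesis by (cases "class_of I j = class_of I j'") auto
qed

text \<open>Each machine that receives a job of X holds its share of X and one setup of class i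
  within T. So a machine has room for T minus one setup of the jobs of a class; moving the setups to
  the left avoids truncated subtraction.\<close>

lemma fits_class_load:
  assumes "fits I T f" "\<And>j. j \<in> X \<Longrightarrow> j < num_jobs I \<and> class_of I j = i"
  shows "sum (proc_time I) X + card (f ` X) * setup_time I i \<le> card (f ` X) * T"
proof -
  have fin: "finite X" by (rule finite_subset[of X "{..<num_jobs I}"]) (use assms(2) in auto)
  have "sum (proc_time I) X + card (f ` X) * setup_time I i =
    (\<Sum>v \<in> f ` X. sum (proc_time I) {j \<in> X. f j = v} + setup_time I i)"
    using sum.image_gen[OF fin, of "proc_time I" f] by (simp add: sum.distrib)
  also have "\<dots> \<le> (\<Sum>v \<in> f ` X. T)"
  proof (rule sum_mono)
    fix v assume "v \<in> f ` X"
    then have "{j \<in> X. f j = v} \<noteq> {}" "class_of I ` {j \<in> X. f j = v} = {i}"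
      using assms(2) by fastforce+
    moreover have "sum (proc_time I) {j \<in> X. f j = v} +
        sum (setup_time I) (class_of I ` {j \<in> X. f j = v}) \<le> T"
      by (rule fits_subset[OF assms(1) calculation(1)]) (use assms(2) in auto)
    ultimately show "sum (proc_time I) {j \<in> X. f j = v} + setup_time I i \<le> T"
      by simp
  qed
  finally show ?thesis by simp
qed

section \<open>Job categories and the machines that heavy jobs occupy\<close>

definition cat :: "batch_instance \<Rightarrow> nat \<Rightarrow> nat \<Rightarrow> nat" where
  "cat I T j = (if T < 2 * proc_time I j then 0
     else if T < 2 * (setup_time I (class_of I j) + proc_time I j) then 1 else 2)"

definition heavy :: "batch_instance \<Rightarrow> nat \<Rightarrow> nat \<Rightarrow> nat set" where
  "heavy I T i = {j. j < num_jobs I \<and> class_of I j = i \<and> cat I T j < 2}"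

lemma finite_heavy [simp]: "finite (heavy I T i)"
  by (simp add: heavy_def)

lemma fits_heavy_disjoint:
  assumes "fits I T f" "i \<noteq> i'"
  shows "f ` heavy I T i \<inter> f ` heavy I T i' = {}"
proof (rule ccontr)
  assume "\<not> ?thesis"
  then obtain j j' where *: "j \<in> heavy I T i" "j' \<in> heavy I T i'" "f j = f j'" by fastforce
  then have "j \<noteq> j'" "class_of I j \<noteq> class_of I j'" using assms(2) by (auto simp: heavy_def)
  with fits_pair[OF assms(1), of j j'] * show False
    by (auto simp: heavy_def cat_def split: if_splits)
qed

lemma fits_heavy_card:
  assumes "fits I T f"
  shows "(\<Sum>i<num_classes I. card (f ` heavy I T i)) \<le> num_machines I"
proof -
  have "(\<Sum>i<num_classes I. card (f ` heavy I T i)) = card (\<Union>i<num_classes I. f ` heavy I T i)"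
    using fits_heavy_disjoint[OF assms] by (intro card_UN_disjoint[symmetric]) auto
  also have "\<dots> \<le> card {..<num_machines I}"
    using assms by (intro card_mono) (auto simp: heavy_def fits_def)
  finally show ?thesis by simp
qed

lemma fits_inj_on_big:
  assumes "fits I T f"
  shows "inj_on f {j. j < num_jobs I \<and> cat I T j = 0}"
proof (rule inj_onI, rule ccontr)
  fix j j' assume *: "j \<in> {j. j < num_jobs I \<and> cat I T j = 0}"
    "j' \<in> {j. j < num_jobs I \<and> cat I T j = 0}" "f j = f j'" "j \<noteq> j'"
  with fits_pair[OF assms, of j j'] show False by (auto simp: cat_def split: if_splits)
qed

lemma finite_class_jobs [simp]: "finite (class_jobs I i)"
  by (simp add: class_jobs_def)

text \<open>Double counting of the setups: class i pays once per machine that holds one of its jobs,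
  and machine u pays once per class present on it.\<close>

lemma fits_total:
  assumes v: "valid_instance I" and f: "fits I T f"
  shows "(\<Sum>i<num_classes I. sum (proc_time I) (class_jobs I i) +
    card (f ` class_jobs I i) * setup_time I i) \<le> num_machines I * T"
proof -
  let ?m = "num_machines I" and ?c = "num_classes I"
  let ?A = "\<lambda>u. {j. j < num_jobs I \<and> f j = u}"
  have cl: "class_of I j < ?c" if "j < num_jobs I" for j
    using v that by (simp add: valid_instance_def)
  have fm: "f j < ?m" if "j < num_jobs I" for j
    using f that by (simp add: fits_def)
  have "(\<Sum>i<?c. sum (proc_time I) (class_jobs I i)) = sum (proc_time I) {..<num_jobs I}"
    using sum.group[of "{..<num_jobs I}" "{..<?c}" "class_of I" "proc_time I"] cl
    by (auto simp: class_jobs_def)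
  also have "\<dots> = (\<Sum>u<?m. sum (proc_time I) (?A u))"
    using sum.group[of "{..<num_jobs I}" "{..<?m}" f "proc_time I"] fm
    by (simp add: image_subset_iff)
  finally have 1: "(\<Sum>i<?c. sum (proc_time I) (class_jobs I i)) = (\<Sum>u<?m. sum (proc_time I) (?A u))" .
  have "card (f ` class_jobs I i) * setup_time I i =
    (\<Sum>u<?m. if u \<in> f ` class_jobs I i then setup_time I i else 0)" for i
  proof -
    have "(\<Sum>u<?m. if u \<in> f ` class_jobs I i then setup_time I i else 0) =
      (\<Sum>u \<in> {u \<in> {..<?m}. u \<in> f ` class_jobs I i}. setup_time I i)"
      by (rule sum.inter_filter[symmetric]) simp
    also have "{u \<in> {..<?m}. u \<in> f ` class_jobs I i} = f ` class_jobs I i"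
      using fm by (auto simp: class_jobs_def)
    finally show ?thesis by simp
  qed
  then have "(\<Sum>i<?c. card (f ` class_jobs I i) * setup_time I i) =
    (\<Sum>i<?c. \<Sum>u<?m. if u \<in> f ` class_jobs I i then setup_time I i else 0)"
    by simp
  also have "\<dots> = (\<Sum>u<?m. \<Sum>i<?c. if u \<in> f ` class_jobs I i then setup_time I i else 0)"
    by (rule sum.swap)
  also have "\<dots> = (\<Sum>u<?m. sum (setup_time I) (class_of I ` ?A u))"
  proof (rule sum.cong[OF refl])
    fix u
    have "(\<Sum>i<?c. if u \<in> f ` class_jobs I i then setup_time I i else 0) =
      sum (setup_time I) {i \<in> {..<?c}. u \<in> f ` class_jobs I i}"
      by (rule sum.inter_filter[symmetric]) simp
    also have "{i \<in> {..<?c}. u \<in> f ` class_jobs I i} = class_of I ` ?A u"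
      using cl by (auto simp: class_jobs_def)
    finally show "(\<Sum>i<?c. if u \<in> f ` class_jobs I i then setup_time I i else 0) =
      sum (setup_time I) (class_of I ` ?A u)" .
  qed
  finally have "(\<Sum>i<?c. sum (proc_time I) (class_jobs I i) + card (f ` class_jobs I i) * setup_time I i)
    = (\<Sum>u<?m. sum (proc_time I) (?A u) + sum (setup_time I) (class_of I ` ?A u))"
    using 1 by (simp add: sum.distrib)
  also have "\<dots> \<le> (\<Sum>u<?m. T)"
    using f by (intro sum_mono) (auto simp: fits_def)
  finally show ?thesis by simp
qed

section \<open>Invariant and steps of the first phase\<close>

definition opened :: "nat \<Rightarrow> (nat \<Rightarrow> nat) \<Rightarrow> nat \<Rightarrow> nat set" where
  "opened cnt mcl i = {u. u < cnt \<and> mcl u = i}"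

lemma finite_opened [simp]: "finite (opened cnt mcl i)"
  by (simp add: opened_def)

abbreviation deferred :: "(nat \<Rightarrow> nat list) \<Rightarrow> nat set" where
  "deferred res \<equiv> \<Union>i. set (res i)"

definition deferred_ok :: "batch_instance \<Rightarrow> nat \<Rightarrow> (nat \<Rightarrow> nat list) \<Rightarrow> bool" where
  "deferred_ok I T res \<longleftrightarrow> (\<forall>i. distinct (res i) \<and>
     (\<forall>j \<in> set (res i). j < num_jobs I \<and> class_of I j = i \<and> cat I T j = 2))"

text \<open>\<^term>\<open>D\<close> are the jobs handled so far, \<^term>\<open>mcl u\<close> is the class that machine \<^term>\<open>u\<close> was
  opened for, \<^term>\<open>stk i\<close> the machines of class \<^term>\<open>i\<close> with load below \<^term>\<open>T\<close>, and \<^term>\<open>res i\<close> the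
  deferred jobs of class \<^term>\<open>i\<close>.\<close>

locale phase1_inv =
  fixes I :: batch_instance and T :: nat and D :: "nat set" and load :: "nat \<Rightarrow> nat"
    and cnt :: nat and mcl :: "nat \<Rightarrow> nat" and stk res :: "nat \<Rightarrow> nat list" and \<sigma> :: schedule
  assumes sched: "partial_schedule I \<sigma> load (D - deferred res)"
    and processed: "D \<subseteq> {..<num_jobs I}" and cnt_le: "cnt \<le> num_machines I" "cnt \<le> card D"
    and unopened: "\<And>u. u \<ge> cnt \<Longrightarrow> \<sigma> u = []"
    and load_le: "\<And>u. u < cnt \<Longrightarrow> 2 * load u \<le> 3 * T"
    and mcl_less: "\<And>u. u < cnt \<Longrightarrow> mcl u < num_classes I"
    and last_mcl: "\<And>u. u < cnt \<Longrightarrow> last_class I (\<sigma> u) = Some (mcl u)"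
    and distinct_stk: "\<And>i. distinct (stk i)"
    and set_stk: "\<And>i. set (stk i) = {u \<in> opened cnt mcl i. load u < T}"
    and deferred: "deferred_ok I T res" "deferred res \<subseteq> D"
    and deferred_stk: "\<And>i. res i \<noteq> [] \<Longrightarrow> stk i = []"
    and class_load: "\<And>i. sum load (opened cnt mcl i) = card (opened cnt mcl i) * setup_time I i +
        sum (proc_time I) {j \<in> D - deferred res. class_of I j = i}"
    and opened_big: "\<And>i. (\<And>j. j \<in> D \<Longrightarrow> cat I T j = 0) \<Longrightarrow>
        card (opened cnt mcl i) \<le> card {j \<in> D. class_of I j = i}"
    and opened_heavy: "\<And>f i. fits I T f \<Longrightarrow> card (opened cnt mcl i) \<le> card (f ` heavy I T i)"

lemmas phase1_invD = phase1_inv.sched phase1_inv.processed phase1_inv.cnt_le phase1_inv.unopened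
  phase1_inv.load_le phase1_inv.mcl_less phase1_inv.last_mcl phase1_inv.distinct_stk
  phase1_inv.set_stk phase1_inv.deferred phase1_inv.deferred_stk phase1_inv.class_load
  phase1_inv.opened_big phase1_inv.opened_heavy

lemma phase1_init:
  assumes "\<And>u. \<sigma> u = []"
  shows "phase1_inv I T {} load 0 mcl (\<lambda>_. []) (\<lambda>_. []) \<sigma>"
proof -
  have "partial_schedule I \<sigma> load {}"
    using assms by (auto simp: partial_schedule_def ends_by_def machine_feasible_def)
  then show ?thesis using assms
    by unfold_locales (auto simp: opened_def deferred_ok_def)
qed

lemma phase1_put:
  assumes inv: "phase1_inv I T D load cnt mcl stk res \<sigma>"
    and j: "j < num_jobs I" "j \<notin> D" "cat I T j \<noteq> 0" and i: "i = class_of I j"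
    and stk: "stk i = u # us"
  shows "u < cnt" "u < num_machines I" "2 * (load u + proc_time I j) \<le> 3 * T"
    "phase1_inv I T (insert j D) (load(u := load u + proc_time I j)) cnt mcl
      (stk(i := if load u + proc_time I j < T then stk i else us)) res
      (\<sigma>(u := \<sigma> u @ [(real (load u), Job j)]))"
proof -
  let ?l = "load(u := load u + proc_time I j)"
  note I = phase1_invD[OF inv]
  have u: "u \<in> opened cnt mcl i" "load u < T" "u \<notin> set us"
    using I(9,10)[of i] stk by auto
  then show ucnt: "u < cnt" by (simp add: opened_def)
  then show um: "u < num_machines I" using I(3) by simp
  have "2 * proc_time I j \<le> T" using j(3) by (auto simp: cat_def split: if_splits)
  with u(2) show le: "2 * (load u + proc_time I j) \<le> 3 * T" by (simp add: distrib_left)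
  have jdef: "j \<notin> deferred res" using I(12) j(2) by blast
  have mu: "mcl u = i" using u by (simp add: opened_def)
  have ps: "partial_schedule I (\<sigma>(u := \<sigma> u @ [(real (load u), Job j)])) ?l (insert j (D - deferred res))"
    using I(1,8) j i ucnt mu by (intro partial_schedule_job[OF _ um]) auto
  have D: "insert j D - deferred res = insert j (D - deferred res)" using jdef by blast
  have finD: "finite D" using I(2) finite_subset by blast
  have rs: "res i = []" using I(13)[of i] stk by fastforce
  have sums: "sum ?l (opened cnt mcl k) = card (opened cnt mcl k) * setup_time I k +
      sum (proc_time I) {j' \<in> insert j (D - deferred res). class_of I j' = k}" for k
  proof (cases "k = i")
    case True
    then have "{j' \<in> insert j (D - deferred res). class_of I j' = k} =
      insert j {j' \<in> D - deferred res. class_of I j' = k}" using i by auto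
    moreover have "sum ?l (opened cnt mcl k) = sum load (opened cnt mcl k) + proc_time I j"
      using u True by (intro sum_update_add) auto
    ultimately show ?thesis using I(14)[of k] j(2) finD by simp
  next
    case False
    then have "sum ?l (opened cnt mcl k) = sum load (opened cnt mcl k)"
      using mu by (intro sum.cong) (auto simp: opened_def)
    moreover have "{j' \<in> insert j (D - deferred res). class_of I j' = k} =
      {j' \<in> D - deferred res. class_of I j' = k}" using False i by auto
    ultimately show ?thesis using I(14)[of k] by simp
  qed
  have stk': "distinct ((stk(i := if load u + proc_time I j < T then stk i else us)) k) \<and>
      set ((stk(i := if load u + proc_time I j < T then stk i else us)) k) =
        {v \<in> opened cnt mcl k. ?l v < T}" for k
  proof -
    have *: "distinct (stk k)" "set (stk k) = {v \<in> opened cnt mcl k. load v < T}"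
      using I(9,10) by auto
    show ?thesis
    proof (cases "k = i")
      case True
      with * stk u show ?thesis by (auto simp: opened_def)
    next
      case False
      with * mu show ?thesis by (auto simp: opened_def)
    qed
  qed
  show "phase1_inv I T (insert j D) ?l cnt mcl
      (stk(i := if load u + proc_time I j < T then stk i else us)) res
      (\<sigma>(u := \<sigma> u @ [(real (load u), Job j)]))"
  proof (rule phase1_inv.intro, unfold D)
    show "(\<sigma>(u := \<sigma> u @ [(real (load u), Job j)])) v = []" if "v \<ge> cnt" for v
      using I(5) ucnt that by simp
    show "2 * ?l v \<le> 3 * T" if "v < cnt" for v using I(6) le that by simp
    show "last_class I ((\<sigma>(u := \<sigma> u @ [(real (load u), Job j)])) v) = Some (mcl v)" if "v < cnt" for v
      using I(8) mu i that by simp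
    show "card (opened cnt mcl k) \<le> card {j' \<in> insert j D. class_of I j' = k}"
      if "\<And>j'. j' \<in> insert j D \<Longrightarrow> cat I T j' = 0" for k
      using j(3) that[of j] by simp
    show "(stk(i := if load u + proc_time I j < T then stk i else us)) k = []" if "res k \<noteq> []" for k
      using I(13) rs that by auto
    show "cnt \<le> card (insert j D)" using I(4) finD j by simp
    show "deferred res \<subseteq> insert j D" using I(12) by blast
    show "sum ?l (opened cnt mcl k) = card (opened cnt mcl k) * setup_time I k +
      sum (proc_time I) {j' \<in> insert j (D - deferred res). class_of I j' = k}" for k by (rule sums)
    show "card (opened cnt mcl k) \<le> card (f ` heavy I T k)" if "fits I T f" for f k
      using that by (rule I(16))
  qed (use I(1-3,7,11) ps stk' j in \<open>(simp; fail)+\<close>)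
qed

text \<open>This is the reason for opening machines sparingly. In category 0, the jobs of class i
  seen so far together with j are longer than T/2 and thus lie on pairwise different machines under
  f, while at most one machine was opened for each job seen. In category 1, all k machines of the
  class have reached T, so the heavy jobs seen already fill the room that k machines offer besides
  their setups. With j there is more heavy work than that, so f uses more than k machines.\<close>

lemma phase1_room:
  assumes inv: "phase1_inv I T D load cnt mcl stk res \<sigma>"
    and j: "j < num_jobs I" "j \<notin> D" "cat I T j < 2" and i: "i = class_of I j"
    and ord: "\<And>j'. j' \<in> D \<Longrightarrow> cat I T j' \<le> cat I T j"
    and stk: "cat I T j \<noteq> 0 \<Longrightarrow> stk i = []" and pos: "1 \<le> proc_time I j"
    and f: "fits I T f"
  shows "card (opened cnt mcl i) < card (f ` heavy I T i)"
proof -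
  note I = phase1_invD[OF inv]
  have finD: "finite D" using I(2) finite_subset by blast
  note DN = I(2)
  \<comment> \<open>Categories are handled in increasing order, so no light job has been seen yet
    when j is heavy.\<close>
  have def: "deferred res = {}"
  proof -
    have "j' \<notin> deferred res" for j'
    proof
      assume j': "j' \<in> deferred res"
      then have "j' \<in> D" using I(12) by blast
      moreover have "cat I T j' = 2" using I(11) j' by (auto simp: deferred_ok_def)
      ultimately show False using ord[of j'] j(3) by simp
    qed
    then show ?thesis by blast
  qed
  show ?thesis
  proof (cases "cat I T j = 0")
    case True
    then have D0: "\<forall>j'\<in>D. cat I T j' = 0" using ord by fastforce
    let ?X = "{j' \<in> D. class_of I j' = i}"
    have "card (opened cnt mcl i) \<le> card ?X" using I(15) D0 by blast
    also have "card ?X < card (insert j ?X)" using j finD by simp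
    also have "\<dots> = card (f ` insert j ?X)"
      by (rule card_image[symmetric], rule inj_on_subset[OF fits_inj_on_big[OF f]])
        (use D0 True j DN in auto)
    also have "\<dots> \<le> card (f ` heavy I T i)"
      using D0 True j DN i by (intro card_mono) (auto simp: heavy_def)
    finally show ?thesis .
  next
    case False
    then have emp: "stk i = []" using stk by simp
    have ge: "T \<le> load u" if "u \<in> opened cnt mcl i" for u
      using I(10)[of i] emp that by (auto simp: not_less)
    let ?X = "{j' \<in> D. class_of I j' = i}"
    let ?k = "card (opened cnt mcl i)" and ?h = "card (f ` heavy I T i)"
    have "?k * T \<le> sum load (opened cnt mcl i)"
      using sum_bounded_below[of "opened cnt mcl i" T load] ge by simp
    also have "\<dots> = ?k * setup_time I i + sum (proc_time I) ?X"
      using I(14)[of i] def by simp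
    finally have 1: "?k * T \<le> ?k * setup_time I i + sum (proc_time I) ?X" .
    have "proc_time I j + sum (proc_time I) ?X = sum (proc_time I) (insert j ?X)"
      using j finD by simp
    also have "\<dots> \<le> sum (proc_time I) (heavy I T i)"
      using j i DN ord by (intro sum_mono2) (fastforce simp: heavy_def)+
    finally have 2: "proc_time I j + sum (proc_time I) ?X \<le> sum (proc_time I) (heavy I T i)" .
    have 3: "sum (proc_time I) (heavy I T i) + ?h * setup_time I i \<le> ?h * T"
      by (rule fits_class_load[OF f]) (auto simp: heavy_def)
    have sT: "setup_time I i + proc_time I j \<le> T" using fits_job[OF f j(1)] i by simp
    \<comment> \<open>d is the room left for jobs on a machine after its setup.\<close>
    obtain d where d: "T = setup_time I i + d" using sT by (metis add_leE le_Suc_ex)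
    have "?k * d \<le> sum (proc_time I) ?X" using 1 d by (simp add: algebra_simps)
    moreover have "sum (proc_time I) (heavy I T i) \<le> ?h * d" using 3 d by (simp add: algebra_simps)
    ultimately have *: "?k * d + proc_time I j \<le> ?h * d" using 2 by linarith
    show ?thesis
    proof (rule ccontr)
      assume "\<not> ?thesis"
      then have "?h * d \<le> ?k * d" by simp
      with * pos show False by linarith
    qed
  qed
qed

lemma sum_card_opened:
  assumes "\<And>u. u < cnt \<Longrightarrow> mcl u < c"
  shows "(\<Sum>i<c. card (opened cnt mcl i)) = cnt"
proof -
  have "(\<Sum>i<c. card (opened cnt mcl i)) = card (\<Union>i<c. opened cnt mcl i)"
    by (rule card_UN_disjoint[symmetric]) (auto simp: opened_def)
  also have "(\<Union>i<c. opened cnt mcl i) = {..<cnt}" using assms by (auto simp: opened_def)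
  finally show ?thesis by simp
qed

text \<open>The premises are just what the program can test. The bound \<open>opened_heavy\<close>
  concerns all assignments f at once; for each of them \<open>phase1_room\<close> leaves room for
  one more machine.\<close>

lemma phase1_open:
  assumes inv: "phase1_inv I T D load cnt mcl stk res \<sigma>" and v: "valid_instance I"
    and j: "j < num_jobs I" "j \<notin> D" "cat I T j < 2" and i: "i = class_of I j"
    and ord: "\<And>j'. j' \<in> D \<Longrightarrow> cat I T j' \<le> cat I T j"
    and stk: "cat I T j \<noteq> 0 \<Longrightarrow> stk i = []"
    and cnt: "cnt < num_machines I" and le: "setup_time I i + proc_time I j \<le> T"
  shows "phase1_inv I T (insert j D) (load(cnt := setup_time I i + proc_time I j)) (Suc cnt)
      (mcl(cnt := i)) (stk(i := if setup_time I i + proc_time I j < T then cnt # stk i else stk i)) res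
      (\<sigma>(cnt := [(0, Setup i), (real (setup_time I i), Job j)]))"
proof -
  note I = phase1_invD[OF inv]
  let ?x = "setup_time I i + proc_time I j"
  have ic: "i < num_classes I" using v j(1) i by (simp add: valid_instance_def)
  have pos: "1 \<le> proc_time I j" using v j(1) by (simp add: valid_instance_def)
  have finD: "finite D" using I(2) finite_subset by blast
  have def: "res k = []" for k
  proof (rule ccontr)
    assume "res k \<noteq> []"
    then obtain j' where j': "j' \<in> set (res k)" by (meson hd_in_set)
    then have "j' \<in> D" "cat I T j' = 2" using I(12) I(11)[unfolded deferred_ok_def] by blast+
    with ord[of j'] j(3) show False by simp
  qed
  \<comment> \<open>Machine \<open>cnt\<close> is still empty, so its leftover load may be taken as
    0 and the setup starts at time 0.\<close>
  have "partial_schedule I \<sigma> (load(cnt := 0)) D"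
    using partial_schedule_load_irrelevant[OF I(1) I(5)] def by simp
  from partial_schedule_setup[OF this cnt ic]
  have "partial_schedule I (\<sigma>(cnt := [(0, Setup i)])) (load(cnt := setup_time I i)) D"
    using I(5)[of cnt] by simp
  from partial_schedule_job[OF this cnt j(1,2)]
  have ps: "partial_schedule I (\<sigma>(cnt := [(0, Setup i), (real (setup_time I i), Job j)]))
      (load(cnt := ?x)) (insert j D)"
    using i by (simp add: last_class_def)
  have op: "opened (Suc cnt) (mcl(cnt := i)) k =
      (if k = i then insert cnt (opened cnt mcl k) else opened cnt mcl k)" for k
    by (auto simp: opened_def less_Suc_eq)
  have cardop: "card (opened (Suc cnt) (mcl(cnt := i)) k) =
      card (opened cnt mcl k) + (if k = i then 1 else 0)" for k
    using op[of k] by (simp add: opened_def)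
  have notin: "cnt \<notin> opened cnt mcl k" for k by (simp add: opened_def)
  have ld: "sum (load(cnt := ?x)) (opened cnt mcl k) = sum load (opened cnt mcl k)" for k
    by (rule sum.cong) (auto simp: opened_def)
  show ?thesis
  proof (rule phase1_inv.intro)
    show "partial_schedule I (\<sigma>(cnt := [(0, Setup i), (real (setup_time I i), Job j)]))
      (load(cnt := ?x)) (insert j D - deferred res)" using ps def by simp
    show "insert j D \<subseteq> {..<num_jobs I}" using I(2) j by simp
    show "Suc cnt \<le> num_machines I" using cnt by simp
    show "Suc cnt \<le> card (insert j D)" using I(4) finD j by simp
    show "(\<sigma>(cnt := [(0, Setup i), (real (setup_time I i), Job j)])) u = []" if "Suc cnt \<le> u" for u
      using I(5) that by simp
    show "2 * (load(cnt := ?x)) u \<le> 3 * T" if "u < Suc cnt" for u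
      using I(6)[of u] le that by (cases "u = cnt") simp_all
    show "(mcl(cnt := i)) u < num_classes I" if "u < Suc cnt" for u
      using I(7)[of u] ic that by (cases "u = cnt") simp_all
    show "last_class I ((\<sigma>(cnt := [(0, Setup i), (real (setup_time I i), Job j)])) u) =
        Some ((mcl(cnt := i)) u)" if "u < Suc cnt" for u
      using I(8)[of u] i that by (cases "u = cnt") (simp_all add: last_class_def)
    show "distinct ((stk(i := if ?x < T then cnt # stk i else stk i)) k)" for k
      using I(9)[of k] I(10)[of k] notin[of k] by (cases "k = i") auto
    show "set ((stk(i := if ?x < T then cnt # stk i else stk i)) k) =
        {u \<in> opened (Suc cnt) (mcl(cnt := i)) k. (load(cnt := ?x)) u < T}" for k
      unfolding op using I(10)[of k] notin[of k] by (cases "k = i") auto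
    show "deferred_ok I T res" by (rule I(11))
    show "deferred res \<subseteq> insert j D" using def by simp
    show "(stk(i := if ?x < T then cnt # stk i else stk i)) k = []" if "res k \<noteq> []" for k
      using that def by simp
    show "sum (load(cnt := ?x)) (opened (Suc cnt) (mcl(cnt := i)) k) =
        card (opened (Suc cnt) (mcl(cnt := i)) k) * setup_time I k +
        sum (proc_time I) {j' \<in> insert j D - deferred res. class_of I j' = k}" for k
    proof (cases "k = i")
      case True
      have "{j' \<in> insert j D. class_of I j' = k} = insert j {j' \<in> D. class_of I j' = k}"
        using True i by auto
      then show ?thesis unfolding cardop op using True I(14)[of i] ld[of i] j(2) finD def notin[of i]
        by simp
    next
      case False
      then have "{j' \<in> insert j D. class_of I j' = k} = {j' \<in> D. class_of I j' = k}"
        using i by auto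
      then show ?thesis unfolding cardop op using False I(14)[of k] ld[of k] def by simp
    qed
    show "card (opened (Suc cnt) (mcl(cnt := i)) k) \<le> card {j' \<in> insert j D. class_of I j' = k}"
      if "\<And>j'. j' \<in> insert j D \<Longrightarrow> cat I T j' = 0" for k
    proof -
      have *: "card (opened cnt mcl k) \<le> card {j' \<in> D. class_of I j' = k}"
        using that by (intro I(15)) simp
      show ?thesis
      proof (cases "k = i")
        case True
        then have "{j' \<in> insert j D. class_of I j' = k} = insert j {j' \<in> D. class_of I j' = k}"
          using i by auto
        with * True j(2) finD show ?thesis unfolding cardop by simp
      next
        case False
        then have "{j' \<in> insert j D. class_of I j' = k} = {j' \<in> D. class_of I j' = k}"
          using i by auto
        with * False show ?thesis unfolding cardop by simp
      qed
    qed
    show "card (opened (Suc cnt) (mcl(cnt := i)) k) \<le> card (f ` heavy I T k)"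
      if "fits I T f" for f k
      unfolding cardop using I(16)[OF that, of k]
        phase1_room[OF inv j i ord stk pos that] by simp
  qed
qed

text \<open>The contrapositive justifies the rejections of the first phase. Summed over the classes,
  the opened machines are strictly fewer than the machines that f uses for heavy jobs, and these are
  counted without overlap because heavy jobs of different classes never share a machine.\<close>

lemma phase1_open_fits:
  assumes inv: "phase1_inv I T D load cnt mcl stk res \<sigma>" and v: "valid_instance I"
    and j: "j < num_jobs I" "j \<notin> D" "cat I T j < 2" and i: "i = class_of I j"
    and ord: "\<And>j'. j' \<in> D \<Longrightarrow> cat I T j' \<le> cat I T j"
    and stk: "cat I T j \<noteq> 0 \<Longrightarrow> stk i = []"
    and f: "fits I T f"
  shows "cnt < num_machines I" "setup_time I i + proc_time I j \<le> T"
proof -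
  note I = phase1_invD[OF inv]
  have ic: "i < num_classes I" using v j(1) i by (simp add: valid_instance_def)
  have pos: "1 \<le> proc_time I j" using v j(1) by (simp add: valid_instance_def)
  have "cnt = (\<Sum>k<num_classes I. card (opened cnt mcl k))"
    using sum_card_opened[of cnt mcl "num_classes I"] I(7) by simp
  also have "\<dots> < (\<Sum>k<num_classes I. card (f ` heavy I T k))"
    using I(16)[OF f] phase1_room[OF inv j i ord stk pos f] ic
    by (intro sum_strict_mono_ex1) auto
  also have "\<dots> \<le> num_machines I" by (rule fits_heavy_card[OF f])
  finally show "cnt < num_machines I" .
  show "setup_time I i + proc_time I j \<le> T" using fits_job[OF f j(1)] i by simp
qed

lemma phase1_defer:
  assumes inv: "phase1_inv I T D load cnt mcl stk res \<sigma>"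
    and j: "j < num_jobs I" "j \<notin> D" "cat I T j = 2" and i: "i = class_of I j"
    and stk: "stk i = []"
  shows "phase1_inv I T (insert j D) load cnt mcl stk (res(i := j # res i)) \<sigma>"
proof -
  note I = phase1_invD[OF inv]
  have finD: "finite D" using I(2) finite_subset by blast
  have "deferred (res(i := j # res i)) = insert j (deferred res)"
  proof -
    have "set ((res(i := j # res i)) k) = set (res k) \<union> (if k = i then {j} else {})" for k by simp
    then show ?thesis by (auto split: if_splits)
  qed
  then have D: "insert j D - deferred (res(i := j # res i)) = D - deferred res"
    "deferred (res(i := j # res i)) \<subseteq> insert j D" using j(2) I(12) by auto
  have jn: "j \<notin> deferred res" using I(12) j(2) by blast
  show ?thesis
  proof (rule phase1_inv.intro, unfold D(1))
    show "insert j D \<subseteq> {..<num_jobs I}" using I(2) j by simp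
    show "cnt \<le> card (insert j D)" using I(4) finD j by simp
    show "deferred_ok I T (res(i := j # res i))"
      using I(11) j i jn by (auto simp: deferred_ok_def)
    show "card (opened cnt mcl k) \<le> card {j' \<in> insert j D. class_of I j' = k}"
      if "\<And>j'. j' \<in> insert j D \<Longrightarrow> cat I T j' = 0" for k
      using j(3) that[of j] by simp
    show "stk k = []" if "(res(i := j # res i)) k \<noteq> []" for k
      using that I(13)[of k] stk by (cases "k = i") simp_all
  qed (rule I(1) I(3) I(5-10) I(14,16) D(2); assumption)+
qed

definition residual :: "batch_instance \<Rightarrow> (nat \<Rightarrow> nat list) \<Rightarrow> nat \<Rightarrow> nat" where
  "residual I res k = (if res k = [] then 0 else setup_time I k + sum (proc_time I) (set (res k)))"

text \<open>The comparison is made class by class, where processing times agree and only setups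
  differ. A class without deferred jobs has at most as many machines, hence setups, as under f. A
  class with deferred jobs is charged one setup more, but its machines are full and work is left
  over, so f needs at least one machine more.\<close>

lemma phase1_total:
  assumes inv: "phase1_inv I T {..<num_jobs I} load cnt mcl stk res \<sigma>" and v: "valid_instance I"
    and f: "fits I T f"
  shows "(\<Sum>u<cnt. load u) + (\<Sum>k<num_classes I. residual I res k) \<le> num_machines I * T"
proof -
  note I = phase1_invD[OF inv]
  let ?c = "num_classes I"
  have "(\<Sum>u<cnt. load u) = (\<Sum>k<?c. sum load (opened cnt mcl k))"
    using sum.group[of "{..<cnt}" "{..<?c}" mcl load] I(7)
    by (simp add: opened_def image_subset_iff)
  also have "\<dots> + (\<Sum>k<?c. residual I res k) = (\<Sum>k<?c. sum load (opened cnt mcl k) + residual I res k)"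
    by (simp add: sum.distrib)
  also have "\<dots> \<le> (\<Sum>i<?c. sum (proc_time I) (class_jobs I i) +
    card (f ` class_jobs I i) * setup_time I i)"
  proof (rule sum_mono)
    fix k assume "k \<in> {..<?c}"
    let ?k = "card (opened cnt mcl k)" and ?h = "card (f ` class_jobs I k)"
    let ?X = "{j \<in> {..<num_jobs I} - deferred res. class_of I j = k}"
    have "class_jobs I k = ?X \<union> set (res k)" "?X \<inter> set (res k) = {}"
      using I(11) by (auto simp: class_jobs_def deferred_ok_def)
    then have P: "sum (proc_time I) (class_jobs I k) =
        sum (proc_time I) ?X + sum (proc_time I) (set (res k))"
      by (simp add: sum.union_disjoint)
    have "heavy I T k \<subseteq> class_jobs I k" by (auto simp: heavy_def class_jobs_def)
    then have "card (f ` heavy I T k) \<le> ?h" by (intro card_mono image_mono) auto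
    with I(16)[OF f, of k] have kh: "?k \<le> ?h" by linarith
    show "sum load (opened cnt mcl k) + residual I res k \<le>
      sum (proc_time I) (class_jobs I k) + ?h * setup_time I k"
    proof (cases "res k = []")
      case True
      then show ?thesis using I(14)[of k] P mult_le_mono1[OF kh, of "setup_time I k"]
        by (simp add: residual_def)
    next
      case False
      then obtain j where j: "j \<in> set (res k)" by (meson hd_in_set)
      then have jk: "j < num_jobs I" "class_of I j = k" using I(11) by (auto simp: deferred_ok_def)
      have ge: "T \<le> load u" if "u \<in> opened cnt mcl k" for u
        using I(10)[of k] I(13)[OF False] that by (auto simp: not_less)
      have "?k * T \<le> sum load (opened cnt mcl k)"
        using sum_bounded_below[of "opened cnt mcl k" T load] ge by simp
      then have 1: "?k * T \<le> ?k * setup_time I k + sum (proc_time I) ?X"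
        using I(14)[of k] by simp
      have 2: "sum (proc_time I) (class_jobs I k) + ?h * setup_time I k \<le> ?h * T"
        by (rule fits_class_load[OF f]) (auto simp: class_jobs_def)
      have pos: "1 \<le> proc_time I j" using v jk by (simp add: valid_instance_def)
      have "proc_time I j \<le> sum (proc_time I) (set (res k))"
        using j by (intro member_le_sum) auto
      with pos have 3: "1 \<le> sum (proc_time I) (set (res k))" by linarith
      have sT: "setup_time I k \<le> T" using fits_job[OF f jk(1)] jk(2) by simp
      then obtain d where d: "T = setup_time I k + d" by (metis le_Suc_ex)
      have "?k * d \<le> sum (proc_time I) ?X" using 1 d by (simp add: algebra_simps)
      moreover have "sum (proc_time I) (class_jobs I k) \<le> ?h * d"
        using 2 d by (simp add: algebra_simps)
      \<comment> \<open>Strictness comes from a deferred job, whose processing time is at least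
        1.\<close>
      ultimately have "?k * d < ?h * d" using P 3 by linarith
      then have "?k + 1 \<le> ?h" by simp
      then have "(?k + 1) * setup_time I k \<le> ?h * setup_time I k" by (rule mult_le_mono1)
      then show ?thesis using I(14)[of k] P False by (simp add: residual_def)
    qed
  qed
  also have "\<dots> \<le> num_machines I * T" by (rule fits_total[OF v f])
  finally show ?thesis .
qed

section \<open>Filling the machines with the deferred jobs\<close>

text \<open>The work not yet accounted for. The setup of the current class i is left out when it has
  been charged already, which is what \<open>\<not> new\<close> records.\<close>

definition remaining :: "batch_instance \<Rightarrow> (nat \<Rightarrow> nat list) \<Rightarrow> nat \<Rightarrow> bool \<Rightarrow> nat" where
  "remaining I res i new = (\<Sum>k<num_classes I. if res k = [] then 0 else
     (if k = i \<and> \<not> new then 0 else setup_time I k) + sum (proc_time I) (set (res k)))"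

definition item_size :: "batch_instance \<Rightarrow> nat \<Rightarrow> nat \<Rightarrow> bool \<Rightarrow> nat" where
  "item_size I i j new = (if new then setup_time I i else 0) + proc_time I j"

lemma remaining_pop:
  assumes "res i = j # js" "distinct (res i)" "i < num_classes I"
  shows "remaining I (res(i := js)) i False + item_size I i j new = remaining I res i new"
proof -
  let ?c = "num_classes I"
  let ?f = "\<lambda>res new k. if res k = [] then 0 else
     (if k = i \<and> \<not> new then 0 else setup_time I k) + sum (proc_time I) (set (res k))"
  have "remaining I (res(i := js)) i False = sum (?f (res(i := js)) False) {..<?c}"
    by (simp add: remaining_def)
  also have "\<dots> = ?f (res(i := js)) False i + sum (?f (res(i := js)) False) ({..<?c} - {i})"
    using assms(3) by (intro sum.remove) auto
  also have "sum (?f (res(i := js)) False) ({..<?c} - {i}) = sum (?f res new) ({..<?c} - {i})"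
    by (rule sum.cong) auto
  finally have 1: "remaining I (res(i := js)) i False =
    ?f (res(i := js)) False i + sum (?f res new) ({..<?c} - {i})" .
  have "remaining I res i new = sum (?f res new) {..<?c}" by (simp add: remaining_def)
  also have "\<dots> = ?f res new i + sum (?f res new) ({..<?c} - {i})"
    using assms(3) by (intro sum.remove) auto
  finally show ?thesis using 1 assms(1,2) by (auto simp: item_size_def)
qed

lemma remaining_next:
  assumes "res i = []"
  shows "remaining I res (Suc i) True = remaining I res i new"
  unfolding remaining_def using assms by (intro sum.cong) auto

lemma remaining_new: "remaining I res i True = (\<Sum>k<num_classes I. residual I res k)"
  by (auto simp: remaining_def residual_def intro!: sum.cong)

text \<open>\<^term>\<open>l\<close> is the vector of loads before the second phase and \<^term>\<open>R0\<close> the total size of the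
  deferred jobs and their setups. Every machine below \<^term>\<open>u\<close> has absorbed at least \<^term>\<open>T\<close>, where
  an item that overruns \<^term>\<open>T\<close> is charged to the machine that it overruns but placed on the next
  one (\<^term>\<open>carry\<close>). So \<^term>\<open>load u\<close> exceeds the charge \<^term>\<open>nom\<close> by at most one setup and
  one job, that is by at most \<^term>\<open>T div 2\<close>.\<close>

locale phase2_inv =
  fixes I :: batch_instance and T :: nat and l :: "nat \<Rightarrow> nat" and cnt R0 :: nat
    and res :: "nat \<Rightarrow> nat list" and i u nom :: nat and carry new :: bool
    and load :: "nat \<Rightarrow> nat" and \<sigma> :: schedule
  assumes sched: "partial_schedule I \<sigma> load ({..<num_jobs I} - deferred res)"
    and deferred: "deferred_ok I T res"
    and i_le: "i \<le> num_classes I" and finished: "\<And>k. k < i \<Longrightarrow> res k = []"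
    and load_le: "\<And>v. \<sigma> v \<noteq> [] \<Longrightarrow> 2 * load v \<le> 3 * T"
    and u_le: "u \<le> num_machines I"
    and l_unopened: "\<And>v. cnt \<le> v \<Longrightarrow> l v = 0"
    and ahead: "\<And>v. u < v \<Longrightarrow> v < cnt \<Longrightarrow> load v = l v"
      "\<And>v. u < v \<Longrightarrow> cnt \<le> v \<Longrightarrow> \<sigma> v = []"
    and carry_load: "carry \<Longrightarrow> load u = l u"
    and carry_sched: "carry \<Longrightarrow> cnt \<le> u \<Longrightarrow> \<sigma> u = []"
    and carry_charge: "carry \<Longrightarrow> u = 0 \<and> remaining I res i new \<le> R0 \<or> i < num_classes I \<and> res i \<noteq> [] \<and>
        u * T + remaining I res i new < sum l {..<u} + R0 + item_size I i (hd (res i)) new"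
    and here: "\<not> carry \<Longrightarrow> u < num_machines I" "\<not> carry \<Longrightarrow> nom \<le> T"
      "\<not> carry \<Longrightarrow> 2 * load u \<le> 2 * nom + T"
      "\<not> carry \<Longrightarrow> \<not> new \<Longrightarrow> last_class I (\<sigma> u) = Some i"
    and charge: "\<not> carry \<Longrightarrow> u * T + nom + remaining I res i new \<le> sum l {..u} + R0"

lemma phase2_next_class:
  assumes inv: "phase2_inv I T l cnt R0 res i u nom carry new load \<sigma>"
    and i: "i < num_classes I" "res i = []"
  shows "phase2_inv I T l cnt R0 res (Suc i) u nom carry True load \<sigma>"
proof -
  interpret phase2_inv I T l cnt R0 res i u nom carry new load \<sigma> by (rule inv)
  note R = remaining_next[of res i I new, OF i(2)]
  show ?thesis
  proof (unfold_locales, unfold R)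
    show "res k = []" if "k < Suc i" for k using that finished i by (auto simp: less_Suc_eq)
    \<comment> \<open>An overrunning item stays in the list of its class, so while
      \<open>carry\<close> holds, the current class can be empty only before any item has been
      charged. That is the first alternative.\<close>
    show "u = 0 \<and> remaining I res i new \<le> R0 \<or> Suc i < num_classes I \<and> res (Suc i) \<noteq> [] \<and>
        u * T + remaining I res i new < sum l {..<u} + R0 + item_size I (Suc i) (hd (res (Suc i))) True"
      if carry using carry_charge[OF that] i by simp
    show "Suc i \<le> num_classes I" using i by simp
    show "last_class I (\<sigma> u) = Some (Suc i)" if "\<not> carry" "\<not> True" using that by simp
  qed (rule sched deferred load_le u_le l_unopened ahead carry_load carry_sched here charge; assumption)+
qed

lemma deferred_ok_pop:
  assumes "deferred_ok I T res" "res i = j # js"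
  shows "deferred_ok I T (res(i := js))" "j < num_jobs I" "class_of I j = i" "cat I T j = 2"
    "j \<notin> set js" "deferred (res(i := js)) = deferred res - {j}"
    "{..<num_jobs I} - deferred (res(i := js)) = insert j ({..<num_jobs I} - deferred res)"
proof -
  have *: "distinct (res k)" "\<And>x. x \<in> set (res k) \<Longrightarrow> x < num_jobs I \<and> class_of I x = k \<and> cat I T x = 2" for k
    using assms(1) by (auto simp: deferred_ok_def)
  show "deferred_ok I T (res(i := js))" unfolding deferred_ok_def
  proof
    fix k
    show "distinct ((res(i := js)) k) \<and> (\<forall>j\<in>set ((res(i := js)) k).
        j < num_jobs I \<and> class_of I j = k \<and> cat I T j = 2)"
      using *(1)[of k] *(2)[of _ k] assms(2) by (cases "k = i") auto
  qed
  show 1: "j < num_jobs I" "class_of I j = i" "cat I T j = 2" using *(2)[of j i] assms(2) by simp_all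
  show 2: "j \<notin> set js" using *(1)[of i] assms(2) by simp
  have k: "j \<notin> set (res k)" if "k \<noteq> i" for k using *(2)[of j k] 1(2) that by blast
  have "set ((res(i := js)) k) = set (res k) - {j}" for k
    using 2 k[of k] assms(2) by (cases "k = i") auto
  then show 3: "deferred (res(i := js)) = deferred res - {j}" by blast
  have "j \<in> deferred res" using assms(2) by (metis UN_I UNIV_I list.set_intros(1))
  with 3 1(1) show "{..<num_jobs I} - deferred (res(i := js)) = insert j ({..<num_jobs I} - deferred res)"
    by blast
qed

lemma cat_small: "cat I T j = 2 \<Longrightarrow> 2 * (setup_time I (class_of I j) + proc_time I j) \<le> T"
  by (auto simp: cat_def split: if_splits)

text \<open>The item was charged to an earlier machine or, at the very beginning, to none. Hence the
  charge of machine u restarts at its load without the item and the setup placed with it. These two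
  take at most T/2, on top of a load below T.\<close>

lemma phase2_place_carry:
  assumes inv: "phase2_inv I T l cnt R0 res i u nom carry new load \<sigma>" and c: carry
    and i: "i < num_classes I" "res i = j # js" and u: "u < num_machines I" "load u < T"
  shows "phase2_inv I T l cnt R0 (res(i := js)) i u (load u) False False
    (load(u := load u + setup_time I i + proc_time I j))
    (\<sigma>(u := \<sigma> u @ [(real (load u), Setup i), (real (load u + setup_time I i), Job j)]))"
proof -
  interpret phase2_inv I T l cnt R0 res i u nom carry new load \<sigma> by (rule inv)
  note P = deferred_ok_pop[OF deferred i(2)]
  have jn: "j \<notin> {..<num_jobs I} - deferred res" using i(2) by (metis DiffE UN_I UNIV_I list.set_intros(1))
  have R: "remaining I (res(i := js)) i False + item_size I i j new = remaining I res i new"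
    by (rule remaining_pop[where res = res, OF i(2) _ i(1)])
      (use deferred in \<open>simp add: deferred_ok_def\<close>)
  from partial_schedule_job[OF partial_schedule_setup[OF sched u(1) i(1)] u(1) P(2) jn]
  have ps: "partial_schedule I
    (\<sigma>(u := \<sigma> u @ [(real (load u), Setup i), (real (load u + setup_time I i), Job j)]))
    (load(u := load u + setup_time I i + proc_time I j))
    (insert j ({..<num_jobs I} - deferred res))"
    using P(3) by (simp add: last_class_def)
  have small: "2 * (setup_time I i + proc_time I j) \<le> T" using cat_small[OF P(4)] P(3) by simp
  have lt: "sum l {..u} = sum l {..<u} + load u"
    using carry_load[OF c] by (simp add: lessThan_Suc_atMost[symmetric])
  show ?thesis
  proof (rule phase2_inv.intro, unfold P(7))
    show "(res(i := js)) k = []" if "k < i" for k using that finished by simp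
    show "2 * (load(u := load u + setup_time I i + proc_time I j)) v \<le> 3 * T"
      if "(\<sigma>(u := \<sigma> u @ [(real (load u), Setup i), (real (load u + setup_time I i), Job j)])) v \<noteq> []" for v
      using that load_le[of v] small u(2) by (cases "v = u") auto
    show "(load(u := load u + setup_time I i + proc_time I j)) v = l v" if "u < v" "v < cnt" for v
      using that ahead by simp
    show "(\<sigma>(u := \<sigma> u @ [(real (load u), Setup i), (real (load u + setup_time I i), Job j)])) v = []"
      if "u < v" "cnt \<le> v" for v using that ahead by simp
    show "last_class I ((\<sigma>(u := \<sigma> u @ [(real (load u), Setup i), (real (load u + setup_time I i), Job j)])) u)
      = Some i" using P(3) by (simp add: last_class_def)
    show "2 * (load(u := load u + setup_time I i + proc_time I j)) u \<le> 2 * load u + T"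
      using small by simp
    show "u * T + load u + remaining I (res(i := js)) i False \<le> sum l {..u} + R0"
      using carry_charge[OF c] R i(2) unfolding lt by auto
  qed (use ps P i_le u u_le l_unopened in simp_all)
qed

text \<open>A machine that already carries T pays for itself, so the pending item moves on with its
  charge intact. Such a machine was opened in the first phase, so skipping brings \<open>u\<close>
  closer to \<open>cnt\<close>, which is needed for termination.\<close>

lemma phase2_skip:
  assumes inv: "phase2_inv I T l cnt R0 res i u nom carry new load \<sigma>" and c: carry
    and i: "i < num_classes I" "res i = j # js" and u: "u < num_machines I" "T \<le> load u"
    and v: "valid_instance I"
    and load': "load' = (if Suc u < cnt then load else load(Suc u := 0))"
  shows "phase2_inv I T l cnt R0 res i (Suc u) nom carry new load' \<sigma>" "u < cnt"
proof -
  interpret phase2_inv I T l cnt R0 res i u nom carry new load \<sigma> by (rule inv)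
  note P = deferred_ok_pop[OF deferred i(2)]
  have pos: "1 \<le> proc_time I j" using v P(2) by (simp add: valid_instance_def)
  have "0 < T" using cat_small[OF P(4)] pos by simp
  show "u < cnt"
  proof (rule ccontr)
    assume "\<not> u < cnt"
    then have "l u = 0" using l_unopened by simp
    with carry_load[OF c] u \<open>0 < T\<close> show False by simp
  qed
  have ps: "partial_schedule I \<sigma> load' ({..<num_jobs I} - deferred res)"
    unfolding load' using sched ahead(2)[of "Suc u"] 
    by (auto intro: partial_schedule_load_irrelevant)
  \<comment> \<open>At machine 0 the charge may hold only as a weak inequality; the positive size of
    the pending item makes it strict.\<close>
  have sz: "1 \<le> item_size I i (hd (res i)) new" using i(2) pos by (simp add: item_size_def)
  have "u * T + remaining I res i new < sum l {..<u} + R0 + item_size I i (hd (res i)) new"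
    using carry_charge[OF c] sz by auto
  then have "Suc u * T + remaining I res i new < sum l {..<Suc u} + R0 + item_size I i (hd (res i)) new"
    using carry_load[OF c] u(2) by simp
  then show "phase2_inv I T l cnt R0 res i (Suc u) nom carry new load' \<sigma>"
  proof (intro phase2_inv.intro)
    show "load' v = l v" if "Suc u < v" "v < cnt" for v using that ahead(1)[of v] load' by simp
    show "load' (Suc u) = l (Suc u)" using ahead(1)[of "Suc u"] l_unopened[of "Suc u"] load' by simp
    show "2 * load' v \<le> 3 * T" if "\<sigma> v \<noteq> []" for v using that load_le load' by simp
  qed (use ps deferred i_le finished u l_unopened ahead i c in simp_all)
qed

text \<open>The overrunning item lifts the charge of machine u above T, but it is not placed and
  \<open>remaining\<close> still counts it. This is why its size appears on the right-hand side of
  \<open>carry_charge\<close>.\<close>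

lemma phase2_cross:
  assumes inv: "phase2_inv I T l cnt R0 res i u nom carry new load \<sigma>" and c: "\<not> carry"
    and i: "i < num_classes I" "res i = j # js" and nom: "T < nom + item_size I i j new"
    and load': "load' = (if Suc u < cnt then load else load(Suc u := 0))"
  shows "phase2_inv I T l cnt R0 res i (Suc u) nom True new load' \<sigma>"
proof -
  interpret phase2_inv I T l cnt R0 res i u nom carry new load \<sigma> by (rule inv)
  have ps: "partial_schedule I \<sigma> load' ({..<num_jobs I} - deferred res)"
    unfolding load' using sched ahead(2)[of "Suc u"] 
    by (auto intro: partial_schedule_load_irrelevant)
  have "Suc u * T + remaining I res i new < sum l {..<Suc u} + R0 + item_size I i (hd (res i)) new"
    using charge[OF c] nom i(2) by (simp add: lessThan_Suc_atMost)
  then show ?thesis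
  proof (intro phase2_inv.intro)
    show "load' v = l v" if "Suc u < v" "v < cnt" for v using that ahead(1)[of v] load' by simp
    show "load' (Suc u) = l (Suc u)" using ahead(1)[of "Suc u"] l_unopened[of "Suc u"] load' by simp
    show "2 * load' v \<le> 3 * T" if "\<sigma> v \<noteq> []" for v using that load_le load' by simp
  qed (use ps deferred i_le finished here(1)[OF c] l_unopened ahead i c in simp_all)
qed

text \<open>Load and charge grow by the same amount, so their gap stays at most T/2, and a charge of
  at most T gives a load of at most 3/2 T.\<close>

lemma phase2_place_new:
  assumes inv: "phase2_inv I T l cnt R0 res i u nom carry new load \<sigma>" and c: "\<not> carry" and n: new
    and i: "i < num_classes I" "res i = j # js" and nom: "nom + item_size I i j new \<le> T"
  shows "phase2_inv I T l cnt R0 (res(i := js)) i u (nom + item_size I i j new) carry False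
    (load(u := load u + setup_time I i + proc_time I j))
    (\<sigma>(u := \<sigma> u @ [(real (load u), Setup i), (real (load u + setup_time I i), Job j)]))"
proof -
  interpret phase2_inv I T l cnt R0 res i u nom carry new load \<sigma> by (rule inv)
  note P = deferred_ok_pop[OF deferred i(2)]
  note u = here(1)[OF c]
  have jn: "j \<notin> {..<num_jobs I} - deferred res" using i(2) by (metis DiffE UN_I UNIV_I list.set_intros(1))
  have R: "remaining I (res(i := js)) i False + item_size I i j new = remaining I res i new"
    by (rule remaining_pop[where res = res, OF i(2) _ i(1)])
      (use deferred in \<open>simp add: deferred_ok_def\<close>)
  from partial_schedule_job[OF partial_schedule_setup[OF sched u(1) i(1)] u(1) P(2) jn]
  have ps: "partial_schedule I
    (\<sigma>(u := \<sigma> u @ [(real (load u), Setup i), (real (load u + setup_time I i), Job j)]))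
    (load(u := load u + setup_time I i + proc_time I j))
    (insert j ({..<num_jobs I} - deferred res))"
    using P(3) by (simp add: last_class_def)
  have sz: "item_size I i j new = setup_time I i + proc_time I j" using n by (simp add: item_size_def)
  show ?thesis
  proof (rule phase2_inv.intro, unfold P(7))
    show "(res(i := js)) k = []" if "k < i" for k using that finished by simp
    show "2 * (load(u := load u + setup_time I i + proc_time I j)) v \<le> 3 * T"
      if "(\<sigma>(u := \<sigma> u @ [(real (load u), Setup i), (real (load u + setup_time I i), Job j)])) v \<noteq> []" for v
      using that load_le[of v] here(3)[OF c] nom sz by (cases "v = u") auto
    show "(load(u := load u + setup_time I i + proc_time I j)) v = l v" if "u < v" "v < cnt" for v
      using that ahead by simp
    show "(\<sigma>(u := \<sigma> u @ [(real (load u), Setup i), (real (load u + setup_time I i), Job j)])) v = []"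
      if "u < v" "cnt \<le> v" for v using that ahead by simp
    show "last_class I ((\<sigma>(u := \<sigma> u @ [(real (load u), Setup i), (real (load u + setup_time I i), Job j)])) u)
      = Some i" using P(3) by (simp add: last_class_def)
    show "2 * (load(u := load u + setup_time I i + proc_time I j)) u \<le> 2 * (nom + item_size I i j new) + T"
      using here(3)[OF c] sz by simp
    show "u * T + (nom + item_size I i j new) + remaining I (res(i := js)) i False \<le> sum l {..u} + R0"
      using charge[OF c] R by simp
  qed (use ps P i_le u u_le l_unopened nom c in simp_all)
qed

lemma phase2_place_old:
  assumes inv: "phase2_inv I T l cnt R0 res i u nom carry new load \<sigma>" and c: "\<not> carry" and n: "\<not> new"
    and i: "i < num_classes I" "res i = j # js" and nom: "nom + item_size I i j new \<le> T"
  shows "phase2_inv I T l cnt R0 (res(i := js)) i u (nom + item_size I i j new) carry False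
    (load(u := load u + proc_time I j)) (\<sigma>(u := \<sigma> u @ [(real (load u), Job j)]))"
proof -
  interpret phase2_inv I T l cnt R0 res i u nom carry new load \<sigma> by (rule inv)
  note P = deferred_ok_pop[OF deferred i(2)]
  note u = here(1)[OF c]
  have jn: "j \<notin> {..<num_jobs I} - deferred res" using i(2) by (metis DiffE UN_I UNIV_I list.set_intros(1))
  have R: "remaining I (res(i := js)) i False + item_size I i j new = remaining I res i new"
    by (rule remaining_pop[where res = res, OF i(2) _ i(1)])
      (use deferred in \<open>simp add: deferred_ok_def\<close>)
  from partial_schedule_job[OF sched u(1) P(2) jn]
  have ps: "partial_schedule I (\<sigma>(u := \<sigma> u @ [(real (load u), Job j)]))
    (load(u := load u + proc_time I j)) (insert j ({..<num_jobs I} - deferred res))"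
    using P(3) here(4)[OF c n] by simp
  have sz: "item_size I i j new = proc_time I j" using n by (simp add: item_size_def)
  show ?thesis
  proof (rule phase2_inv.intro, unfold P(7))
    show "(res(i := js)) k = []" if "k < i" for k using that finished by simp
    show "2 * (load(u := load u + proc_time I j)) v \<le> 3 * T"
      if "(\<sigma>(u := \<sigma> u @ [(real (load u), Job j)])) v \<noteq> []" for v
      using that load_le[of v] here(3)[OF c] nom sz by (cases "v = u") auto
    show "(load(u := load u + proc_time I j)) v = l v" if "u < v" "v < cnt" for v
      using that ahead by simp
    show "(\<sigma>(u := \<sigma> u @ [(real (load u), Job j)])) v = []"
      if "u < v" "cnt \<le> v" for v using that ahead by simp
    show "last_class I ((\<sigma>(u := \<sigma> u @ [(real (load u), Job j)])) u) = Some i"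
      using P(3) by (simp add: last_class_def)
    show "2 * (load(u := load u + proc_time I j)) u \<le> 2 * (nom + item_size I i j new) + T"
      using here(3)[OF c] sz by simp
    show "u * T + (nom + item_size I i j new) + remaining I (res(i := js)) i False \<le> sum l {..u} + R0"
      using charge[OF c] R by simp
  qed (use ps P i_le u u_le l_unopened nom c in simp_all)
qed

text \<open>If an item is pending beyond the last machine, the m machines have been charged more
  than m T in total. But only the initial loads and the deferred work R0 were ever charged, and
  these sum to at most m T.\<close>

lemma phase2_fail:
  assumes inv: "phase2_inv I T l cnt R0 res i u nom carry new load \<sigma>" and c: carry
    and i: "i < num_classes I" "res i = j # js" and u: "num_machines I \<le> u"
    and v: "valid_instance I" and tot: "sum l {..<cnt} + R0 \<le> num_machines I * T"
  shows False
proof -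
  interpret phase2_inv I T l cnt R0 res i u nom carry new load \<sigma> by (rule inv)
  have R: "remaining I (res(i := js)) i False + item_size I i j new = remaining I res i new"
    by (rule remaining_pop[where res = res, OF i(2) _ i(1)])
      (use deferred in \<open>simp add: deferred_ok_def\<close>)
  have um: "u = num_machines I" using u u_le by simp
  then have "u \<noteq> 0" using v by (simp add: valid_instance_def)
  then have "u * T + remaining I res i new < sum l {..<u} + R0 + item_size I i j new"
    using carry_charge[OF c] i(2) by simp
  with R have "u * T < sum l {..<u} + R0" by linarith
  moreover have "sum l {..<u} \<le> sum l {..<cnt}"
  proof -
    have "sum l {..<u} = sum l ({..<u} \<inter> {..<cnt})"
      by (rule sum.mono_neutral_right) (simp, blast, rule ballI, rule l_unopened, auto)
    also have "\<dots> \<le> sum l {..<cnt}" by (rule sum_mono2) auto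
    finally show ?thesis .
  qed
  ultimately show False using tot um by simp
qed

lemma phase2_complete:
  assumes inv: "phase2_inv I T l cnt R0 res (num_classes I) u nom carry new load \<sigma>"
    and v: "valid_instance I"
  shows "feasible I \<sigma>" "makespan I \<sigma> \<le> 3 / 2 * real T"
proof -
  interpret phase2_inv I T l cnt R0 res "num_classes I" u nom carry new load \<sigma> by (rule inv)
  have "res k = []" for k
  proof (rule ccontr)
    assume ne: "res k \<noteq> []"
    then have "hd (res k) < num_jobs I \<and> class_of I (hd (res k)) = k"
      using deferred[unfolded deferred_ok_def] by (metis hd_in_set)
    with v have "k < num_classes I" by (auto simp: valid_instance_def)
    with finished ne show False by simp
  qed
  then have ps: "partial_schedule I \<sigma> load {..<num_jobs I}" using sched by simp
  show "feasible I \<sigma>" "makespan I \<sigma> \<le> 3 / 2 * real T"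
    using partial_schedule_complete[OF ps load_le] by auto
qed

text \<open>Starting with \<open>carry\<close> set treats machine 0 like every machine entered
  later: it is skipped if full, and otherwise its charge starts at its load. The first item is then
  placed without being charged, which only adds slack.\<close>

lemma phase1_phase2:
  assumes inv: "phase1_inv I T {..<num_jobs I} load cnt mcl stk res \<sigma>"
    and load': "load' = (if cnt = 0 then load(0 := 0) else load)"
  shows "phase2_inv I T (\<lambda>v. if v < cnt then load v else 0) cnt
    (\<Sum>k<num_classes I. residual I res k) res 0 0 nom True True load' \<sigma>"
proof -
  interpret phase1_inv I T "{..<num_jobs I}" load cnt mcl stk res \<sigma> by (rule inv)
  show ?thesis
  proof (rule phase2_inv.intro)
    show "partial_schedule I \<sigma> load' ({..<num_jobs I} - deferred res)"
      unfolding load' using sched unopened[of 0] by (auto intro: partial_schedule_load_irrelevant)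
    show "2 * load' v \<le> 3 * T" if "\<sigma> v \<noteq> []" for v
      using that unopened[of v] load_le[of v] load' by (cases "v < cnt") auto
  qed (use deferred unopened remaining_new load' in simp_all)
qed

section \<open>The program\<close>

fun writes :: "com \<Rightarrow> string set" where
  "writes Skip = {}"
| "writes (Write a e1 e2) = {a}"
| "writes (Seq p q) = writes p \<union> writes q"
| "writes (Cond b p q) = writes p \<union> writes q"
| "writes (While b p) = writes p"

lemma exec_frame: "exec W p s k s' \<Longrightarrow> a \<notin> writes p \<Longrightarrow> s' a = s a"
  by (induction rule: exec.induct) (auto simp: update_def)

lemma runs_frame:
  "runs B W p t Q s \<Longrightarrow> runs B W p t (\<lambda>s'. Q s' \<and> (\<forall>a. a \<notin> writes p \<longrightarrow> s' a = s a)) s"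
  unfolding runs_def using exec_frame by metis

lemma wp_mono: "wp B p Q s \<Longrightarrow> (\<And>s'. Q s' \<Longrightarrow> Q' s') \<Longrightarrow> wp B p Q' s"
proof (induction p arbitrary: Q Q' s)
  case (Seq p q)
  show ?case using Seq.IH(1)[of "wp B q Q" s "wp B q Q'"] Seq.IH(2)[of Q _ Q'] Seq.prems by auto
qed (auto split: if_splits)

lemma wp_frame:
  "wp B p Q s \<Longrightarrow> wp B p (\<lambda>s'. Q s' \<and> (\<forall>a. a \<notin> writes p \<longrightarrow> s' a = s a)) s"
proof (induction p arbitrary: Q s)
  case (Seq p q)
  have "wp B p (wp B q Q) s" using Seq.prems by simp
  from Seq.IH(1)[OF this] have "wp B p (\<lambda>s'. wp B q Q s' \<and> (\<forall>a. a \<notin> writes p \<longrightarrow> s' a = s a)) s" .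
  then have "wp B p (wp B q (\<lambda>s'. Q s' \<and> (\<forall>a. a \<notin> writes (Seq p q) \<longrightarrow> s' a = s a))) s"
  proof (rule wp_mono, elim conjE)
    fix s' assume "wp B q Q s'" and fr: "\<forall>a. a \<notin> writes p \<longrightarrow> s' a = s a"
    from Seq.IH(2)[OF this(1)]
    show "wp B q (\<lambda>s'. Q s' \<and> (\<forall>a. a \<notin> writes (Seq p q) \<longrightarrow> s' a = s a)) s'"
      by (rule wp_mono) (use fr in simp)
  qed
  then show ?case by simp
next
  case (Cond b p q)
  show ?case
  proof (cases "ev s b = 0")
    case True
    with Cond.prems have "wp B q Q s" by simp
    from wp_mono[OF Cond.IH(2)[OF this]] True show ?thesis by simp
  next
    case False
    with Cond.prems have "wp B p Q s" by simp
    from wp_mono[OF Cond.IH(1)[OF this]] False show ?thesis by simp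
  qed
qed auto

lemma wp_bounded:
  "bounded B s \<Longrightarrow> wp B p Q s \<Longrightarrow> wp B p (\<lambda>s'. Q s' \<and> bounded B s') s"
proof (induction p arbitrary: Q s)
  case (Seq p q)
  have "wp B p (wp B q Q) s" using Seq.prems by simp
  from Seq.IH(1)[OF Seq.prems(1) this] have "wp B p (\<lambda>s'. wp B q Q s' \<and> bounded B s') s" .
  then have "wp B p (wp B q (\<lambda>s'. Q s' \<and> bounded B s')) s"
    by (rule wp_mono) (use Seq.IH(2) in blast)
  then show ?case by simp
qed (auto simp: bounded_def)

text \<open>Specifications of program pieces mention only what changes; this rule restores the bound
  on the cells and the arrays that are not written.\<close>

lemma wp_conseq:
  assumes "bounded B s" "wp B p Q s"
    "\<And>s'. Q s' \<Longrightarrow> bounded B s' \<Longrightarrow> (\<And>a. a \<notin> writes p \<Longrightarrow> s' a = s a) \<Longrightarrow> Q' s'"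
  shows "wp B p Q' s"
  by (rule wp_mono[OF wp_frame[OF wp_bounded[OF assms(1,2)]]]) (use assms(3) in blast)

section \<open>Code of the first phase\<close>

fun block :: "com list \<Rightarrow> com" where
  "block [] = Skip"
| "block (p # ps) = Seq p (block ps)"

abbreviation V :: "string \<Rightarrow> expr" where "V x \<equiv> Read x (Const 0)"
abbreviation assign :: "string \<Rightarrow> expr \<Rightarrow> com" where "assign x e \<equiv> Write x (Const 0) e"

text \<open>Schedules are written to buffer arrays, since a failed attempt must not overwrite the output of
  an earlier successful one.\<close>

definition emit :: "expr \<Rightarrow> expr \<Rightarrow> nat \<Rightarrow> expr \<Rightarrow> com" where
  "emit mach start kind x = block
     [Write ''bm'' (V ''bl'') mach, Write ''bs'' (V ''bl'') start,
      Write ''bk'' (V ''bl'') (Const kind), Write ''bi'' (V ''bl'') x,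
      assign ''bl'' (Bin Plus (V ''bl'') (Const 1))]"

definition put :: com where
  "put = block
     [assign ''u'' (Bin Minus (Read ''top'' (V ''i'')) (Const 1)),
      emit (V ''u'') (Read ''load'' (V ''u'')) 0 (V ''j''),
      Write ''load'' (V ''u'') (Bin Plus (Read ''load'' (V ''u'')) (Read ''t'' (V ''j''))),
      Cond (Bin Less (Read ''load'' (V ''u'')) (V ''T'')) Skip
        (Write ''top'' (V ''i'') (Read ''below'' (V ''u'')))]"

definition open_machine :: com where
  "open_machine =
     Cond (Bin Less (V ''cnt'') (V ''m''))
       (Cond (Bin Less (V ''T'') (V ''x''))
         (assign ''ph'' (Const 4))
         (block
           [emit (V ''cnt'') (Const 0) 1 (V ''i''),
            emit (V ''cnt'') (Read ''s'' (V ''i'')) 0 (V ''j''),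
            Write ''load'' (V ''cnt'') (V ''x''),
            Cond (Bin Less (V ''x'') (V ''T''))
              (block
                [Write ''below'' (V ''cnt'') (Read ''top'' (V ''i'')),
                 Write ''top'' (V ''i'') (Bin Plus (V ''cnt'') (Const 1))])
              Skip,
            assign ''cnt'' (Bin Plus (V ''cnt'') (Const 1))]))
       (assign ''ph'' (Const 4))"

definition defer_job :: com where
  "defer_job = block
     [Write ''next'' (V ''j'') (Read ''res'' (V ''i'')),
      Write ''res'' (V ''i'') (Bin Plus (V ''j'') (Const 1))]"

definition classify :: com where
  "classify = block
     [assign ''i'' (Read ''class'' (V ''j'')),
      assign ''x'' (Bin Plus (Read ''s'' (V ''i'')) (Read ''t'' (V ''j''))),
      Cond (Bin Less (V ''T'') (Bin Plus (Read ''t'' (V ''j'')) (Read ''t'' (V ''j''))))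
        (assign ''cat'' (Const 0))
        (Cond (Bin Less (V ''T'') (Bin Plus (V ''x'') (V ''x'')))
          (assign ''cat'' (Const 1)) (assign ''cat'' (Const 2)))]"

definition handle :: com where
  "handle =
     Cond (Bin Equal (V ''cat'') (V ''ph''))
       (Cond (V ''ph'')
         (Cond (Read ''top'' (V ''i'')) put
           (Cond (Bin Less (V ''ph'') (Const 2)) open_machine defer_job))
         open_machine)
       Skip"

definition next_job :: com where
  "next_job =
     Cond (Bin Less (V ''ph'') (Const 3))
       (Cond (Bin Less (Bin Plus (V ''j'') (Const 1)) (V ''n''))
         (assign ''j'' (Bin Plus (V ''j'') (Const 1)))
         (block [assign ''j'' (Const 0), assign ''ph'' (Bin Plus (V ''ph'') (Const 1))]))
       Skip"

text \<open>The jobs are scanned once for each category \<^verbatim>\<open>ph\<close> in 0, 1, 2; \<^verbatim>\<open>ph\<close> = 3 means that all jobs are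
  handled and \<^verbatim>\<open>ph\<close> = 4 that \<^verbatim>\<open>T\<close> is rejected.\<close>

definition body1 :: com where
  "body1 = Seq classify (Seq handle next_job)"

section \<open>Representation of schedules, stacks and lists by arrays\<close>

definition sched_of ::
  "(nat \<Rightarrow> nat) \<Rightarrow> (nat \<Rightarrow> nat) \<Rightarrow> (nat \<Rightarrow> nat) \<Rightarrow> (nat \<Rightarrow> nat) \<Rightarrow> nat \<Rightarrow> schedule" where
  "sched_of M S K X l u = map (\<lambda>k. (real (S k), if K k = 0 then Job (X k) else Setup (X k)))
     (filter (\<lambda>k. M k = u) [0..<l])"

text \<open>Taking the arrays rather than the state as arguments lets one notion serve both the
  buffer and the output, and makes the effect of emitting an entry visible as a rewrite
  rule.\<close>

lemma sched_of_snoc: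
  "sched_of (M(l := w)) (S(l := a)) (K(l := k)) (X(l := x)) (Suc l) =
     (sched_of M S K X l)(w := sched_of M S K X l w @ [(real a, if k = 0 then Job x else Setup x)])"
proof (rule ext)
  fix u
  have "map (\<lambda>i. (real ((S(l := a)) i), if (K(l := k)) i = 0 then Job ((X(l := x)) i) else Setup ((X(l := x)) i)))
      (filter (\<lambda>i. (M(l := w)) i = u) [0..<l]) =
    map (\<lambda>i. (real (S i), if K i = 0 then Job (X i) else Setup (X i))) (filter (\<lambda>i. M i = u) [0..<l])"
    by (rule map_cong[OF filter_cong]) auto
  then show "sched_of (M(l := w)) (S(l := a)) (K(l := k)) (X(l := x)) (Suc l) u =
     ((sched_of M S K X l)(w := sched_of M S K X l w @ [(real a, if k = 0 then Job x else Setup x)])) u"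
    by (simp add: sched_of_def)
qed

lemma output_schedule_eq:
  "output_schedule s = sched_of (s ''machine'') (s ''start'') (s ''kind'') (s ''id'') (s ''len'' 0)"
  by (rule ext) (simp add: output_schedule_def sched_of_def)

abbreviation buffer :: "state \<Rightarrow> schedule" where
  "buffer s \<equiv> sched_of (s ''bm'') (s ''bs'') (s ''bk'') (s ''bi'') (s ''bl'' 0)"

text \<open>A linked list with all pointers shifted by one, so that 0 can mark its end. Resetting
  the head empties the list, and old link cells may keep their contents.\<close>

fun chain :: "nat \<Rightarrow> (nat \<Rightarrow> nat) \<Rightarrow> nat list \<Rightarrow> bool" where
  "chain h nx [] \<longleftrightarrow> h = 0"
| "chain h nx (x # xs) \<longleftrightarrow> h = Suc x \<and> chain (nx x) nx xs"

lemma chain_update: "x \<notin> set xs \<Longrightarrow> chain h (nx(x := y)) xs \<longleftrightarrow> chain h nx xs"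
  by (induction xs arbitrary: h) auto

definition input_ok :: "batch_instance \<Rightarrow> state \<Rightarrow> bool" where
  "input_ok I s \<longleftrightarrow> s ''m'' 0 = num_machines I \<and> s ''n'' 0 = num_jobs I \<and>
     s ''c'' 0 = num_classes I \<and> (\<forall>j<num_jobs I. s ''t'' j = proc_time I j) \<and>
     (\<forall>j<num_jobs I. s ''class'' j = class_of I j) \<and>
     (\<forall>i<num_classes I. s ''s'' i = setup_time I i)"

definition total_work :: "batch_instance \<Rightarrow> nat" where
  "total_work I = (\<Sum>j<num_jobs I. proc_time I j + setup_time I (class_of I j))"

text \<open>A common bound for all stored values: loads are at most 3/2 T with T at most
  \<open>total_work I\<close>, the buffer has at most two entries per job, and machine numbers do
  not exceed the number of machines. The summand 10 covers constants and off-by-one values.\<close>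

definition bnd :: "batch_instance \<Rightarrow> nat" where
  "bnd I = 10 + 4 * (num_jobs I + num_machines I + total_work I)"

lemma total_work_ge: "j < num_jobs I \<Longrightarrow> proc_time I j + setup_time I (class_of I j) \<le> total_work I"
  unfolding total_work_def by (rule member_le_sum[where f = "\<lambda>j. proc_time I j + setup_time I (class_of I j)"]) auto

text \<open>The inequality on the buffer length gives every handled job two entries, one for itself
  and one for a setup, and reserves those of the deferred jobs for the second phase.\<close>

definition phase1_state :: "batch_instance \<Rightarrow> nat \<Rightarrow> nat set \<Rightarrow> state \<Rightarrow> bool" where
  "phase1_state I T D s \<longleftrightarrow> (\<exists>mcl stk res.
     phase1_inv I T D (s ''load'') (s ''cnt'' 0) mcl stk res (buffer s) \<and>
     (\<forall>i<num_classes I. chain (s ''top'' i) (s ''below'') (stk i)) \<and>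
     (\<forall>i<num_classes I. chain (s ''res'' i) (s ''next'') (res i)) \<and>
     s ''bl'' 0 + 2 * card (deferred res) \<le> 2 * card D)"

lemma phase1_stateI:
  assumes "phase1_inv I T D (s ''load'') (s ''cnt'' 0) mcl stk res (buffer s)"
    "\<And>i. i < num_classes I \<Longrightarrow> chain (s ''top'' i) (s ''below'') (stk i)"
    "\<And>i. i < num_classes I \<Longrightarrow> chain (s ''res'' i) (s ''next'') (res i)"
    "s ''bl'' 0 + 2 * card (deferred res) \<le> 2 * card D"
  shows "phase1_state I T D s"
  using assms by (auto simp: phase1_state_def)

section \<open>Correctness of the first phase\<close>

lemma wp_put:
  assumes ok: "input_ok I s" and v: "valid_instance I" and T: "s ''T'' 0 = T" "T \<le> total_work I"
    and st: "phase1_state I T D s" and bd: "bounded (bnd I) s"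
    and j: "s ''j'' 0 = j" "s ''i'' 0 = class_of I j" "j < num_jobs I" "j \<notin> D" "cat I T j \<noteq> 0"
    and top: "s ''top'' (class_of I j) \<noteq> 0"
  shows "wp (bnd I) put (phase1_state I T (insert j D)) s"
proof -
  from st obtain mcl stk res where
    inv: "phase1_inv I T D (s ''load'') (s ''cnt'' 0) mcl stk res (buffer s)" and
    tops: "\<And>i. i < num_classes I \<Longrightarrow> chain (s ''top'' i) (s ''below'') (stk i)" and
    ress: "\<And>i. i < num_classes I \<Longrightarrow> chain (s ''res'' i) (s ''next'') (res i)" and
    bl: "s ''bl'' 0 + 2 * card (deferred res) \<le> 2 * card D" by (auto simp: phase1_state_def)
  have ic: "class_of I j < num_classes I" using v j by (simp add: valid_instance_def)
  obtain u us where stk: "stk (class_of I j) = u # us"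
    using tops[OF ic] top by (cases "stk (class_of I j)") auto
  then have u: "s ''top'' (class_of I j) = Suc u" "chain (s ''below'' u) (s ''below'') us"
    using tops[OF ic] by auto
  note P = phase1_put[OF inv j(3-5) refl stk]
  have D: "D \<subseteq> {..<num_jobs I}" by (rule phase1_inv.processed[OF inv])
  then have "card D \<le> num_jobs I" using card_mono[OF _ D] by simp
  moreover have card: "card (insert j D) = Suc (card D)"
    using D j(4) by (meson card_insert_disjoint finite_lessThan finite_subset)
  moreover have le: "s a i \<le> bnd I" for a i using bd by (simp add: bounded_def)
  moreover have tj: "s ''t'' j = proc_time I j" using ok j by (simp add: input_ok_def)
  ultimately have bounds: "j \<le> bnd I" "u \<le> bnd I" "Suc (s ''bl'' 0) \<le> bnd I" "s ''load'' u + proc_time I j \<le> bnd I"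
    using le[of "''top''" "class_of I j"] bl u P(3) T(2) j(3) by (auto simp: bnd_def)
  have us: "u \<notin> set us" "set us \<subseteq> opened (s ''cnt'' 0) mcl (class_of I j)"
    using phase1_inv.distinct_stk[OF inv, of "class_of I j"]
      phase1_inv.set_stk[OF inv, of "class_of I j"] stk by auto
  show ?thesis
  proof (cases "s ''load'' u + proc_time I j < T")
    case True
    then have "phase1_inv I T (insert j D) ((s ''load'')(u := s ''load'' u + proc_time I j)) (s ''cnt'' 0)
      mcl stk res ((buffer s)(u := buffer s u @ [(real (s ''load'' u), Job j)]))"
      using P(4) by simp
    then show ?thesis
      unfolding put_def emit_def using True tj card bounds le tops ress bl u
      by (simp add: j T, intro phase1_stateI[where mcl = mcl and stk = stk and res = res])
        (simp_all add: sched_of_snoc)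
  next
    case False
    then have "phase1_inv I T (insert j D) ((s ''load'')(u := s ''load'' u + proc_time I j)) (s ''cnt'' 0)
      mcl (stk(class_of I j := us)) res ((buffer s)(u := buffer s u @ [(real (s ''load'' u), Job j)]))"
      using P(4) by simp
    then show ?thesis
      unfolding put_def emit_def using False tj card bounds le tops ress bl u
      by (simp add: j T,
          intro phase1_stateI[where mcl = mcl and stk = "stk(class_of I j := us)" and res = res])
        (simp_all add: sched_of_snoc)
  qed
qed

lemma wp_defer:
  assumes ok: "input_ok I s" and v: "valid_instance I"
    and st: "phase1_state I T D s" and bd: "bounded (bnd I) s"
    and j: "s ''j'' 0 = j" "s ''i'' 0 = class_of I j" "j < num_jobs I" "j \<notin> D" "cat I T j = 2"
    and top: "s ''top'' (class_of I j) = 0"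
  shows "wp (bnd I) defer_job (phase1_state I T (insert j D)) s"
proof -
  from st obtain mcl stk res where
    inv: "phase1_inv I T D (s ''load'') (s ''cnt'' 0) mcl stk res (buffer s)" and
    tops: "\<And>i. i < num_classes I \<Longrightarrow> chain (s ''top'' i) (s ''below'') (stk i)" and
    ress: "\<And>i. i < num_classes I \<Longrightarrow> chain (s ''res'' i) (s ''next'') (res i)" and
    bl: "s ''bl'' 0 + 2 * card (deferred res) \<le> 2 * card D" by (auto simp: phase1_state_def)
  have ic: "class_of I j < num_classes I" using v j by (simp add: valid_instance_def)
  have stk: "stk (class_of I j) = []"
    using tops[OF ic] top by (cases "stk (class_of I j)") auto
  have inv': "phase1_inv I T (insert j D) (s ''load'') (s ''cnt'' 0) mcl stk
      (res(class_of I j := j # res (class_of I j))) (buffer s)"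
    by (rule phase1_defer[OF inv j(3-5) refl stk])
  have D: "D \<subseteq> {..<num_jobs I}" by (rule phase1_inv.processed[OF inv])
  have card: "card (insert j D) = Suc (card D)"
    using D j(4) by (meson card_insert_disjoint finite_lessThan finite_subset)
  have le: "s a i \<le> bnd I" for a i using bd by (simp add: bounded_def)
  let ?res = "res(class_of I j := j # res (class_of I j))"
  have "deferred ?res = insert j (deferred res)"
  proof -
    have "set (?res k) = set (res k) \<union> (if k = class_of I j then {j} else {})" for k by simp
    then show ?thesis by (auto split: if_splits)
  qed
  moreover have "j \<notin> deferred res" "finite (deferred res)"
    using phase1_inv.deferred(2)[OF inv] j(4) D by (auto intro: finite_subset)
  ultimately have cd: "card (deferred ?res) = Suc (card (deferred res))" by simp
  have "j \<notin> set (res k)" for k using phase1_inv.deferred(2)[OF inv] j(4) by blast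
  then have ch: "chain h ((s ''next'')(j := y)) (res k) = chain h (s ''next'') (res k)" for k h y
    by (rule chain_update)
  have "Suc j \<le> bnd I" using j(3) by (simp add: bnd_def)
  then show ?thesis
    unfolding defer_job_def using card le tops ress bl ch inv' cd
    by (simp add: j, intro phase1_stateI[where mcl = mcl and stk = stk
        and res = "res(class_of I j := j # res (class_of I j))"]) simp_all
qed

lemma wp_open:
  assumes ok: "input_ok I s" and v: "valid_instance I" and T: "s ''T'' 0 = T" "T \<le> total_work I"
    and st: "phase1_state I T D s" and bd: "bounded (bnd I) s"
    and j: "s ''j'' 0 = j" "s ''i'' 0 = class_of I j" "j < num_jobs I" "j \<notin> D" "cat I T j < 2"
    and x: "s ''x'' 0 = setup_time I (class_of I j) + proc_time I j"
    and ord: "\<And>j'. j' \<in> D \<Longrightarrow> cat I T j' \<le> cat I T j"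
    and top: "cat I T j \<noteq> 0 \<Longrightarrow> s ''top'' (class_of I j) = 0"
  shows "wp (bnd I) open_machine (\<lambda>s'. s' ''ph'' 0 = s ''ph'' 0 \<and> phase1_state I T (insert j D) s' \<or>
    s' ''ph'' 0 = 4 \<and> (\<forall>f. \<not> fits I T f)) s"
proof -
  from st obtain mcl stk res where
    inv: "phase1_inv I T D (s ''load'') (s ''cnt'' 0) mcl stk res (buffer s)" and
    tops: "\<And>i. i < num_classes I \<Longrightarrow> chain (s ''top'' i) (s ''below'') (stk i)" and
    ress: "\<And>i. i < num_classes I \<Longrightarrow> chain (s ''res'' i) (s ''next'') (res i)" and
    bl: "s ''bl'' 0 + 2 * card (deferred res) \<le> 2 * card D" by (auto simp: phase1_state_def)
  let ?i = "class_of I j" and ?c = "s ''cnt'' 0"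
  let ?x = "setup_time I ?i + proc_time I j"
  have ic: "?i < num_classes I" using v j by (simp add: valid_instance_def)
  have stk: "stk ?i = []" if "cat I T j \<noteq> 0"
    using tops[OF ic] top[OF that] by (cases "stk ?i") auto
  note F = phase1_open_fits[OF inv v j(3-5) refl ord stk]
  note P = phase1_open[OF inv v j(3-5) refl ord stk]
  have D: "D \<subseteq> {..<num_jobs I}" by (rule phase1_inv.processed[OF inv])
  then have cD: "card D \<le> num_jobs I" using card_mono[OF _ D] by simp
  have card: "card (insert j D) = Suc (card D)"
    using D j(4) by (meson card_insert_disjoint finite_lessThan finite_subset)
  have le: "s a i \<le> bnd I" for a i using bd by (simp add: bounded_def)
  have in_eqs: "s ''m'' 0 = num_machines I" "s ''s'' ?i = setup_time I ?i"
    using ok ic by (simp_all add: input_ok_def)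
  have four: "4 \<le> bnd I" by (simp add: bnd_def)
  show ?thesis
  proof (cases "?c < num_machines I \<and> ?x \<le> T")
    case False
    then have "\<not> fits I T f" for f using F[of f] by blast
    then show ?thesis unfolding open_machine_def using False
      by (auto simp: in_eqs T x four)
  next
    case True
    have bounds: "j \<le> bnd I" "?i \<le> bnd I" "?x \<le> bnd I" "setup_time I ?i \<le> bnd I" "?c \<le> bnd I"
      using le[of "''j''" 0] le[of "''i''" 0] le[of "''x''" 0] le[of "''cnt''" 0] by (simp_all add: j x)
    have bounds': "Suc (Suc (s ''bl'' 0)) \<le> bnd I" "Suc (s ''bl'' 0) \<le> bnd I" "Suc ?c \<le> bnd I" "1 \<le> bnd I"
      using bl True cD by (auto simp: bnd_def)
    have "?c \<notin> set (stk k)" for k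
      using phase1_inv.set_stk[OF inv, of k] by (simp add: opened_def)
    then have ch: "chain h ((s ''below'')(?c := y)) (stk k) = chain h (s ''below'') (stk k)" for k h y
      by (rule chain_update)
    have inv': "phase1_inv I T (insert j D) ((s ''load'')(?c := ?x)) (Suc ?c) (mcl(?c := ?i))
      (stk(?i := if ?x < T then ?c # stk ?i else stk ?i)) res
      ((buffer s)(?c := [(0, Setup ?i), (real (setup_time I ?i), Job j)]))"
      by (rule P) (use True in auto)
    have em: "buffer s ?c = []" by (rule phase1_inv.unopened[OF inv]) simp
    show ?thesis
    proof (cases "?x < T")
      case lt: True
      then have inv'': "phase1_inv I T (insert j D) ((s ''load'')(?c := ?x)) (Suc ?c) (mcl(?c := ?i))
        (stk(?i := ?c # stk ?i)) res
        ((buffer s)(?c := [(0, Setup ?i), (real (setup_time I ?i), Job j)]))" using inv' by simp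
      show ?thesis unfolding open_machine_def emit_def
        using True lt card bounds bounds' le tops ress bl ch inv'' em
        by (simp add: j T in_eqs x, intro disjI1 phase1_stateI[where mcl = "mcl(?c := ?i)"
            and stk = "stk(?i := ?c # stk ?i)" and res = res])
          (simp_all add: sched_of_snoc)
    next
      case ge: False
      then have inv'': "phase1_inv I T (insert j D) ((s ''load'')(?c := ?x)) (Suc ?c) (mcl(?c := ?i))
        stk res ((buffer s)(?c := [(0, Setup ?i), (real (setup_time I ?i), Job j)]))" using inv' by simp
      show ?thesis unfolding open_machine_def emit_def
        using True ge card bounds bounds' le tops ress bl ch inv'' em
        by (simp add: j T in_eqs x, intro disjI1 phase1_stateI[where mcl = "mcl(?c := ?i)"
            and stk = stk and res = res])
          (simp_all add: sched_of_snoc)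
    qed
  qed
qed

lemma wp_classify:
  assumes ok: "input_ok I s" and v: "valid_instance I" and T: "s ''T'' 0 = T"
    and bd: "bounded (bnd I) s" and j: "s ''j'' 0 = j" "j < num_jobs I"
  shows "wp (bnd I) classify (\<lambda>s'. s' ''i'' 0 = class_of I j \<and>
    s' ''x'' 0 = setup_time I (class_of I j) + proc_time I j \<and> s' ''cat'' 0 = cat I T j) s"
proof -
  have ic: "class_of I j < num_classes I" using v j by (simp add: valid_instance_def)
  have eqs: "s ''class'' j = class_of I j" "s ''t'' j = proc_time I j"
    "s ''s'' (class_of I j) = setup_time I (class_of I j)"
    using ok j ic by (simp_all add: input_ok_def)
  have "class_of I j \<le> bnd I" using bd eqs(1) by (metis bounded_def)
  moreover have "setup_time I (class_of I j) + proc_time I j \<le> bnd I"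
    using total_work_ge[OF j(2)] by (simp add: bnd_def)
  moreover have "2 \<le> bnd I" by (simp add: bnd_def)
  ultimately show ?thesis unfolding classify_def cat_def
    by (simp add: j eqs T mult_2)
qed

lemma phase1_state_cong:
  assumes "phase1_state I T D s"
    "\<And>a. a \<in> {''load'', ''cnt'', ''bm'', ''bs'', ''bk'', ''bi'', ''bl'', ''top'', ''below'', ''res'', ''next''} \<Longrightarrow>
      s' a = s a"
  shows "phase1_state I T D s'"
  using assms(1) by (simp add: phase1_state_def assms(2))

lemma input_ok_cong:
  assumes "input_ok I s"
    "\<And>a. a \<in> {''m'', ''n'', ''c'', ''t'', ''class'', ''s''} \<Longrightarrow> s' a = s a"
  shows "input_ok I s'"
  using assms(1) by (simp add: input_ok_def assms(2))

text \<open>The jobs before (ph, j) in the lexicographic order of category and index. All lower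
  categories are included, which is the order that \<open>phase1_room\<close> relies on.\<close>

definition done_jobs :: "batch_instance \<Rightarrow> nat \<Rightarrow> nat \<Rightarrow> nat \<Rightarrow> nat set" where
  "done_jobs I T ph j = {j'. j' < num_jobs I \<and> (cat I T j' < ph \<or> cat I T j' = ph \<and> j' < j)}"

lemma done_jobs_step:
  assumes "j < num_jobs I"
  shows "done_jobs I T ph (Suc j) =
    (if cat I T j = ph then insert j (done_jobs I T ph j) else done_jobs I T ph j)"
  using assms by (auto simp: done_jobs_def less_Suc_eq)

lemma done_jobs_next: "done_jobs I T (Suc ph) 0 = done_jobs I T ph (num_jobs I)"
  by (auto simp: done_jobs_def less_Suc_eq)

lemma cat_less_3: "cat I T j < 3"
  by (simp add: cat_def)

lemma done_jobs_all: "done_jobs I T 3 0 = {..<num_jobs I}"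
  using cat_less_3[of I T] by (auto simp: done_jobs_def)

lemma wp_handle:
  assumes ok: "input_ok I s" and v: "valid_instance I" and T: "s ''T'' 0 = T" "T \<le> total_work I"
    and bd: "bounded (bnd I) s" and j: "s ''j'' 0 = j" "j < num_jobs I" "s ''i'' 0 = class_of I j"
    and x: "s ''x'' 0 = setup_time I (class_of I j) + proc_time I j"
    and cat: "s ''cat'' 0 = cat I T j"
    and ph: "s ''ph'' 0 = ph" "ph < 3" and st: "phase1_state I T (done_jobs I T ph j) s"
  shows "wp (bnd I) handle (\<lambda>s'. s' ''ph'' 0 = ph \<and> phase1_state I T (done_jobs I T ph (Suc j)) s' \<or>
    s' ''ph'' 0 = 4 \<and> (\<forall>f. \<not> fits I T f)) s"
proof (cases "cat I T j = ph")
  case False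
  then show ?thesis unfolding handle_def using st ph by (simp add: cat ph(1) done_jobs_step[OF j(2)])
next
  case True
  let ?D = "done_jobs I T ph j"
  have D: "done_jobs I T ph (Suc j) = insert j ?D" using True by (simp add: done_jobs_step[OF j(2)])
  have nD: "j \<notin> ?D" using True by (simp add: done_jobs_def)
  have ord: "cat I T j' \<le> cat I T j" if "j' \<in> ?D" for j'
    using that True by (auto simp: done_jobs_def)
  show ?thesis
  proof (cases "ph \<noteq> 0 \<and> s ''top'' (class_of I j) \<noteq> 0")
    case put: True
    have "wp (bnd I) put (phase1_state I T (insert j ?D)) s"
      by (rule wp_put[OF ok v T st bd j(1,3,2) nD]) (use True put in auto)
    then have "wp (bnd I) put (\<lambda>s'. s' ''ph'' 0 = ph \<and> phase1_state I T (done_jobs I T ph (Suc j)) s' \<or>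
      s' ''ph'' 0 = 4 \<and> (\<forall>f. \<not> fits I T f)) s"
      by (rule wp_conseq[OF bd]) (simp add: D put_def emit_def ph)
    then show ?thesis unfolding handle_def using put True by (simp add: cat ph(1) j)
  next
    case noput: False
    show ?thesis
    proof (cases "ph < 2")
      case lt: True
      have "wp (bnd I) open_machine (\<lambda>s'. s' ''ph'' 0 = s ''ph'' 0 \<and> phase1_state I T (insert j ?D) s' \<or>
          s' ''ph'' 0 = 4 \<and> (\<forall>f. \<not> fits I T f)) s"
        by (rule wp_open[OF ok v T st bd j(1,3,2) nD _ x ord]) (use True noput lt in auto)
      then show ?thesis unfolding handle_def using noput True lt D
        by (cases "ph = 0") (simp_all add: cat ph(1) j)
    next
      case ge: False
      have "wp (bnd I) defer_job (phase1_state I T (insert j ?D)) s"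
        by (rule wp_defer[OF ok v st bd j(1,3,2) nD]) (use True noput ge ph in auto)
      then have "wp (bnd I) defer_job (\<lambda>s'. s' ''ph'' 0 = ph \<and> phase1_state I T (done_jobs I T ph (Suc j)) s' \<or>
        s' ''ph'' 0 = 4 \<and> (\<forall>f. \<not> fits I T f)) s"
        by (rule wp_conseq[OF bd]) (simp add: D defer_job_def ph)
      then show ?thesis unfolding handle_def using noput True ge by (simp add: cat ph(1) j)
    qed
  qed
qed

text \<open>k is the number of job visits left in the three scans.\<close>

definition loop1_inv :: "batch_instance \<Rightarrow> nat \<Rightarrow> nat \<Rightarrow> state \<Rightarrow> bool" where
  "loop1_inv I T k s \<longleftrightarrow> input_ok I s \<and> s ''T'' 0 = T \<and>
     (s ''ph'' 0 < 3 \<and> s ''j'' 0 < num_jobs I \<and> k = (3 - s ''ph'' 0) * num_jobs I - s ''j'' 0 \<and>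
        phase1_state I T (done_jobs I T (s ''ph'' 0) (s ''j'' 0)) s \<or>
      s ''ph'' 0 = 3 \<and> k = 0 \<and> phase1_state I T {..<num_jobs I} s \<or>
      s ''ph'' 0 = 4 \<and> k = 0 \<and> (\<forall>f. \<not> fits I T f))"

lemma wp_body1:
  assumes inv: "loop1_inv I T k s" and v: "valid_instance I" and T: "T \<le> total_work I"
    and bd: "bounded (bnd I) s" and ph: "s ''ph'' 0 < 3"
  shows "wp (bnd I) body1 (\<lambda>s'. \<exists>k'<k. loop1_inv I T k' s') s"
proof -
  let ?ph = "s ''ph'' 0" and ?j = "s ''j'' 0"
  let ?n = "num_jobs I"
  from inv ph have ok: "input_ok I s" and sT: "s ''T'' 0 = T" and j: "?j < ?n"
    and k: "k = (3 - ?ph) * ?n - ?j" and st: "phase1_state I T (done_jobs I T ?ph ?j) s"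
    by (auto simp: loop1_inv_def)
  have "1 \<le> 3 - ?ph" using ph by linarith
  from mult_le_mono1[OF this, of ?n] have "?n \<le> (3 - ?ph) * ?n" by simp
  then have kpos: "0 < k" using j k by linarith
  let ?P = "\<lambda>s'. s' ''ph'' 0 = ?ph \<and> phase1_state I T (done_jobs I T ?ph (Suc ?j)) s' \<or>
    s' ''ph'' 0 = 4 \<and> (\<forall>f. \<not> fits I T f)"
  show ?thesis unfolding body1_def wp.simps
  proof (rule wp_conseq[OF bd wp_classify[OF ok v sT bd refl j]], elim conjE)
    fix s1 assume 1: "s1 ''i'' 0 = class_of I ?j"
      "s1 ''x'' 0 = setup_time I (class_of I ?j) + proc_time I ?j" "s1 ''cat'' 0 = cat I T ?j"
      and bd1: "bounded (bnd I) s1"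
      and "\<And>a. a \<notin> writes classify \<Longrightarrow> s1 a = s a"
    then have fr1: "\<And>a. a \<notin> {''i'', ''x'', ''cat''} \<Longrightarrow> s1 a = s a" by (simp add: classify_def)
    have ok1: "input_ok I s1" by (rule input_ok_cong[OF ok]) (rule fr1, auto)
    have st1: "phase1_state I T (done_jobs I T ?ph ?j) s1"
      by (rule phase1_state_cong[OF st]) (rule fr1, auto)
    have "wp (bnd I) handle ?P s1"
      by (rule wp_handle[OF ok1 v _ T bd1 _ j 1 _ ph st1]) (simp_all add: fr1 sT)
    then show "wp (bnd I) handle (wp (bnd I) next_job (\<lambda>s'. \<exists>k'<k. loop1_inv I T k' s')) s1"
    proof (rule wp_conseq[OF bd1])
      fix s2 assume P: "?P s2" and bd2: "bounded (bnd I) s2"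
        and fr: "\<And>a. a \<notin> writes handle \<Longrightarrow> s2 a = s1 a"
      have fr2: "s2 a = s1 a" if "a \<in> {''m'', ''n'', ''c'', ''t'', ''class'', ''s'', ''T'', ''j''}" for a
        by (rule fr) (use that in \<open>auto simp: handle_def put_def open_machine_def defer_job_def emit_def\<close>)
      have ok2: "input_ok I s2" by (rule input_ok_cong[OF ok1]) (rule fr2, auto)
      have e: "s2 ''T'' 0 = T" "s2 ''j'' 0 = ?j" "s2 ''n'' 0 = ?n"
        using fr1 fr2 sT ok2 by (simp_all add: input_ok_def)
      have b: "Suc ?j \<le> bnd I" "4 \<le> bnd I" using j by (auto simp: bnd_def)
      show "wp (bnd I) next_job (\<lambda>s'. \<exists>k'<k. loop1_inv I T k' s') s2"
      proof (cases "s2 ''ph'' 0 = ?ph")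
        case False
        with P have "s2 ''ph'' 0 = 4" "\<forall>f. \<not> fits I T f" by auto
        then show ?thesis unfolding next_job_def using kpos ok2 e(1)
          by (auto simp: loop1_inv_def)
      next
        case True
        with P ph have st2: "phase1_state I T (done_jobs I T ?ph (Suc ?j)) s2" by auto
        show ?thesis
        proof (cases "Suc ?j < ?n")
          case lt: True
          let ?s = "s2(''j'' := (s2 ''j'')(0 := Suc ?j))"
          have "phase1_state I T (done_jobs I T ?ph (Suc ?j)) ?s"
            by (rule phase1_state_cong[OF st2]) auto
          moreover have "input_ok I ?s" by (rule input_ok_cong[OF ok2]) auto
          ultimately have "loop1_inv I T (k - 1) ?s"
            unfolding loop1_inv_def using lt ph True e k by simp
          then show ?thesis unfolding next_job_def using True ph lt b kpos
            by (auto simp: e intro!: exI[of _ "k - 1"])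
        next
          case ge: False
          then have jn: "Suc ?j = ?n" using j by simp
          let ?s = "s2(''j'' := (s2 ''j'')(0 := 0), ''ph'' := (s2 ''ph'')(0 := Suc ?ph))"
          have st3: "phase1_state I T (done_jobs I T (Suc ?ph) 0) ?s"
            unfolding done_jobs_next using st2 unfolding jn by (rule phase1_state_cong) auto
          have ok3: "input_ok I ?s" by (rule input_ok_cong[OF ok2]) auto
          let ?k = "if Suc ?ph < 3 then (3 - Suc ?ph) * ?n else 0"
          have "loop1_inv I T ?k ?s"
            unfolding loop1_inv_def using ph True e k ok3 st3 j done_jobs_all[of I T]
            by (cases "?ph = 2") auto
          moreover have "?k < k"
          proof -
            have "(3 - ?ph) * ?n = (3 - Suc ?ph) * ?n + ?n"
              using ph by (metis Suc_diff_Suc add.commute mult_Suc)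
            then show ?thesis using k kpos j by auto
          qed
          ultimately have "\<exists>k'<k. loop1_inv I T k' ?s" by blast
          then show ?thesis unfolding next_job_def using True ph ge b ph
            by (simp add: e)
        qed
      qed
    qed
  qed
qed

lemma plain_body1: "plain body1"
  by (simp add: body1_def classify_def handle_def put_def open_machine_def defer_job_def emit_def
      next_job_def)

lemma runs_loop1:
  assumes v: "valid_instance I" and T: "T \<le> total_work I" and W: "20 * bnd I < W"
    and inv: "loop1_inv I T k s" and bd: "bounded (bnd I) s"
  shows "runs (bnd I) W (While (Bin Less (V ''ph'') (Const 3)) body1) (k * (cost body1 + 21) + 21)
    (\<lambda>s'. loop1_inv I T 0 s' \<and> 3 \<le> s' ''ph'' 0) s"
proof (rule runs_mono[OF runs_While[where Inv = "loop1_inv I T", OF _ W _ _ _ bd inv]])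
  show "5 \<le> bnd I" by (simp add: bnd_def)
  fix k s assume "bounded (bnd I) s" "loop1_inv I T k s" "ev s (Bin Less (V ''ph'') (Const 3)) \<noteq> 0"
  then show "runs (bnd I) W body1 (cost body1) (\<lambda>s'. \<exists>k'<k. loop1_inv I T k' s') s"
    by (intro runs_plain[OF _ W plain_body1] wp_body1[OF _ v T]) (auto simp: bnd_def split: if_splits)
next
  fix s' assume "(\<exists>k'. loop1_inv I T k' s') \<and> ev s' (Bin Less (V ''ph'') (Const 3)) = 0"
  then show "loop1_inv I T 0 s' \<and> 3 \<le> s' ''ph'' 0"
    by (auto simp: loop1_inv_def split: if_splits)
qed auto

section \<open>Code and correctness of the second phase\<close>

definition advance :: com where
  "advance = block
     [assign ''u'' (Bin Plus (V ''u'') (Const 1)),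
      Cond (Bin Less (V ''u'') (V ''cnt'')) Skip (Write ''load'' (V ''u'') (Const 0))]"

definition place_old :: com where
  "place_old = block
     [emit (V ''u'') (Read ''load'' (V ''u'')) 0 (V ''j''),
      Write ''load'' (V ''u'') (Bin Plus (Read ''load'' (V ''u'')) (Read ''t'' (V ''j''))),
      Write ''res'' (V ''i'') (Read ''next'' (V ''j''))]"

definition place_new :: com where
  "place_new = block
     [emit (V ''u'') (Read ''load'' (V ''u'')) 1 (V ''i''),
      Write ''load'' (V ''u'') (Bin Plus (Read ''load'' (V ''u'')) (Read ''s'' (V ''i''))),
      assign ''new'' (Const 0),
      place_old]"

text \<open>When the machines run out, \<open>i\<close> is set to the number of classes in order to
  leave the loop.\<close>

definition body2 :: com where
  "body2 =
     Cond (Read ''res'' (V ''i''))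
       (Seq (assign ''j'' (Bin Minus (Read ''res'' (V ''i'')) (Const 1)))
         (Cond (V ''carry'')
           (Cond (Bin Less (V ''u'') (V ''m''))
             (Cond (Bin Less (Read ''load'' (V ''u'')) (V ''T''))
               (block
                 [assign ''nom'' (Read ''load'' (V ''u'')), assign ''carry'' (Const 0), place_new])
               advance)
             (block [assign ''ph'' (Const 4), assign ''i'' (V ''c'')]))
           (block
             [Cond (V ''new'') (assign ''x'' (Bin Plus (Read ''s'' (V ''i'')) (Read ''t'' (V ''j''))))
                (assign ''x'' (Read ''t'' (V ''j''))),
              Cond (Bin Less (V ''T'') (Bin Plus (V ''nom'') (V ''x'')))
                (block [advance, assign ''carry'' (Const 1)])
                (block
                  [assign ''nom'' (Bin Plus (V ''nom'') (V ''x'')),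
                   Cond (V ''new'') place_new place_old])])))
       (block [assign ''i'' (Bin Plus (V ''i'') (Const 1)), assign ''new'' (Const 1)])"

text \<open>A deferred job weighs 2 because placing a carried item also clears \<open>carry\<close>,
  which adds 1. An overrun sets \<open>carry\<close> again and takes this 1 back. Finishing a class
  and skipping a full machine lower the first and the last summand.\<close>

definition phase2_measure :: "batch_instance \<Rightarrow> (nat \<Rightarrow> nat list) \<Rightarrow> state \<Rightarrow> nat" where
  "phase2_measure I res s = (num_classes I - s ''i'' 0) + 2 * card (deferred res) +
     (if s ''carry'' 0 = 0 then 1 else 0) + (s ''cnt'' 0 - s ''u'' 0)"

definition phase2_state ::
  "batch_instance \<Rightarrow> nat \<Rightarrow> (nat \<Rightarrow> nat) \<Rightarrow> nat \<Rightarrow> nat \<Rightarrow> state \<Rightarrow> bool" where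
  "phase2_state I T l R0 k s \<longleftrightarrow> (\<exists>res.
     phase2_inv I T l (s ''cnt'' 0) R0 res (s ''i'' 0) (s ''u'' 0) (s ''nom'' 0)
       (s ''carry'' 0 \<noteq> 0) (s ''new'' 0 \<noteq> 0) (s ''load'') (buffer s) \<and>
     (\<forall>i<num_classes I. chain (s ''res'' i) (s ''next'') (res i)) \<and>
     s ''bl'' 0 + 2 * card (deferred res) \<le> 2 * num_jobs I \<and> k = phase2_measure I res s)"

lemma phase2_stateI:
  assumes "phase2_inv I T l (s ''cnt'' 0) R0 res (s ''i'' 0) (s ''u'' 0) (s ''nom'' 0)
       (s ''carry'' 0 \<noteq> 0) (s ''new'' 0 \<noteq> 0) (s ''load'') (buffer s)"
    "\<And>i. i < num_classes I \<Longrightarrow> chain (s ''res'' i) (s ''next'') (res i)"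
    "s ''bl'' 0 + 2 * card (deferred res) \<le> 2 * num_jobs I"
    "phase2_measure I res s < k"
  shows "\<exists>k'<k. phase2_state I T l R0 k' s"
  using assms unfolding phase2_state_def by blast

lemma wp_body2:
  assumes ok: "input_ok I s" and v: "valid_instance I" and sT: "s ''T'' 0 = T" and T: "T \<le> total_work I"
    and st: "phase2_state I T l R0 k s" and bd: "bounded (bnd I) s"
    and i: "s ''i'' 0 < num_classes I"
    and tot: "\<And>f. fits I T f \<Longrightarrow> sum l {..<s ''cnt'' 0} + R0 \<le> num_machines I * T"
  shows "wp (bnd I) body2 (\<lambda>s'. s' ''ph'' 0 = s ''ph'' 0 \<and> (\<exists>k'<k. phase2_state I T l R0 k' s') \<or>
    s' ''ph'' 0 = 4 \<and> s' ''i'' 0 = num_classes I \<and> (\<forall>f. \<not> fits I T f)) s"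
proof -
  from st obtain res where
    inv: "phase2_inv I T l (s ''cnt'' 0) R0 res (s ''i'' 0) (s ''u'' 0) (s ''nom'' 0)
       (s ''carry'' 0 \<noteq> 0) (s ''new'' 0 \<noteq> 0) (s ''load'') (buffer s)" and
    ress: "\<And>i. i < num_classes I \<Longrightarrow> chain (s ''res'' i) (s ''next'') (res i)" and
    bl: "s ''bl'' 0 + 2 * card (deferred res) \<le> 2 * num_jobs I" and
    k: "k = phase2_measure I res s" by (auto simp: phase2_state_def)
  let ?i = "s ''i'' 0" and ?u = "s ''u'' 0" and ?nom = "s ''nom'' 0" and ?new = "s ''new'' 0 \<noteq> 0"
  let ?load = "s ''load''"
  have le: "s a i \<le> bnd I" for a i using bd by (simp add: bounded_def)
  have cle: "num_classes I \<le> bnd I" using le[of "''c''" 0] ok by (simp add: input_ok_def)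
  show ?thesis
  proof (cases "res ?i")
    case Nil
    then have r0: "s ''res'' ?i = 0" using ress[OF i] by simp
    have "\<exists>k'<k. phase2_state I T l R0 k' (s(''i'' := (s ''i'')(0 := Suc ?i), ''new'' := (s ''new'')(0 := 1)))"
      by (rule phase2_stateI[where res = res])
        (use phase2_next_class[OF inv i Nil] ress bl i in \<open>simp_all add: k phase2_measure_def\<close>)
    then show ?thesis unfolding body2_def using r0 i cle by simp
  next
    case (Cons j js)
    then have r: "s ''res'' ?i = Suc j" "chain (s ''next'' j) (s ''next'') js" using ress[OF i] by auto
    note P = deferred_ok_pop[OF phase2_inv.deferred[OF inv] Cons]
    let ?res = "res(?i := js)"
    have in_eqs: "s ''t'' j = proc_time I j" "s ''s'' ?i = setup_time I ?i" "s ''m'' 0 = num_machines I"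
      "s ''c'' 0 = num_classes I"
      using ok P(2) i by (simp_all add: input_ok_def)
    have "deferred res \<subseteq> {..<num_jobs I}"
      using phase2_inv.deferred[OF inv] by (auto simp: deferred_ok_def)
    then have fin: "finite (deferred res)" using finite_subset by blast
    have jd: "j \<in> deferred res" using Cons by (metis UN_I UNIV_I list.set_intros(1))
    then have card: "card (deferred res) = Suc (card (deferred ?res))"
      unfolding P(6) using card.remove[OF fin] by simp
    have bounds: "j \<le> bnd I" "?i \<le> bnd I" "?u \<le> bnd I" "Suc (Suc (s ''bl'' 0)) \<le> bnd I" "Suc (s ''bl'' 0) \<le> bnd I"
      "1 \<le> bnd I" "4 \<le> bnd I"
      using P(2) le[of _ 0] bl by (auto simp: bnd_def)
    show ?thesis
    proof (cases "s ''carry'' 0 \<noteq> 0")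
      case carry: True
      show ?thesis
      proof (cases "?u < num_machines I")
        case False
        then have "\<not> fits I T f" for f
          using phase2_fail[OF inv carry i Cons _ v tot] by (meson not_less)
        then show ?thesis unfolding body2_def using False r carry in_eqs bounds cle by simp
      next
        case u: True
        show ?thesis
        proof (cases "?load ?u < T")
          case True
          note Q = phase2_place_carry[OF inv carry i Cons u True]
          have "2 * (?load ?u + setup_time I ?i + proc_time I j) \<le> 3 * T"
            using phase2_inv.load_le[OF Q, of ?u] by simp
          then have "?load ?u + setup_time I ?i + proc_time I j \<le> bnd I"
            "?load ?u + setup_time I ?i \<le> bnd I" using T by (auto simp: bnd_def)
          then show ?thesis
            unfolding body2_def place_new_def place_old_def emit_def
            using r carry u True in_eqs bounds le Q ress bl card
            by (simp add: sT, intro disjI1 phase2_stateI[where res = ?res])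
              (simp_all add: sched_of_snoc k phase2_measure_def)
        next
          case False
          then have "T \<le> ?load ?u" by simp
          note Q = phase2_skip[OF inv carry i Cons u this v refl]
          show ?thesis
          proof (cases "Suc ?u < s ''cnt'' 0")
            case lt: True
            have "Suc ?u \<le> bnd I" using lt le[of "''cnt''" 0] by simp
            then show ?thesis
              unfolding body2_def advance_def
              using r carry u False in_eqs bounds le Q lt ress bl 
              by (simp add: sT, intro disjI1 phase2_stateI[where res = res])
                (simp_all add: k phase2_measure_def)
          next
            case ge: False
            have "Suc ?u \<le> bnd I" using u by (simp add: bnd_def)
            then show ?thesis
              unfolding body2_def advance_def
              using r carry u False in_eqs bounds le Q ge ress bl 
              by (simp add: sT, intro disjI1 phase2_stateI[where res = res])
                (simp_all add: k phase2_measure_def)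
          qed
        qed
      qed
    next
      case nc: False
      have u: "?u < num_machines I" by (rule phase2_inv.here(1)[OF inv nc])
      let ?x = "item_size I ?i j ?new"
      have x: "?x \<le> bnd I" using total_work_ge[OF P(2)] P(3) by (auto simp: item_size_def bnd_def)
      have xs: "(if ?new then setup_time I ?i + proc_time I j else proc_time I j) = ?x"
        by (simp add: item_size_def)
      show ?thesis
      proof (cases "T < ?nom + ?x")
        case True
        note Q = phase2_cross[OF inv nc i Cons True refl]
        have ub: "Suc ?u \<le> bnd I" using u by (simp add: bnd_def)
        show ?thesis
        proof (cases ?new)
          case n: True
          show ?thesis
          proof (cases "Suc ?u < s ''cnt'' 0")
            case lt: True
            then show ?thesis
              unfolding body2_def advance_def
              using r nc u True in_eqs bounds le Q ress bl ub x n
              by (simp add: sT item_size_def, intro disjI1 phase2_stateI[where res = res])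
                (simp_all add: k phase2_measure_def)
          next
            case ge: False
            then show ?thesis
              unfolding body2_def advance_def
              using r nc u True in_eqs bounds le Q ress bl ub x n
              by (simp add: sT item_size_def, intro disjI1 phase2_stateI[where res = res])
                (simp_all add: k phase2_measure_def)
          qed
        next
          case n: False
          show ?thesis
          proof (cases "Suc ?u < s ''cnt'' 0")
            case lt: True
            then show ?thesis
              unfolding body2_def advance_def
              using r nc u True in_eqs bounds le Q ress bl ub x n
              by (simp add: sT item_size_def, intro disjI1 phase2_stateI[where res = res])
                (simp_all add: k phase2_measure_def)
          next
            case ge: False
            then show ?thesis
              unfolding body2_def advance_def
              using r nc u True in_eqs bounds le Q ress bl ub x n
              by (simp add: sT item_size_def, intro disjI1 phase2_stateI[where res = res])
                (simp_all add: k phase2_measure_def)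
          qed
        qed
      next
        case False
        then have nom: "?nom + ?x \<le> T" by simp
        have nb: "?nom + ?x \<le> bnd I" using nom T by (simp add: bnd_def)
        show ?thesis
        proof (cases ?new)
          case n: True
          note Q = phase2_place_new[OF inv nc n i Cons nom]
          have "2 * (?load ?u + setup_time I ?i + proc_time I j) \<le> 3 * T"
            using phase2_inv.load_le[OF Q, of ?u] by simp
          then have "?load ?u + setup_time I ?i + proc_time I j \<le> bnd I"
            "?load ?u + setup_time I ?i \<le> bnd I" using T by (auto simp: bnd_def)
          then show ?thesis
            unfolding body2_def place_new_def place_old_def emit_def
            using r nc u False in_eqs bounds le Q ress bl card nb x n
            by (simp add: sT item_size_def, intro disjI1 phase2_stateI[where res = ?res])
              (simp_all add: sched_of_snoc k phase2_measure_def)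
        next
          case n: False
          note Q = phase2_place_old[OF inv nc n i Cons nom]
          have "2 * (?load ?u + proc_time I j) \<le> 3 * T"
            using phase2_inv.load_le[OF Q, of ?u] by simp
          then have "?load ?u + proc_time I j \<le> bnd I" using T by (auto simp: bnd_def)
          then show ?thesis
            unfolding body2_def place_old_def emit_def
            using r nc u False in_eqs bounds le Q ress bl card nb x n
            by (simp add: sT item_size_def, intro disjI1 phase2_stateI[where res = ?res])
              (simp_all add: sched_of_snoc k phase2_measure_def)
        qed
      qed
    qed
  qed
qed

lemma plain_body2: "plain body2"
  by (simp add: body2_def advance_def place_new_def place_old_def emit_def)

definition loop2_inv ::
  "batch_instance \<Rightarrow> nat \<Rightarrow> (nat \<Rightarrow> nat) \<Rightarrow> nat \<Rightarrow> nat \<Rightarrow> nat \<Rightarrow> state \<Rightarrow> bool" where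
  "loop2_inv I T l R0 cnt k s \<longleftrightarrow> input_ok I s \<and> s ''T'' 0 = T \<and> s ''cnt'' 0 = cnt \<and>
     (s ''ph'' 0 = 3 \<and> phase2_state I T l R0 k s \<or>
      s ''ph'' 0 = 4 \<and> k = 0 \<and> s ''i'' 0 = num_classes I \<and> (\<forall>f. \<not> fits I T f))"

lemma runs_body2:
  assumes v: "valid_instance I" and T: "T \<le> total_work I" and W: "20 * bnd I < W"
    and inv: "loop2_inv I T l R0 cnt k s" and bd: "bounded (bnd I) s" and i: "s ''i'' 0 < s ''c'' 0"
    and tot: "\<And>f. fits I T f \<Longrightarrow> sum l {..<cnt} + R0 \<le> num_machines I * T"
  shows "runs (bnd I) W body2 (cost body2) (\<lambda>s'. \<exists>k'<k. loop2_inv I T l R0 cnt k' s') s"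
proof (rule runs_plain[OF _ W plain_body2 bd])
  show "5 \<le> bnd I" by (simp add: bnd_def)
  have ok: "input_ok I s" and c: "s ''c'' 0 = num_classes I" and sT: "s ''T'' 0 = T"
    and cnt: "s ''cnt'' 0 = cnt"
    using inv by (simp_all add: loop2_inv_def input_ok_def)
  have ph: "s ''ph'' 0 = 3" and st: "phase2_state I T l R0 k s"
    using inv i c by (auto simp: loop2_inv_def)
  have kpos: "0 < k" using st i c by (auto simp: phase2_state_def phase2_measure_def)
  have ic: "s ''i'' 0 < num_classes I" using i c by simp
  have tot': "sum l {..<s ''cnt'' 0} + R0 \<le> num_machines I * T" if "fits I T f" for f
    using tot[OF that] by (simp add: cnt)
  show "wp (bnd I) body2 (\<lambda>s'. \<exists>k'<k. loop2_inv I T l R0 cnt k' s') s"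
  proof (rule wp_conseq[OF bd wp_body2[OF ok v sT T st bd ic tot']])
    fix s' assume P: "s' ''ph'' 0 = s ''ph'' 0 \<and> (\<exists>k'<k. phase2_state I T l R0 k' s') \<or>
      s' ''ph'' 0 = 4 \<and> s' ''i'' 0 = num_classes I \<and> (\<forall>f. \<not> fits I T f)"
    assume fr: "\<And>a. a \<notin> writes body2 \<Longrightarrow> s' a = s a"
    have fr': "s' a = s a" if "a \<in> {''m'', ''n'', ''c'', ''t'', ''class'', ''s'', ''T'', ''cnt''}" for a
      by (rule fr) (use that in \<open>auto simp: body2_def advance_def place_new_def place_old_def emit_def\<close>)
    have ok': "input_ok I s'" by (rule input_ok_cong[OF ok]) (rule fr', auto)
    have e: "s' ''T'' 0 = T" "s' ''cnt'' 0 = cnt" using fr' sT cnt by simp_all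
    from P show "\<exists>k'<k. loop2_inv I T l R0 cnt k' s'"
    proof (elim disjE conjE exE)
      fix k' assume "s' ''ph'' 0 = s ''ph'' 0" "k' < k" "phase2_state I T l R0 k' s'"
      then show ?thesis using ph ok' e by (auto simp: loop2_inv_def)
    next
      assume "s' ''ph'' 0 = 4" "s' ''i'' 0 = num_classes I" "\<forall>f. \<not> fits I T f"
      then show ?thesis using kpos ok' e by (auto simp: loop2_inv_def intro!: exI[of _ 0])
    qed
  qed
qed

section \<open>The complete test of one value T\<close>

definition reset_body :: com where
  "reset_body = block
     [Write ''top'' (V ''k'') (Const 0), Write ''res'' (V ''k'') (Const 0),
      assign ''k'' (Bin Plus (V ''k'') (Const 1))]"

definition init1 :: com where
  "init1 = block [assign ''cnt'' (Const 0), assign ''bl'' (Const 0), assign ''ph'' (Const 0),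
     assign ''j'' (Const 0)]"

definition init2 :: com where
  "init2 = block
     [Cond (V ''cnt'') Skip (Write ''load'' (Const 0) (Const 0)),
      assign ''u'' (Const 0), assign ''new'' (Const 1), assign ''carry'' (Const 1),
      Cond (Bin Equal (V ''ph'') (Const 3)) (assign ''i'' (Const 0)) (assign ''i'' (V ''c''))]"

definition attempt :: com where
  "attempt =
     Seq (assign ''k'' (Const 0))
    (Seq (While (Bin Less (V ''k'') (V ''c'')) reset_body)
    (Seq init1
    (Seq (While (Bin Less (V ''ph'') (Const 3)) body1)
    (Seq init2
         (While (Bin Less (V ''i'') (V ''c'')) body2)))))"

text \<open>Per job, the loops make 1 + 3 + 4 rounds with overhead 21 each, and the three final
  guards cost 21 each; these 231 units are covered by 400.\<close>

definition attempt_cost :: nat where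
  "attempt_cost = cost (assign ''k'' (Const 0)) + cost reset_body + cost init1 + 3 * cost body1 +
     cost init2 + 4 * cost body2 + 400"

definition attempt_post :: "batch_instance \<Rightarrow> nat \<Rightarrow> state \<Rightarrow> bool" where
  "attempt_post I T s \<longleftrightarrow>
     s ''ph'' 0 = 3 \<and> feasible I (buffer s) \<and> makespan I (buffer s) \<le> 3 / 2 * real T \<and>
       s ''bl'' 0 \<le> 2 * num_jobs I \<or>
     s ''ph'' 0 = 4 \<and> (\<forall>f. \<not> fits I T f)"

lemma num_classes_le:
  assumes "valid_instance I"
  shows "num_classes I \<le> num_jobs I"
proof -
  have "{..<num_classes I} \<subseteq> class_of I ` {..<num_jobs I}"
    using assms by (fastforce simp: valid_instance_def class_jobs_def)
  then have "card {..<num_classes I} \<le> card {..<num_jobs I}"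
    by (meson card_image_le card_mono finite_imageI finite_lessThan le_trans)
  then show ?thesis by simp
qed

text \<open>l, R0 and cnt freeze the loads and the deferred work at the end of the first phase,
  since the loop invariant refers to them while the arrays change. If the first phase has rejected
  T, no f fits and the bound holds for any choice.\<close>

lemma wp_init2:
  assumes inv: "loop1_inv I T 0 s" "3 \<le> s ''ph'' 0" and v: "valid_instance I"
    and bd: "bounded (bnd I) s"
  shows "\<exists>l R0 cnt. (\<forall>f. fits I T f \<longrightarrow> sum l {..<cnt} + R0 \<le> num_machines I * T) \<and>
    wp (bnd I) init2 (\<lambda>s'. \<exists>k \<le> 4 * num_jobs I. loop2_inv I T l R0 cnt k s') s"
proof -
  have ok: "input_ok I s" and sT: "s ''T'' 0 = T" using inv(1) by (simp_all add: loop1_inv_def)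
  have c: "s ''c'' 0 = num_classes I" using ok by (simp add: input_ok_def)
  have b: "1 \<le> bnd I" "num_classes I \<le> bnd I"
    using num_classes_le[OF v] by (simp_all add: bnd_def)
  show ?thesis
  proof (cases "s ''ph'' 0 = 3")
    case False
    then have ph: "s ''ph'' 0 = 4" and nf: "\<forall>f. \<not> fits I T f" using inv by (auto simp: loop1_inv_def)
    have "wp (bnd I) init2 (\<lambda>s'. s' ''i'' 0 = num_classes I) s"
      unfolding init2_def using ph b by (simp add: c)
    then have "wp (bnd I) init2 (\<lambda>s'. \<exists>k \<le> 4 * num_jobs I. loop2_inv I T l R0 (s ''cnt'' 0) k s') s" for l R0
    proof (rule wp_conseq[OF bd])
      fix s' assume i: "s' ''i'' 0 = num_classes I" and fr: "\<And>a. a \<notin> writes init2 \<Longrightarrow> s' a = s a"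
      have fr': "s' a = s a" if "a \<notin> {''load'', ''u'', ''new'', ''carry'', ''i''}" for a
        by (rule fr) (use that in \<open>simp add: init2_def\<close>)
      have "input_ok I s'" by (rule input_ok_cong[OF ok]) (rule fr', auto)
      then have "loop2_inv I T l R0 (s ''cnt'' 0) 0 s'"
        using i ph nf fr' sT by (simp add: loop2_inv_def)
      then show "\<exists>k \<le> 4 * num_jobs I. loop2_inv I T l R0 (s ''cnt'' 0) k s'" by blast
    qed
    with nf show ?thesis by blast
  next
    case ph: True
    then have "phase1_state I T {..<num_jobs I} s" using inv by (auto simp: loop1_inv_def)
    then obtain mcl stk res where
      inv1: "phase1_inv I T {..<num_jobs I} (s ''load'') (s ''cnt'' 0) mcl stk res (buffer s)" and
      ress: "\<And>i. i < num_classes I \<Longrightarrow> chain (s ''res'' i) (s ''next'') (res i)" and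
      bl: "s ''bl'' 0 + 2 * card (deferred res) \<le> 2 * num_jobs I" by (auto simp: phase1_state_def)
    let ?cnt = "s ''cnt'' 0"
    let ?l = "\<lambda>v. if v < ?cnt then s ''load'' v else 0"
    let ?R0 = "\<Sum>k<num_classes I. residual I res k"
    let ?load = "if ?cnt = 0 then (s ''load'')(0 := 0) else s ''load''"
    have tot: "sum ?l {..<?cnt} + ?R0 \<le> num_machines I * T" if "fits I T f" for f
      using phase1_total[OF inv1 v that] by simp
    have inv2: "phase2_inv I T ?l ?cnt ?R0 res 0 0 (s ''nom'' 0) True True ?load (buffer s)"
      by (rule phase1_phase2[OF inv1 refl])
    have "wp (bnd I) init2 (\<lambda>s'. s' ''i'' 0 = 0 \<and> s' ''u'' 0 = 0 \<and> s' ''new'' 0 = 1 \<and> s' ''carry'' 0 = 1 \<and>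
      s' ''load'' = ?load) s"
      unfolding init2_def using ph b by (simp add: c)
    then have "wp (bnd I) init2 (\<lambda>s'. \<exists>k \<le> 4 * num_jobs I. loop2_inv I T ?l ?R0 ?cnt k s') s"
    proof (rule wp_conseq[OF bd], elim conjE)
      fix s' assume i: "s' ''i'' 0 = 0" "s' ''u'' 0 = 0" "s' ''new'' 0 = 1" "s' ''carry'' 0 = 1"
        "s' ''load'' = ?load" and fr: "\<And>a. a \<notin> writes init2 \<Longrightarrow> s' a = s a"
      have fr': "s' a = s a" if "a \<notin> {''load'', ''u'', ''new'', ''carry'', ''i''}" for a
        by (rule fr) (use that in \<open>simp add: init2_def\<close>)
      have ok': "input_ok I s'" by (rule input_ok_cong[OF ok]) (rule fr', auto)
      have "phase2_state I T ?l ?R0 (phase2_measure I res s') s'"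
        unfolding phase2_state_def
        by (rule exI[of _ res]) (use inv2 ress bl in \<open>simp add: fr' i\<close>)
      then have "loop2_inv I T ?l ?R0 ?cnt (phase2_measure I res s') s'"
        using ok' sT ph by (simp add: loop2_inv_def fr')
      \<comment> \<open>At most n classes, weight 2 for each of at most n deferred jobs, and at most
        n opened machines; the summand for \<open>carry\<close> is 0 because \<open>carry\<close> is
        set.\<close>
      moreover have "phase2_measure I res s' \<le> 4 * num_jobs I"
      proof -
        have "deferred res \<subseteq> {..<num_jobs I}" by (rule phase1_inv.deferred(2)[OF inv1])
        from card_mono[OF _ this] have "card (deferred res) \<le> num_jobs I" by simp
        moreover have "?cnt \<le> num_jobs I" using phase1_inv.cnt_le(2)[OF inv1] by simp
        ultimately show ?thesis using num_classes_le[OF v] by (simp add: phase2_measure_def fr' i)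
      qed
      ultimately show "\<exists>k \<le> 4 * num_jobs I. loop2_inv I T ?l ?R0 ?cnt k s'" by blast
    qed
    with tot show ?thesis by blast
  qed
qed

lemma runs_reset:
  assumes v: "valid_instance I" and W: "20 * bnd I < W" and ok: "input_ok I s"
    and k: "s ''k'' 0 = 0" and bd: "bounded (bnd I) s"
  shows "runs (bnd I) W (While (Bin Less (V ''k'') (V ''c'')) reset_body)
    (num_jobs I * (cost reset_body + 21) + 21)
    (\<lambda>s'. \<forall>i<num_classes I. s' ''top'' i = 0 \<and> s' ''res'' i = 0) s"
proof -
  define Inv where "Inv k s \<longleftrightarrow> s ''c'' 0 = num_classes I \<and> s ''k'' 0 + k = num_classes I \<and>
    (\<forall>i < s ''k'' 0. s ''top'' i = 0 \<and> s ''res'' i = 0)" for k and s :: state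
  have c: "s ''c'' 0 = num_classes I" using ok by (simp add: input_ok_def)
  have "runs (bnd I) W (While (Bin Less (V ''k'') (V ''c'')) reset_body)
    (num_classes I * (cost reset_body + 21) + 21)
    (\<lambda>s'. (\<exists>k. Inv k s') \<and> ev s' (Bin Less (V ''k'') (V ''c'')) = 0) s"
  proof (rule runs_While[OF _ W _ _ _ bd])
    show "5 \<le> bnd I" by (simp add: bnd_def)
    show "Inv (num_classes I) s" using c k by (simp add: Inv_def)
    fix k s assume bd: "bounded (bnd I) s" and inv: "Inv k s" and b: "ev s (Bin Less (V ''k'') (V ''c'')) \<noteq> 0"
    show "runs (bnd I) W reset_body (cost reset_body) (\<lambda>s'. \<exists>k'<k. Inv k' s') s"
    proof (rule runs_plain[OF _ W _ bd])
      show "5 \<le> bnd I" by (simp add: bnd_def)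
      show "plain reset_body" by (simp add: reset_body_def)
      have "Suc (s ''k'' 0) \<le> bnd I"
        using b inv num_classes_le[OF v] by (auto simp: Inv_def bnd_def split: if_splits)
      then show "wp (bnd I) reset_body (\<lambda>s'. \<exists>k'<k. Inv k' s') s"
        unfolding reset_body_def using inv b
        by (auto simp: Inv_def less_Suc_eq split: if_splits intro!: exI[of _ "k - 1"])
    qed
  qed auto
  then show ?thesis
  proof (rule runs_mono)
    show "num_classes I * (cost reset_body + 21) + 21 \<le> num_jobs I * (cost reset_body + 21) + 21"
      using num_classes_le[OF v] by (simp add: mult_le_mono1)
  qed (auto simp: Inv_def split: if_splits)
qed

lemma runs_loop2:
  assumes v: "valid_instance I" and T: "T \<le> total_work I" and W: "20 * bnd I < W"
    and inv: "loop2_inv I T l R0 cnt k s" and k: "k \<le> 4 * num_jobs I" and bd: "bounded (bnd I) s"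
    and tot: "\<And>f. fits I T f \<Longrightarrow> sum l {..<cnt} + R0 \<le> num_machines I * T"
  shows "runs (bnd I) W (While (Bin Less (V ''i'') (V ''c'')) body2)
    (4 * num_jobs I * (cost body2 + 21) + 21) (attempt_post I T) s"
proof (rule runs_mono[OF runs_While[where Inv = "loop2_inv I T l R0 cnt", OF _ W _ _ _ bd inv]])
  show "5 \<le> bnd I" by (simp add: bnd_def)
  fix k s assume "bounded (bnd I) s" "loop2_inv I T l R0 cnt k s" "ev s (Bin Less (V ''i'') (V ''c'')) \<noteq> 0"
  then show "runs (bnd I) W body2 (cost body2) (\<lambda>s'. \<exists>k'<k. loop2_inv I T l R0 cnt k' s') s"
    by (intro runs_body2[OF v T W _ _ _ tot]) (auto split: if_splits)
next
  show "k * (cost body2 + 21) + 21 \<le> 4 * num_jobs I * (cost body2 + 21) + 21"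
    by (intro add_right_mono mult_le_mono1 k)
next
  fix s' assume *: "(\<exists>k'. loop2_inv I T l R0 cnt k' s') \<and> ev s' (Bin Less (V ''i'') (V ''c'')) = 0"
  then obtain k' where k': "loop2_inv I T l R0 cnt k' s'" by blast
  then have "s' ''c'' 0 = num_classes I" by (simp add: loop2_inv_def input_ok_def)
  with * have ge: "num_classes I \<le> s' ''i'' 0" by (simp split: if_splits)
  show "attempt_post I T s'"
  proof (cases "s' ''ph'' 0 = 3")
    case False
    then show ?thesis using k' by (auto simp: loop2_inv_def attempt_post_def)
  next
    case True
    then obtain res where inv2: "phase2_inv I T l (s' ''cnt'' 0) R0 res (s' ''i'' 0) (s' ''u'' 0) (s' ''nom'' 0)
       (s' ''carry'' 0 \<noteq> 0) (s' ''new'' 0 \<noteq> 0) (s' ''load'') (buffer s')"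
      and bl: "s' ''bl'' 0 + 2 * card (deferred res) \<le> 2 * num_jobs I"
      using k' by (auto simp: loop2_inv_def phase2_state_def)
    have iN: "s' ''i'' 0 = num_classes I" using ge phase2_inv.i_le[OF inv2] by simp
    then show ?thesis using phase2_complete[OF inv2[unfolded iN] v] True bl
      by (simp add: attempt_post_def)
  qed
qed auto

lemma runs_attempt:
  assumes v: "valid_instance I" and T: "T \<le> total_work I" and W: "20 * bnd I < W"
    and ok: "input_ok I s" and sT: "s ''T'' 0 = T" and bd: "bounded (bnd I) s"
  shows "runs (bnd I) W attempt (attempt_cost * num_jobs I) (attempt_post I T) s"
proof -
  let ?n = "num_jobs I" and ?B = "bnd I"
  have B5: "5 \<le> ?B" by (simp add: bnd_def)
  have n: "1 \<le> ?n" using v by (simp add: valid_instance_def)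
  let ?w1 = "While (Bin Less (V ''k'') (V ''c'')) reset_body"
  let ?w2 = "While (Bin Less (V ''ph'') (Const 3)) body1"
  let ?w3 = "While (Bin Less (V ''i'') (V ''c'')) body2"
  let ?R = "\<lambda>s. input_ok I s \<and> s ''T'' 0 = T"
  have "runs ?B W attempt (cost (assign ''k'' (Const 0)) + ((?n * (cost reset_body + 21) + 21) +
    (cost init1 + ((3 * ?n * (cost body1 + 21) + 21) + (cost init2 + (4 * ?n * (cost body2 + 21) + 21))))))
    (attempt_post I T) s"
    unfolding attempt_def
  proof (rule runs_Seq)
    show "runs ?B W (assign ''k'' (Const 0)) (cost (assign ''k'' (Const 0)))
      (\<lambda>s. ?R s \<and> s ''k'' 0 = 0) s"
      by (rule runs_plain[OF B5 W _ bd]) (use ok sT in \<open>simp_all add: input_ok_def\<close>)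
  next
    fix s assume bd: "bounded ?B s" and R: "?R s \<and> s ''k'' 0 = 0"
    show "runs ?B W (Seq ?w1 (Seq init1 (Seq ?w2 (Seq init2 ?w3)))) ((?n * (cost reset_body + 21) + 21) +
      (cost init1 + ((3 * ?n * (cost body1 + 21) + 21) + (cost init2 + (4 * ?n * (cost body2 + 21) + 21)))))
      (attempt_post I T) s"
    proof (rule runs_Seq)
      have "runs ?B W ?w1 (?n * (cost reset_body + 21) + 21)
        (\<lambda>s'. \<forall>i<num_classes I. s' ''top'' i = 0 \<and> s' ''res'' i = 0) s"
        by (rule runs_reset[OF v W _ _ bd]) (use R in auto)
      from runs_frame[OF this]
      show "runs ?B W ?w1 (?n * (cost reset_body + 21) + 21)
        (\<lambda>s'. ?R s' \<and> (\<forall>i<num_classes I. s' ''top'' i = 0 \<and> s' ''res'' i = 0)) s"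
      proof (rule runs_mono)
        fix s' assume *: "(\<forall>i<num_classes I. s' ''top'' i = 0 \<and> s' ''res'' i = 0) \<and>
          (\<forall>a. a \<notin> writes ?w1 \<longrightarrow> s' a = s a)"
        then have fr: "s' a = s a" if "a \<notin> {''top'', ''res'', ''k''}" for a
          using that by (simp add: reset_body_def)
        have "input_ok I s'" by (rule input_ok_cong[OF conjunct1[OF conjunct1[OF R]]]) (rule fr, auto)
        then show "?R s' \<and> (\<forall>i<num_classes I. s' ''top'' i = 0 \<and> s' ''res'' i = 0)"
          using conjunct1[OF *] R fr[of "''T''"] by simp
      qed simp
    next
      fix s assume bd: "bounded ?B s"
        and R: "?R s \<and> (\<forall>i<num_classes I. s ''top'' i = 0 \<and> s ''res'' i = 0)"
      show "runs ?B W (Seq init1 (Seq ?w2 (Seq init2 ?w3)))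
        (cost init1 + ((3 * ?n * (cost body1 + 21) + 21) + (cost init2 + (4 * ?n * (cost body2 + 21) + 21))))
        (attempt_post I T) s"
      proof (rule runs_Seq)
        show "runs ?B W init1 (cost init1) (loop1_inv I T (3 * ?n)) s"
        proof (rule runs_plain[OF B5 W _ bd])
          show "plain init1" by (simp add: init1_def)
          have "wp ?B init1 (\<lambda>s'. s' ''cnt'' 0 = 0 \<and> s' ''bl'' 0 = 0 \<and> s' ''ph'' 0 = 0 \<and> s' ''j'' 0 = 0) s"
            by (simp add: init1_def)
          then show "wp ?B init1 (loop1_inv I T (3 * ?n)) s"
          proof (rule wp_conseq[OF bd], elim conjE)
            fix s' assume z: "s' ''cnt'' 0 = 0" "s' ''bl'' 0 = 0" "s' ''ph'' 0 = 0" "s' ''j'' 0 = 0"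
              and fr: "\<And>a. a \<notin> writes init1 \<Longrightarrow> s' a = s a"
            have fr': "s' a = s a" if "a \<notin> {''cnt'', ''bl'', ''ph'', ''j''}" for a
              by (rule fr) (use that in \<open>simp add: init1_def\<close>)
            have "input_ok I s'" by (rule input_ok_cong[OF conjunct1[OF conjunct1[OF R]]]) (rule fr', auto)
            moreover have "phase1_state I T {} s'"
              by (rule phase1_stateI[where mcl = "\<lambda>_. 0" and stk = "\<lambda>_. []" and res = "\<lambda>_. []"])
                (simp_all add: fr' z R phase1_init sched_of_def)
            moreover have "done_jobs I T 0 0 = {}" by (auto simp: done_jobs_def)
            ultimately show "loop1_inv I T (3 * ?n) s'"
              using R n by (simp add: loop1_inv_def fr' z)
          qed
        qed
      next
        fix s assume bd: "bounded ?B s" and R: "loop1_inv I T (3 * ?n) s"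
        show "runs ?B W (Seq ?w2 (Seq init2 ?w3))
          ((3 * ?n * (cost body1 + 21) + 21) + (cost init2 + (4 * ?n * (cost body2 + 21) + 21)))
          (attempt_post I T) s"
        proof (rule runs_Seq[OF runs_loop1[OF v T W R bd]])
          fix s assume bd: "bounded ?B s" and R: "loop1_inv I T 0 s \<and> 3 \<le> s ''ph'' 0"
          from wp_init2[OF _ _ v bd] R obtain l R0 cnt where
            tot: "\<And>f. fits I T f \<Longrightarrow> sum l {..<cnt} + R0 \<le> num_machines I * T" and
            wp: "wp (bnd I) init2 (\<lambda>s'. \<exists>k \<le> 4 * num_jobs I. loop2_inv I T l R0 cnt k s') s"
            by blast
          show "runs ?B W (Seq init2 ?w3) (cost init2 + (4 * ?n * (cost body2 + 21) + 21)) (attempt_post I T) s"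
          proof (rule runs_Seq[OF runs_plain[OF B5 W _ bd wp]])
            show "plain init2" by (simp add: init2_def)
            fix s assume bd: "bounded ?B s" and "\<exists>k \<le> 4 * num_jobs I. loop2_inv I T l R0 cnt k s"
            then obtain k where k: "k \<le> 4 * num_jobs I" "loop2_inv I T l R0 cnt k s" by blast
            show "runs ?B W ?w3 (4 * ?n * (cost body2 + 21) + 21) (attempt_post I T) s"
              by (rule runs_loop2[OF v T W k(2,1) bd]) (rule tot)
          qed
        qed
      qed
    qed
  qed
  then show ?thesis
  proof (rule runs_mono)
    have *: "c \<le> c * ?n" for c :: nat using n by simp
    have "cost (assign ''k'' (Const 0)) + ((?n * (cost reset_body + 21) + 21) +
      (cost init1 + ((3 * ?n * (cost body1 + 21) + 21) + (cost init2 + (4 * ?n * (cost body2 + 21) + 21))))) =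
      (cost (assign ''k'' (Const 0)) + cost init1 + cost init2 + 63) +
      (cost reset_body + 3 * cost body1 + 4 * cost body2 + 168) * ?n"
      by (simp add: algebra_simps)
    also have "\<dots> \<le> (cost (assign ''k'' (Const 0)) + cost init1 + cost init2 + 63) * ?n +
      (cost reset_body + 3 * cost body1 + 4 * cost body2 + 168) * ?n"
      using * by (rule add_right_mono)
    also have "\<dots> \<le> attempt_cost * ?n"
      unfolding attempt_cost_def distrib_right[symmetric] by (rule mult_le_mono1) simp
    finally show "cost (assign ''k'' (Const 0)) + ((?n * (cost reset_body + 21) + 21) +
      (cost init1 + ((3 * ?n * (cost body1 + 21) + 21) + (cost init2 + (4 * ?n * (cost body2 + 21) + 21)))))
      \<le> attempt_cost * ?n" .
  qed
qed

section \<open>Binary search\<close>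

definition sum_body :: com where
  "sum_body = block
     [assign ''hi'' (Bin Plus (V ''hi'') (Bin Plus (Read ''t'' (V ''k'')) (Read ''s'' (Read ''class'' (V ''k''))))),
      assign ''k'' (Bin Plus (V ''k'') (Const 1))]"

definition copy_body :: com where
  "copy_body = block
     [Write ''machine'' (V ''k'') (Read ''bm'' (V ''k'')),
      Write ''start'' (V ''k'') (Read ''bs'' (V ''k'')),
      Write ''kind'' (V ''k'') (Read ''bk'' (V ''k'')),
      Write ''id'' (V ''k'') (Read ''bi'' (V ''k'')),
      assign ''k'' (Bin Plus (V ''k'') (Const 1))]"

text \<open>After a rejection, setting \<open>k\<close> to the buffer length makes the copying loop
  stop at once, so the stored output survives.\<close>

definition decide :: com where
  "decide = Cond (Bin Equal (V ''ph'') (Const 3))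
     (block [assign ''k'' (Const 0), assign ''len'' (V ''bl''), assign ''hi'' (V ''T'')])
     (block [assign ''k'' (V ''bl''), assign ''lo'' (Bin Plus (V ''T'') (Const 1))])"

definition midpoint :: com where
  "midpoint = assign ''T'' (Bin Divide (Bin Plus (V ''lo'') (V ''hi'')) (Const 2))"

definition search_body :: com where
  "search_body = Seq midpoint (Seq attempt (Seq decide
     (While (Bin Less (V ''k'') (V ''bl'')) copy_body)))"

definition init0 :: com where
  "init0 = block [assign ''lo'' (Const 0), assign ''hi'' (Const 1), assign ''k'' (Const 0)]"

definition batch_program :: com where
  "batch_program = Seq init0 (Seq (While (Bin Less (V ''k'') (V ''n'')) sum_body)
     (While (Bin Less (V ''lo'') (V ''hi'')) search_body))"

lemma runs_sum:
  assumes v: "valid_instance I" and W: "20 * bnd I < W" and ok: "input_ok I s"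
    and z: "s ''k'' 0 = 0" "s ''hi'' 0 = 1" and bd: "bounded (bnd I) s"
  shows "runs (bnd I) W (While (Bin Less (V ''k'') (V ''n'')) sum_body)
    (num_jobs I * (cost sum_body + 21) + 21) (\<lambda>s'. s' ''hi'' 0 = Suc (total_work I)) s"
proof -
  let ?w = "\<lambda>j. proc_time I j + setup_time I (class_of I j)"
  define Inv where "Inv k s \<longleftrightarrow> input_ok I s \<and> s ''k'' 0 + k = num_jobs I \<and>
    s ''hi'' 0 = Suc (\<Sum>j < s ''k'' 0. ?w j)" for k and s :: state
  have "runs (bnd I) W (While (Bin Less (V ''k'') (V ''n'')) sum_body)
    (num_jobs I * (cost sum_body + 21) + 21)
    (\<lambda>s'. (\<exists>k. Inv k s') \<and> ev s' (Bin Less (V ''k'') (V ''n'')) = 0) s"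
  proof (rule runs_While[OF _ W _ _ _ bd])
    show "5 \<le> bnd I" by (simp add: bnd_def)
    show "Inv (num_jobs I) s" using ok z by (simp add: Inv_def)
    fix k s assume bd: "bounded (bnd I) s" and inv: "Inv k s"
      and b: "ev s (Bin Less (V ''k'') (V ''n'')) \<noteq> 0"
    show "runs (bnd I) W sum_body (cost sum_body) (\<lambda>s'. \<exists>k'<k. Inv k' s') s"
    proof (rule runs_plain[OF _ W _ bd])
      show "5 \<le> bnd I" by (simp add: bnd_def)
      show "plain sum_body" by (simp add: sum_body_def)
      let ?k = "s ''k'' 0"
      have ok: "input_ok I s" using inv by (simp add: Inv_def)
      have kn: "?k < num_jobs I" using b ok by (simp add: input_ok_def split: if_splits)
      have ic: "class_of I ?k < num_classes I" using v kn by (simp add: valid_instance_def)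
      have eqs: "s ''class'' ?k = class_of I ?k" "s ''t'' ?k = proc_time I ?k"
        "s ''s'' (class_of I ?k) = setup_time I (class_of I ?k)"
        using ok kn ic by (simp_all add: input_ok_def)
      have hi: "s ''hi'' 0 + ?w ?k = Suc (\<Sum>j < Suc ?k. ?w j)" using inv by (simp add: Inv_def)
      have "(\<Sum>j < Suc ?k. ?w j) \<le> total_work I"
        unfolding total_work_def using kn by (intro sum_mono2) auto
      then have b1: "s ''hi'' 0 + ?w ?k \<le> bnd I" unfolding hi by (simp add: bnd_def)
      have b2: "Suc ?k \<le> bnd I" using kn by (simp add: bnd_def)
      let ?s = "s(''hi'' := (s ''hi'')(0 := s ''hi'' 0 + ?w ?k), ''k'' := (s ''k'')(0 := Suc ?k))"
      have "input_ok I ?s" by (rule input_ok_cong[OF ok]) auto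
      moreover have "Suc ?k + (k - 1) = num_jobs I" "k - 1 < k" using inv kn by (auto simp: Inv_def)
      ultimately have "\<exists>k'<k. Inv k' ?s"
        using hi by (intro exI[of _ "k - 1"]) (simp add: Inv_def)
      then show "wp (bnd I) sum_body (\<lambda>s'. \<exists>k'<k. Inv k' s') s"
        unfolding sum_body_def using b1 b2 by (simp add: eqs)
    qed
  qed auto
  then show ?thesis
  proof (rule runs_mono)
    fix s' assume *: "(\<exists>k. Inv k s') \<and> ev s' (Bin Less (V ''k'') (V ''n'')) = 0"
    then obtain k where k: "Inv k s'" by blast
    then have "s' ''n'' 0 = num_jobs I" by (simp add: Inv_def input_ok_def)
    with * k have "s' ''k'' 0 = num_jobs I" by (auto simp: Inv_def split: if_splits)
    with k show "s' ''hi'' 0 = Suc (total_work I)" by (simp add: Inv_def total_work_def)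
  qed simp
qed

lemma sched_of_cong:
  assumes "\<And>k. k < l \<Longrightarrow> M k = M' k \<and> S k = S' k \<and> K k = K' k \<and> X k = X' k"
  shows "sched_of M S K X l = sched_of M' S' K' X' l"
  unfolding sched_of_def by (rule ext, rule map_cong[OF filter_cong]) (use assms in auto)

lemma runs_copy:
  assumes W: "20 * bnd I < W" and bl: "s ''bl'' 0 \<le> k" "s ''k'' 0 = 0" "s ''len'' 0 = s ''bl'' 0"
    and bd: "bounded (bnd I) s"
  shows "runs (bnd I) W (While (Bin Less (V ''k'') (V ''bl'')) copy_body)
    (k * (cost copy_body + 21) + 21) (\<lambda>s'. output_schedule s' = buffer s) s"
proof -
  define Inv where "Inv k s' \<longleftrightarrow> s' ''bl'' = s ''bl'' \<and> s' ''len'' = s ''len'' \<and>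
    s' ''bm'' = s ''bm'' \<and> s' ''bs'' = s ''bs'' \<and> s' ''bk'' = s ''bk'' \<and> s' ''bi'' = s ''bi'' \<and>
    s' ''k'' 0 + k = s ''bl'' 0 \<and>
    (\<forall>q < s' ''k'' 0. s' ''machine'' q = s ''bm'' q \<and> s' ''start'' q = s ''bs'' q \<and>
      s' ''kind'' q = s ''bk'' q \<and> s' ''id'' q = s ''bi'' q)" for k and s' :: state
  have "runs (bnd I) W (While (Bin Less (V ''k'') (V ''bl'')) copy_body)
    (s ''bl'' 0 * (cost copy_body + 21) + 21)
    (\<lambda>s'. (\<exists>k. Inv k s') \<and> ev s' (Bin Less (V ''k'') (V ''bl'')) = 0) s"
  proof (rule runs_While[OF _ W _ _ _ bd])
    show "5 \<le> bnd I" by (simp add: bnd_def)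
    show "Inv (s ''bl'' 0) s" using bl by (simp add: Inv_def)
    fix k s1 assume bd1: "bounded (bnd I) s1" and inv: "Inv k s1"
      and b: "ev s1 (Bin Less (V ''k'') (V ''bl'')) \<noteq> 0"
    show "runs (bnd I) W copy_body (cost copy_body) (\<lambda>s'. \<exists>k'<k. Inv k' s') s1"
    proof (rule runs_plain[OF _ W _ bd1])
      show "5 \<le> bnd I" by (simp add: bnd_def)
      show "plain copy_body" by (simp add: copy_body_def)
      let ?k = "s1 ''k'' 0"
      have kn: "?k < s ''bl'' 0" using b inv by (simp add: Inv_def split: if_splits)
      have le: "s a i \<le> bnd I" for a i using bd by (simp add: bounded_def)
      have b2: "Suc ?k \<le> bnd I" using kn le[of "''bl''" 0] by linarith
      have k: "Suc ?k + (k - 1) = s ''bl'' 0" "k - 1 < k" using inv kn by (auto simp: Inv_def)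
      show "wp (bnd I) copy_body (\<lambda>s'. \<exists>k'<k. Inv k' s') s1"
        unfolding copy_body_def using b2 le inv k
        by (auto simp: Inv_def less_Suc_eq intro!: exI[of _ "k - 1"])
    qed
  qed auto
  then show ?thesis
  proof (rule runs_mono)
    show "s ''bl'' 0 * (cost copy_body + 21) + 21 \<le> k * (cost copy_body + 21) + 21"
      by (intro add_right_mono mult_le_mono1 bl)
    fix s' assume *: "(\<exists>k. Inv k s') \<and> ev s' (Bin Less (V ''k'') (V ''bl'')) = 0"
    then obtain k where k: "Inv k s'" by blast
    with * have "s' ''k'' 0 = s ''bl'' 0" "s' ''len'' 0 = s ''bl'' 0"
      using bl by (auto simp: Inv_def split: if_splits)
    with k show "output_schedule s' = buffer s"
      unfolding output_schedule_eq by (auto simp: Inv_def intro!: sched_of_cong)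
  qed
qed

section \<open>Number of search steps\<close>

fun halvings :: "nat \<Rightarrow> nat" where
  "halvings 0 = 0"
| "halvings (Suc d) = Suc (halvings (Suc d div 2))"

lemma halvings_pos: "0 < d \<Longrightarrow> halvings d = Suc (halvings (d div 2))"
  by (cases d) auto

lemma halvings_mono: "d \<le> e \<Longrightarrow> halvings d \<le> halvings e"
proof (induction e arbitrary: d rule: less_induct)
  case (less e)
  show ?case
  proof (cases "d = 0")
    case False
    with less.prems have "0 < e" by simp
    then have "halvings (d div 2) \<le> halvings (e div 2)"
      using less.prems by (intro less.IH div_le_mono) auto
    with False \<open>0 < e\<close> show ?thesis by (simp add: halvings_pos)
  qed simp
qed

lemma halvings_less: "0 < d \<Longrightarrow> d' \<le> d div 2 \<Longrightarrow> halvings d' < halvings d"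
  using halvings_mono[of d' "d div 2"] by (simp add: halvings_pos)

text \<open>For positive d, \<open>halvings d\<close> is the number of binary digits of d, hence at
  most log 2 d + 1.\<close>

lemma halvings_power: "0 < d \<Longrightarrow> 2 ^ halvings d \<le> 2 * d"
proof (induction d rule: less_induct)
  case (less d)
  show ?case
  proof (cases "d div 2 = 0")
    case True
    with less.prems show ?thesis by (simp add: halvings_pos)
  next
    case False
    then have "2 ^ halvings (d div 2) \<le> 2 * (d div 2)" using less by auto
    with less.prems show ?thesis by (simp add: halvings_pos)
  qed
qed

text \<open>The initial upper limit \<^term>\<open>Suc (total_work I)\<close> has not been tested; it cannot survive the search,
  because all jobs fit on one machine of load \<^term>\<open>total_work I\<close>.\<close>

definition search_inv :: "batch_instance \<Rightarrow> nat \<Rightarrow> state \<Rightarrow> bool" where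
  "search_inv I k s \<longleftrightarrow> input_ok I s \<and> (\<forall>T<s ''lo'' 0. \<forall>f. \<not> fits I T f) \<and>
     s ''lo'' 0 \<le> s ''hi'' 0 \<and> s ''hi'' 0 \<le> Suc (total_work I) \<and>
     (s ''hi'' 0 = Suc (total_work I) \<or> feasible I (output_schedule s) \<and>
        makespan I (output_schedule s) \<le> 3 / 2 * real (s ''hi'' 0)) \<and>
     k = halvings (s ''hi'' 0 - s ''lo'' 0)"

definition search_cost :: nat where
  "search_cost = cost midpoint + attempt_cost + cost decide + 2 * cost copy_body + 63"

lemma frame_attempt:
  assumes "\<And>a. a \<notin> writes attempt \<Longrightarrow> s' a = s a"
    "a \<in> {''m'', ''n'', ''c'', ''t'', ''class'', ''s'', ''T'', ''lo'', ''hi'',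
      ''machine'', ''start'', ''kind'', ''id'', ''len''}"
  shows "s' a = s a"
  by (rule assms(1)) (use assms(2) in \<open>auto simp: attempt_def reset_body_def init1_def init2_def
    body1_def classify_def handle_def next_job_def put_def open_machine_def defer_job_def
    body2_def advance_def place_new_def place_old_def emit_def\<close>)

text \<open>With T the rounded-down midpoint, the new interval is either from lo to T or from T + 1
  to hi. In both cases its length is at most half the old one, rounded down.\<close>

lemma runs_search_body:
  assumes v: "valid_instance I" and W: "20 * bnd I < W"
    and inv: "search_inv I k s" and lt: "s ''lo'' 0 < s ''hi'' 0" and bd: "bounded (bnd I) s"
  shows "runs (bnd I) W search_body (search_cost * num_jobs I) (\<lambda>s'. \<exists>k'<k. search_inv I k' s') s"
proof -
  let ?B = "bnd I" and ?n = "num_jobs I"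
  have B5: "5 \<le> ?B" by (simp add: bnd_def)
  have n: "1 \<le> ?n" using v by (simp add: valid_instance_def)
  let ?w = "While (Bin Less (V ''k'') (V ''bl'')) copy_body"
  let ?lo = "s ''lo'' 0" and ?hi = "s ''hi'' 0"
  define T where "T = (?lo + ?hi) div 2"
  have T: "?lo \<le> T" "T < ?hi" using lt by (auto simp: T_def)
  have ok: "input_ok I s" and hi: "?hi \<le> Suc (total_work I)" using inv by (auto simp: search_inv_def)
  have Tt: "T \<le> total_work I" using T hi by simp
  have k: "k = halvings (?hi - ?lo)" using inv by (simp add: search_inv_def)
  have TB: "T \<le> ?B" "Suc T \<le> ?B" using Tt by (auto simp: bnd_def)
  let ?Q = "\<lambda>s'. \<exists>k'<k. search_inv I k' s'"
  let ?R = "\<lambda>s'. input_ok I s' \<and> s' ''T'' 0 = T \<and> s' ''lo'' 0 = ?lo \<and> s' ''hi'' 0 = ?hi \<and>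
    output_schedule s' = output_schedule s"
  have "runs ?B W search_body
    (cost midpoint + (attempt_cost * ?n + (cost decide + (2 * ?n * (cost copy_body + 21) + 21)))) ?Q s"
    unfolding search_body_def
  proof (rule runs_Seq)
    show "runs ?B W midpoint (cost midpoint) ?R s"
    proof (rule runs_plain[OF B5 W _ bd])
      show "plain midpoint" by (simp add: midpoint_def)
      have "input_ok I (s(''T'' := (s ''T'')(0 := T)))" by (rule input_ok_cong[OF ok]) auto
      then show "wp ?B midpoint ?R s" unfolding midpoint_def
        using TB by (simp add: T_def[symmetric] output_schedule_eq)
    qed
  next
    fix s1 assume bd1: "bounded ?B s1" and R1: "?R s1"
    show "runs ?B W (Seq attempt (Seq decide ?w))
      (attempt_cost * ?n + (cost decide + (2 * ?n * (cost copy_body + 21) + 21))) ?Q s1"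
    proof (rule runs_Seq[OF runs_frame[OF runs_attempt[OF v Tt W _ _ bd1]]])
      show "input_ok I s1" "s1 ''T'' 0 = T" using R1 by simp_all
      fix s2 assume bd2: "bounded ?B s2"
        and *: "attempt_post I T s2 \<and> (\<forall>a. a \<notin> writes attempt \<longrightarrow> s2 a = s1 a)"
      have post: "attempt_post I T s2" using * by (rule conjunct1)
      have fr: "s2 a = s1 a" if "a \<in> {''m'', ''n'', ''c'', ''t'', ''class'', ''s'', ''T'', ''lo'', ''hi'',
          ''machine'', ''start'', ''kind'', ''id'', ''len''}" for a
        by (rule frame_attempt[OF _ that]) (use * in blast)
      have ok2: "input_ok I s2" by (rule input_ok_cong[OF conjunct1[OF R1]]) (rule fr, auto)
      have e2: "s2 ''T'' 0 = T" "s2 ''lo'' 0 = ?lo" "s2 ''hi'' 0 = ?hi"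
        "output_schedule s2 = output_schedule s"
        using R1 by (simp_all add: fr output_schedule_eq)
      have le2: "s2 a i \<le> ?B" for a i using bd2 by (simp add: bounded_def)
      have pd: "plain decide" by (simp add: decide_def)
      show "runs ?B W (Seq decide ?w) (cost decide + (2 * ?n * (cost copy_body + 21) + 21)) ?Q s2"
      proof (cases "s2 ''ph'' 0 = 3")
        case True
        then have good: "feasible I (buffer s2)" "makespan I (buffer s2) \<le> 3 / 2 * real T"
          "s2 ''bl'' 0 \<le> 2 * ?n" using post by (auto simp: attempt_post_def)
        let ?s = "s2(''k'' := (s2 ''k'')(0 := 0), ''len'' := (s2 ''len'')(0 := s2 ''bl'' 0),
          ''hi'' := (s2 ''hi'')(0 := T))"
        show ?thesis
        proof (rule runs_Seq[OF runs_plain[OF B5 W pd bd2]])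
          show "wp ?B decide (\<lambda>s'. s' = ?s) s2"
            unfolding decide_def using True le2 TB by (simp add: e2)
          fix s3 assume bd3: "bounded ?B s3" and s3: "s3 = ?s"
          have "runs ?B W ?w (2 * ?n * (cost copy_body + 21) + 21)
            (\<lambda>s'. output_schedule s' = buffer s3) s3"
            by (rule runs_copy[OF W _ _ _ bd3]) (use good in \<open>simp_all add: s3\<close>)
          from runs_frame[OF this]
          show "runs ?B W ?w (2 * ?n * (cost copy_body + 21) + 21) ?Q s3"
          proof (rule runs_mono)
            fix s' assume **: "output_schedule s' = buffer s3 \<and> (\<forall>a. a \<notin> writes ?w \<longrightarrow> s' a = s3 a)"
            have fr': "s' a = s3 a" if "a \<notin> {''machine'', ''start'', ''kind'', ''id'', ''k''}" for a
              using that conjunct2[OF **] by (simp add: copy_body_def)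
            have ok3: "input_ok I s3" by (rule input_ok_cong[OF ok2]) (auto simp: s3)
            have ok': "input_ok I s'" by (rule input_ok_cong[OF ok3]) (rule fr', auto)
            have out: "output_schedule s' = buffer s2" using conjunct1[OF **] by (simp add: s3)
            have e': "s' ''lo'' 0 = ?lo" "s' ''hi'' 0 = T" by (simp_all add: fr' s3 e2)
            have "search_inv I (halvings (T - ?lo)) s'"
              using inv ok' out good T Tt by (simp add: search_inv_def e')
            moreover have "halvings (T - ?lo) < k"
              unfolding k by (rule halvings_less) (use lt in \<open>auto simp: T_def\<close>)
            ultimately show "?Q s'" by blast
          qed simp
        qed
      next
        case False
        then have nf: "\<not> fits I T f" for f using post by (auto simp: attempt_post_def)
        let ?s = "s2(''k'' := (s2 ''k'')(0 := s2 ''bl'' 0), ''lo'' := (s2 ''lo'')(0 := Suc T))"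
        show ?thesis
        proof (rule runs_Seq[OF runs_plain[OF B5 W pd bd2]])
          show "wp ?B decide (\<lambda>s'. s' = ?s) s2"
            unfolding decide_def using False le2 TB by (simp add: e2)
          fix s3 assume bd3: "bounded ?B s3" and s3: "s3 = ?s"
          \<comment> \<open>The guard is false at the start, so the variant 0 suffices.\<close>
          have "runs ?B W ?w (0 * (cost copy_body + 21) + 21)
            (\<lambda>s'. (\<exists>k::nat. s' = s3 \<and> k = 0) \<and> ev s' (Bin Less (V ''k'') (V ''bl'')) = 0) s3"
            by (rule runs_While[OF B5 W _ _ _ bd3]) (auto simp: s3)
          then show "runs ?B W ?w (2 * ?n * (cost copy_body + 21) + 21) ?Q s3"
          proof (rule runs_mono)
            fix s' assume "(\<exists>k::nat. s' = s3 \<and> k = 0) \<and> ev s' (Bin Less (V ''k'') (V ''bl'')) = 0"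
            then have s': "s' = ?s" by (simp add: s3)
            have ok': "input_ok I s'" by (rule input_ok_cong[OF ok2]) (auto simp: s')
            have out: "output_schedule s' = output_schedule s"
              using e2(4) by (simp add: s' output_schedule_eq)
            have e': "s' ''lo'' 0 = Suc T" "s' ''hi'' 0 = ?hi" by (simp_all add: s' e2)
            \<comment> \<open>Rejecting T excludes all smaller values too, by monotonicity of
              \<open>fits\<close>.\<close>
            have nf': "\<not> fits I T' f" if "T' < Suc T" for T' f
              using nf fits_mono[of I T' f T] that by auto
            have "search_inv I (halvings (?hi - Suc T)) s'"
              using inv ok' out T nf' by (simp add: search_inv_def e')
            moreover have "halvings (?hi - Suc T) < k"
              unfolding k by (rule halvings_less) (use lt in \<open>auto simp: T_def\<close>)
            ultimately show "?Q s'" by blast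
          qed simp
        qed
      qed
    qed
  qed
  then show ?thesis
  proof (rule runs_mono)
    have *: "c \<le> c * ?n" for c :: nat using n by simp
    have "cost midpoint + (attempt_cost * ?n + (cost decide + (2 * ?n * (cost copy_body + 21) + 21))) =
      (cost midpoint + cost decide + 21) + (attempt_cost + 2 * cost copy_body + 42) * ?n"
      by (simp add: algebra_simps)
    also have "\<dots> \<le> (cost midpoint + cost decide + 21) * ?n + (attempt_cost + 2 * cost copy_body + 42) * ?n"
      using * by (rule add_right_mono)
    also have "\<dots> \<le> search_cost * ?n"
      unfolding search_cost_def distrib_right[symmetric] by (rule mult_le_mono1) simp
    finally show "cost midpoint + (attempt_cost * ?n + (cost decide + (2 * ?n * (cost copy_body + 21) + 21)))
      \<le> search_cost * ?n" .
  qed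
qed

section \<open>Word size, running time and approximation ratio in terms of the input\<close>

lemma input_state_ok: "input_ok I (input_state I)"
  by (simp add: input_ok_def input_state_def)

lemma setup_le_total:
  assumes "valid_instance I" "i < num_classes I"
  shows "setup_time I i \<le> total_work I"
proof -
  have "class_jobs I i \<noteq> {}" using assms by (simp add: valid_instance_def)
  then obtain j where "j < num_jobs I" "class_of I j = i" by (auto simp: class_jobs_def)
  with total_work_ge[of j I] show ?thesis by simp
qed

lemma input_state_bounded:
  assumes v: "valid_instance I"
  shows "bounded (bnd I) (input_state I)"
proof -
  have "proc_time I j \<le> bnd I" if "j < num_jobs I" for j
    using total_work_ge[OF that] by (simp add: bnd_def)
  moreover have "class_of I j \<le> bnd I" if "j < num_jobs I" for j
  proof -
    have "class_of I j < num_classes I" using v that by (simp add: valid_instance_def)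
    with num_classes_le[OF v] show ?thesis by (simp add: bnd_def)
  qed
  moreover have "setup_time I i \<le> bnd I" if "i < num_classes I" for i
    using setup_le_total[OF v that] by (simp add: bnd_def)
  moreover have "num_classes I \<le> bnd I" "num_jobs I \<le> bnd I" "num_machines I \<le> bnd I"
    using num_classes_le[OF v] by (simp_all add: bnd_def)
  ultimately show ?thesis by (simp add: bounded_def input_state_def)
qed

lemma total_le_Delta:
  assumes v: "valid_instance I"
  shows "total_work I \<le> 2 * num_jobs I * Delta I" "1 \<le> Delta I"
proof -
  have p: "proc_time I j \<le> Delta I" if "j < num_jobs I" for j
  proof -
    have "proc_time I j \<le> max_proc I" unfolding max_proc_def using that by (intro Max_ge) auto
    then show ?thesis by (simp add: Delta_def)
  qed
  have st: "setup_time I i \<le> Delta I" if "i < num_classes I" for i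
  proof -
    have "setup_time I i \<le> max_setup I" unfolding max_setup_def using that by (intro Max_ge) auto
    then show ?thesis by (simp add: Delta_def)
  qed
  have "proc_time I j + setup_time I (class_of I j) \<le> 2 * Delta I" if "j < num_jobs I" for j
    using p[OF that] st[of "class_of I j"] v that by (fastforce simp: valid_instance_def)
  then have "total_work I \<le> (\<Sum>j<num_jobs I. 2 * Delta I)" unfolding total_work_def by (intro sum_mono) simp
  then show "total_work I \<le> 2 * num_jobs I * Delta I" by (simp add: algebra_simps)
  have "0 < num_jobs I" "1 \<le> proc_time I 0" using v by (auto simp: valid_instance_def)
  with p[of 0] show "1 \<le> Delta I" by simp
qed

text \<open>\<open>bnd I\<close> is quadratic in N, the base of the word bound. Since N is at least
  3, the constant factor is absorbed by 243 = 3 ^ 5, which gives the exponent 2 + 5.\<close>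

lemma bnd_less_word_bound:
  assumes v: "valid_instance I"
  shows "20 * bnd I < word_bound 7 I"
proof -
  define N where "N = num_jobs I + num_machines I + Delta I"
  have N3: "3 \<le> N" using total_le_Delta(2)[OF v] v by (simp add: N_def valid_instance_def)
  have "num_jobs I * Delta I \<le> N * N" by (rule mult_le_mono) (simp_all add: N_def)
  then have t: "total_work I \<le> 2 * (N * N)" using total_le_Delta(1)[OF v] by simp
  have 3: "3 * N \<le> N * N" using N3 by (rule mult_le_mono1)
  have "bnd I \<le> 10 + 4 * N + 8 * (N * N)" using t by (simp add: bnd_def N_def)
  then have "20 * bnd I < 243 * (N * N)" using 3 N3 by linarith
  also have "243 * (N * N) \<le> N ^ 5 * (N * N)"
    using power_mono[OF N3, of 5] by (intro mult_le_mono1) simp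
  also have "\<dots> = N ^ 7" by (simp add: eval_nat_numeral)
  finally show ?thesis by (simp add: word_bound_def N_def)
qed

text \<open>With M = n + Delta, the search interval has length at most 2 n Delta + 1, which is at
  most M ^ 2. The factor 2 from \<open>halvings_power\<close> is at most M, hence the exponent
  3.\<close>

lemma halvings_total:
  assumes v: "valid_instance I"
  shows "real (halvings (Suc (total_work I))) \<le> 3 * log 2 (real (num_jobs I + Delta I))"
    "1 \<le> log 2 (real (num_jobs I + Delta I))"
proof -
  define M where "M = num_jobs I + Delta I"
  have n: "1 \<le> num_jobs I" using v by (simp add: valid_instance_def)
  have D: "1 \<le> Delta I" by (rule total_le_Delta(2)[OF v])
  have M2: "2 \<le> M" using n D by (simp add: M_def)
  have "Suc (total_work I) \<le> 1 + 2 * (num_jobs I * Delta I)" using total_le_Delta(1)[OF v] by simp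
  also have "\<dots> \<le> M * M"
  proof -
    have "M * M = num_jobs I * num_jobs I + 2 * (num_jobs I * Delta I) + Delta I * Delta I"
      by (simp add: M_def algebra_simps)
    then show ?thesis using mult_le_mono[OF n n] by linarith
  qed
  finally have "Suc (total_work I) \<le> M * M" .
  then have "2 ^ halvings (Suc (total_work I)) \<le> 2 * (M * M)"
    using halvings_power[OF zero_less_Suc[of "total_work I"]] by (meson le_trans mult_le_mono2)
  also have "\<dots> \<le> M * (M * M)" using M2 by (rule mult_le_mono1)
  finally have "2 ^ halvings (Suc (total_work I)) \<le> M ^ 3" by (simp add: power3_eq_cube)
  then have "(2::real) ^ halvings (Suc (total_work I)) \<le> real M ^ 3"
    by (metis of_nat_le_iff of_nat_numeral of_nat_power)
  then have "log 2 (2 ^ halvings (Suc (total_work I))) \<le> log 2 (real M ^ 3)"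
    using M2 by (subst log_le_cancel_iff) auto
  then show "real (halvings (Suc (total_work I))) \<le> 3 * log 2 (real (num_jobs I + Delta I))"
    using M2 by (simp add: log_nat_power M_def del: halvings.simps)
  have "log 2 2 \<le> log 2 (real M)" using M2 by (subst log_le_cancel_iff) auto
  then show "1 \<le> log 2 (real (num_jobs I + Delta I))" by (simp add: M_def)
qed

lemma runs_batch_program:
  assumes v: "valid_instance I" and W: "20 * bnd I < W"
  shows "runs (bnd I) W batch_program
    (cost init0 + ((num_jobs I * (cost sum_body + 21) + 21) +
      (halvings (Suc (total_work I)) * (search_cost * num_jobs I + 21) + 21)))
    (\<lambda>s. feasible I (output_schedule s) \<and> makespan I (output_schedule s) \<le> 3 / 2 * OPT_nonp I)
    (input_state I)"
  unfolding batch_program_def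
proof (rule runs_Seq)
  have B5: "5 \<le> bnd I" by (simp add: bnd_def)
  show "runs (bnd I) W init0 (cost init0)
    (\<lambda>s. input_ok I s \<and> s ''lo'' 0 = 0 \<and> s ''hi'' 0 = 1 \<and> s ''k'' 0 = 0) (input_state I)"
    by (rule runs_plain[OF B5 W _ input_state_bounded[OF v]])
      (use input_state_ok[of I] B5 in \<open>simp_all add: init0_def input_ok_def\<close>)
  fix s assume bd: "bounded (bnd I) s"
    and R: "input_ok I s \<and> s ''lo'' 0 = 0 \<and> s ''hi'' 0 = 1 \<and> s ''k'' 0 = 0"
  let ?w = "While (Bin Less (V ''k'') (V ''n'')) sum_body"
  let ?w2 = "While (Bin Less (V ''lo'') (V ''hi'')) search_body"
  let ?k = "halvings (Suc (total_work I))"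
  have ok: "input_ok I s" using R by simp
  show "runs (bnd I) W (Seq ?w ?w2) ((num_jobs I * (cost sum_body + 21) + 21) +
      (?k * (search_cost * num_jobs I + 21) + 21))
    (\<lambda>s. feasible I (output_schedule s) \<and> makespan I (output_schedule s) \<le> 3 / 2 * OPT_nonp I) s"
  proof (rule runs_Seq)
    have "runs (bnd I) W ?w (num_jobs I * (cost sum_body + 21) + 21) (\<lambda>s'. s' ''hi'' 0 = Suc (total_work I)) s"
      by (rule runs_sum[OF v W ok _ _ bd]) (use R in simp_all)
    from runs_frame[OF this]
    show "runs (bnd I) W ?w (num_jobs I * (cost sum_body + 21) + 21) (search_inv I ?k) s"
    proof (rule runs_mono)
      fix s' assume *: "s' ''hi'' 0 = Suc (total_work I) \<and> (\<forall>a. a \<notin> writes ?w \<longrightarrow> s' a = s a)"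
      have fr: "s' a = s a" if "a \<notin> {''hi'', ''k''}" for a
        using that conjunct2[OF *] by (simp add: sum_body_def)
      have "input_ok I s'" by (rule input_ok_cong[OF ok]) (rule fr, auto)
      then show "search_inv I ?k s'" using R conjunct1[OF *] by (simp add: search_inv_def fr)
    qed simp
  next
    fix s assume bd: "bounded (bnd I) s" and inv: "search_inv I ?k s"
    show "runs (bnd I) W ?w2 (?k * (search_cost * num_jobs I + 21) + 21)
      (\<lambda>s. feasible I (output_schedule s) \<and> makespan I (output_schedule s) \<le> 3 / 2 * OPT_nonp I) s"
    proof (rule runs_mono[OF runs_While[where Inv = "search_inv I", OF B5 W _ _ _ bd inv]])
      fix k s assume "bounded (bnd I) s" "search_inv I k s" "ev s (Bin Less (V ''lo'') (V ''hi'')) \<noteq> 0"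
      then show "runs (bnd I) W search_body (search_cost * num_jobs I) (\<lambda>s'. \<exists>k'<k. search_inv I k' s') s"
        by (intro runs_search_body[OF v W]) (auto split: if_splits)
    next
      fix s' assume *: "(\<exists>k'. search_inv I k' s') \<and> ev s' (Bin Less (V ''lo'') (V ''hi'')) = 0"
      then obtain k' where inv: "search_inv I k' s'" by blast
      with * have eq: "s' ''lo'' 0 = s' ''hi'' 0" by (auto simp: search_inv_def split: if_splits)
      have nf: "\<not> fits I T f" if "T < s' ''hi'' 0" for T f
        using inv that by (simp add: search_inv_def eq)
      have "s' ''hi'' 0 \<noteq> Suc (total_work I)"
        using nf[of "total_work I" "\<lambda>_. 0"] fits_single_machine[OF v] by (auto simp: total_work_def)
      then have good: "feasible I (output_schedule s')"
        "makespan I (output_schedule s') \<le> 3 / 2 * real (s' ''hi'' 0)"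
        using inv by (auto simp: search_inv_def)
      \<comment> \<open>No value below the final limit admits an assignment, so the limit itself is
        a lower bound for the optimum, and the stored schedule is within 3/2 of it.\<close>
      have "real (s' ''hi'' 0) \<le> OPT_nonp I" by (rule le_OPT_nonp[OF good(1) nf])
      with good show "feasible I (output_schedule s') \<and>
        makespan I (output_schedule s') \<le> 3 / 2 * OPT_nonp I" by simp
    qed auto
  qed
qed

theorem theoremD1:
  "\<exists>(p :: com) (d :: nat) (K :: real). \<forall>I. valid_instance I \<longrightarrow>
     (\<exists>k s. exec (word_bound d I) p (input_state I) k s \<and>
        feasible I (output_schedule s) \<and>
        makespan I (output_schedule s) \<le> 3 / 2 * OPT_nonp I \<and>
        real k \<le> K * (real (num_jobs I) * log 2 (real (num_jobs I + Delta I))))"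
proof -
  \<comment> \<open>The factor 3 is that of \<open>halvings_total\<close>; the costs outside the
    search are absorbed because n times the logarithm is at least n and at least 1.\<close>
  define K where "K = real (cost init0 + cost sum_body + 42 + 21) + 3 * real (search_cost + 21)"
  have "\<exists>k s. exec (word_bound 7 I) batch_program (input_state I) k s \<and>
        feasible I (output_schedule s) \<and>
        makespan I (output_schedule s) \<le> 3 / 2 * OPT_nonp I \<and>
        real k \<le> K * (real (num_jobs I) * log 2 (real (num_jobs I + Delta I)))"
    if v: "valid_instance I" for I
  proof -
    let ?n = "real (num_jobs I)" and ?h = "real (halvings (Suc (total_work I)))"
    let ?L = "log 2 (real (num_jobs I + Delta I))"
    from runs_batch_program[OF v bnd_less_word_bound[OF v]] obtain k s where
      ex: "exec (word_bound 7 I) batch_program (input_state I) k s" and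
      kle: "k \<le> cost init0 + ((num_jobs I * (cost sum_body + 21) + 21) +
        (halvings (Suc (total_work I)) * (search_cost * num_jobs I + 21) + 21))" and
      good: "feasible I (output_schedule s)" "makespan I (output_schedule s) \<le> 3 / 2 * OPT_nonp I"
      unfolding runs_def by blast
    have n: "1 \<le> ?n" using v by (simp add: valid_instance_def)
    note L = halvings_total[OF v]
    have nL: "?n \<le> ?n * ?L" using mult_left_mono[OF L(2), of ?n] by simp
    have hn: "?h * ?n \<le> 3 * (?n * ?L)"
      using mult_right_mono[OF L(1), of ?n] by (simp add: mult_ac)
    have "real k \<le> real (cost init0 + ((num_jobs I * (cost sum_body + 21) + 21) +
        (halvings (Suc (total_work I)) * (search_cost * num_jobs I + 21) + 21)))"
      using kle by (rule of_nat_mono)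
    also have "\<dots> = real (cost init0 + 42) * 1 + real (cost sum_body + 21) * ?n +
        (real search_cost * (?h * ?n) + 21 * (?h * 1))"
      by (simp add: algebra_simps)
    also have "\<dots> \<le> real (cost init0 + 42) * (?n * ?L) + real (cost sum_body + 21) * (?n * ?L) +
        (real search_cost * (3 * (?n * ?L)) + 21 * (3 * (?n * ?L)))"
    proof (intro add_mono mult_left_mono)
      show "1 \<le> ?n * ?L" using n nL by linarith
      have "?h * 1 \<le> ?h * ?n" using n by (intro mult_left_mono) auto
      then show "?h * 1 \<le> 3 * (?n * ?L)" using hn by linarith
    qed (use nL hn in auto)
    also have "\<dots> = K * (?n * ?L)" by (simp add: K_def algebra_simps)
    finally show ?thesis using ex good by blast
  qed
  then show ?thesis by blast
qed

end
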